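(* Let $d\ge1$. For all $m\in\mathbb{N}$ with $4m>d$ there exists an $a>0$ such that for any strongly elliptic operator $H=-\sum_{i,j=1}^d\partial_i c_{ij}\partial_j$ on $L_2(\mathbb{R}^d)$ with measurable coefficients $C=(c_{ij})$, \[ a\,|B_C(x;r)|\ \ge\ K_{(I+r^2H)^{-2m}}(x;x)^{-1}\ \ge\ \|(I+r^2H)^{-m}\|_{2\to\infty}^{-2} \] for all $x\in\mathbb{R}^d$ and $r>0$.
   Context: The coefficients $c_{ij}$ are real-valued $L_\infty(\mathbb{R}^d)$ functions with $C=(c_{ij})$ symmetric; strongly elliptic means that there is a $\mu>0$ with $C\ge\mu I$ almost everywhere. Then $H$ is the positive self-adjoint operator associated with the closed form $h(\varphi)=\sum_{i,j}(\partial_i\varphi,c_{ij}\partial_j\varphi)$ with domain $W^{1,2}(\mathbb{R}^d)$. The distance is $d_C(x;y)=\sup\{|\psi(x)-\psi(y)|:\psi\in\mathcal D\}$, where $\mathcal D$ is the set of real $\psi\in C_c^\infty(\mathbb{R}^d)$ with $\|\sum_{i,j=1}^d c_{ij}(\partial_i\psi)(\partial_j\psi)\|_\infty\le1$, and $B_C(x;r)=\{y\in\mathbb{R}^d:d_C(x;y)<r\}$; $|\cdot|$ of a set is Lebesgue measure. $K_S$ denotes the distribution (integral) kernel of a bounded operator $S$ on $L_2(\mathbb{R}^d)$; for $4m>d$ the kernel $K_{(I+r^2H)^{-2m}}$ is a continuous function on $\mathbb{R}^d\times\mathbb{R}^d$, so its diagonal values are well defined. $\|\cdot\|_{2\to\infty}$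 is the operator norm from $L_2(\mathbb{R}^d)$ to $L_\infty(\mathbb{R}^d)$. The constant $a$ depends on $m$ (and $d$) but not on $H$, $x$ or $r$. *)

theory Defs
  imports "HOL-Probability.Essential_Supremum"
begin

definition partial :: "'n::finite \<Rightarrow> (real^'n \<Rightarrow> 'b::real_normed_vector) \<Rightarrow> real^'n \<Rightarrow> 'b" where
  "partial i f x = frechet_derivative f (at x) (axis i 1)"

primrec Ck :: "nat \<Rightarrow> (real^'n::finite \<Rightarrow> 'b::real_normed_vector) \<Rightarrow> bool" where
  "Ck 0 f \<longleftrightarrow> continuous_on UNIV f"
| "Ck (Suc k) f \<longleftrightarrow> f differentiable_on UNIV \<and> (\<forall>i. Ck k (partial i f))"

definition test_functions :: "(real^'n::finite \<Rightarrow> 'b::real_normed_vector) set" where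
  "test_functions = {\<phi>. (\<forall>k. Ck k \<phi>) \<and> compact (closure {x. \<phi> x \<noteq> 0})}"

text \<open>Elements of $L_2$ are represented by functions; operators on $L_2$ are represented by
  relations between functions that respect equality almost everywhere.\<close>

definition L2 :: "(real^'n::finite \<Rightarrow> complex) set" where
  "L2 = {f \<in> borel_measurable lebesgue. integrable lebesgue (\<lambda>x. (cmod (f x))\<^sup>2)}"

definition L2_inner :: "(real^'n::finite \<Rightarrow> complex) \<Rightarrow> (real^'n \<Rightarrow> complex) \<Rightarrow> complex" where
  "L2_inner f g = (\<integral>x. cnj (f x) * g x \<partial>lebesgue)"

definition L2_norm :: "(real^'n::finite \<Rightarrow> complex) \<Rightarrow> real" where
  "L2_norm f = sqrt (\<integral>x. (cmod (f x))\<^sup>2 \<partial>lebesgue)"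

definition Linf_norm :: "(real^'n::finite \<Rightarrow> 'b::real_normed_vector) \<Rightarrow> ennreal" where
  "Linf_norm f = esssup lebesgue (\<lambda>x. ennreal (norm (f x)))"

definition is_weak_gradient :: "(real^'n::finite \<Rightarrow> complex) \<Rightarrow> (real^'n \<Rightarrow> complex^'n) \<Rightarrow> bool" where
  "is_weak_gradient u G \<longleftrightarrow>
     (\<forall>i. (\<lambda>x. G x $ i) \<in> L2 \<and>
       (\<forall>\<phi>\<in>test_functions. (\<integral>x. u x * partial i \<phi> x \<partial>lebesgue) = - (\<integral>x. G x $ i * \<phi> x \<partial>lebesgue)))"

definition W12 :: "(real^'n::finite \<Rightarrow> complex) set" where
  "W12 = {u \<in> L2. \<exists>G. is_weak_gradient u G}"

text \<open>Weak gradients are unique only up to null sets; every use below is under an integral.\<close>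

definition weak_gradient :: "(real^'n::finite \<Rightarrow> complex) \<Rightarrow> real^'n \<Rightarrow> complex^'n" where
  "weak_gradient u = (SOME G. is_weak_gradient u G)"

definition strongly_elliptic :: "(real^'n::finite \<Rightarrow> real^'n^'n) \<Rightarrow> bool" where
  "strongly_elliptic C \<longleftrightarrow>
     (\<forall>i j. (\<lambda>x. C x $ i $ j) \<in> borel_measurable lebesgue \<and> Linf_norm (\<lambda>x. C x $ i $ j) < \<infinity>) \<and>
     (AE x in lebesgue. transpose (C x) = C x) \<and>
     (\<exists>\<mu>>0. AE x in lebesgue. \<forall>\<xi>. \<mu> * (\<xi> \<bullet> \<xi>) \<le> \<xi> \<bullet> (C x *v \<xi>))"

text \<open>The sesquilinear form, antilinear in the first argument, whose quadratic form is $h$.\<close>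

definition elliptic_form ::
    "(real^'n::finite \<Rightarrow> real^'n^'n) \<Rightarrow> (real^'n \<Rightarrow> complex) \<Rightarrow> (real^'n \<Rightarrow> complex) \<Rightarrow> complex" where
  "elliptic_form C v u =
     (\<Sum>i\<in>UNIV. \<Sum>j\<in>UNIV.
        L2_inner (\<lambda>x. weak_gradient v x $ i)
                 (\<lambda>x. complex_of_real (C x $ i $ j) * weak_gradient u x $ j))"

text \<open>The graph of the self-adjoint operator $H$ associated with the form:
  $(u,f)$ belongs to it iff $u \in D(H)$ and $Hu = f$.\<close>

definition elliptic_operator ::
    "(real^'n::finite \<Rightarrow> real^'n^'n) \<Rightarrow> ((real^'n \<Rightarrow> complex) \<times> (real^'n \<Rightarrow> complex)) set" where
  "elliptic_operator C =
     {(u, f). u \<in> W12 \<and> f \<in> L2 \<and> (\<forall>v\<in>W12. elliptic_form C v u = L2_inner v f)}"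

text \<open>The graph of $(I + r^2 H)^{-k}$, as the $k$-fold composition of the inverse relation
  of the graph of $I + r^2 H$.\<close>

definition resolvent_power ::
    "(real^'n::finite \<Rightarrow> real^'n^'n) \<Rightarrow> real \<Rightarrow> nat \<Rightarrow> ((real^'n \<Rightarrow> complex) \<times> (real^'n \<Rightarrow> complex)) set" where
  "resolvent_power C r k =
     ({(u, \<lambda>x. u x + complex_of_real (r\<^sup>2) * f x) | u f. (u, f) \<in> elliptic_operator C}\<inverse>) ^^ k"

definition norm_2_inf :: "((real^'n::finite \<Rightarrow> complex) \<times> (real^'n \<Rightarrow> complex)) set \<Rightarrow> ennreal" where
  "norm_2_inf S = (SUP (f, u) \<in> {(f, u) \<in> S. L2_norm f \<le> 1}. Linf_norm u)"

text \<open>\<open>K\<close> is the distribution kernel of \<open>S\<close>, and it is a continuous function. Continuity makes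
  \<open>K\<close> unique as a function, so that its values on the diagonal are determined by \<open>S\<close>.\<close>

definition is_continuous_kernel ::
    "((real^'n::finite \<Rightarrow> complex) \<times> (real^'n \<Rightarrow> complex)) set \<Rightarrow>
     (real^'n \<Rightarrow> real^'n \<Rightarrow> complex) \<Rightarrow> bool" where
  "is_continuous_kernel S K \<longleftrightarrow>
     continuous_on UNIV (\<lambda>(x, y). K x y) \<and>
     (\<forall>\<phi>\<in>test_functions. \<forall>\<psi>\<in>test_functions. \<forall>u. (\<psi>, u) \<in> S \<longrightarrow>
        (\<integral>x. \<phi> x * u x \<partial>lebesgue) =
        (\<integral>x. (\<integral>y. \<phi> x * K x y * \<psi> y \<partial>lebesgue) \<partial>lebesgue))"

definition dist_class :: "(real^'n::finite \<Rightarrow> real^'n^'n) \<Rightarrow> (real^'n \<Rightarrow> real) set" where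
  "dist_class C =
     {\<psi> \<in> test_functions.
        Linf_norm (\<lambda>x. \<Sum>i\<in>UNIV. \<Sum>j\<in>UNIV. C x $ i $ j * partial i \<psi> x * partial j \<psi> x) \<le> 1}"

definition dist_C :: "(real^'n::finite \<Rightarrow> real^'n^'n) \<Rightarrow> real^'n \<Rightarrow> real^'n \<Rightarrow> ennreal" where
  "dist_C C x y = (SUP \<psi> \<in> dist_class C. ennreal \<bar>\<psi> x - \<psi> y\<bar>)"

definition ball_C :: "(real^'n::finite \<Rightarrow> real^'n^'n) \<Rightarrow> real^'n \<Rightarrow> real \<Rightarrow> (real^'n) set" where
  "ball_C C x r = {y. dist_C C x y < ennreal r}"

end

theory Submission
  imports Defs "HOL-Computational_Algebra.Polynomial"
begin

text \<open>With \<open>u\<^sub>0\<close> a probability density concentrated near \<open>x\<close> and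
  \<open>u\<^sub>j = (I + r\<^sup>2 H)\<^sup>-\<^sup>j u\<^sub>0\<close>, the number \<open>K(x;x)\<close> is the limit of
  \<open>(u\<^sub>0, u\<^sub>2\<^sub>m) = \<parallel>u\<^sub>m\<parallel>\<^sup>2\<close>, and duality bounds
  \<open>\<parallel>u\<^sub>m\<parallel>\<close> by the norm from \<open>L\<^sub>2\<close> to \<open>L\<^sub>\<infinity>\<close>. For the lower bound
  take a cut-off \<open>\<eta>\<close> of the ball that is \<open>1\<close> near \<open>x\<close> and satisfies
  \<open>r\<^sup>2 \<Gamma>(\<eta>) \<le> c\<close>. The weak equations give
  \<open>1 = (\<eta>, u\<^sub>0) = (\<eta>, u\<^sub>m) + r\<^sup>2 \<Sum>\<^sub>j h(\<eta>, u\<^sub>j)\<close>, and only the region where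
  \<open>\<nabla>\<eta> \<noteq> 0\<close> contributes to the last sum. There \<open>(I + r\<^sup>2 H)\<^sup>m u\<^sub>m = 0\<close>, so
  an iterated Caccioppoli inequality bounds the energies of all \<open>u\<^sub>j\<close> by
  \<open>\<parallel>u\<^sub>m\<parallel>\<close>; hence \<open>1 \<le> c |B|\<^sup>1\<^sup>/\<^sup>2 \<parallel>u\<^sub>m\<parallel>\<close>.\<close>

section \<open>Smooth functions\<close>

text \<open>The constant may depend on \<open>m\<close> only, so the ellipticity bounds
  \<open>\<mu>\<close> and \<open>\<Lambda>\<close> are used qualitatively: for square
  integrability, completeness of the form domain, openness of the ball and compact support of the
  cut-offs. Every quantitative estimate rests on Cauchy-Schwarz for the energy form and on bounds
  for the energy density of a cut-off, the same quantity that defines the distance.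

  The obstacle is that \<open>u j\<close> with j < m is (I + r^2 H)^(m-j) applied to
  \<open>u m\<close>, an unbounded operator, so no global inequality bounds it by
  \<open>u m\<close>. Only away from the source does the chain of equations close, because there
  \<open>u 0\<close> vanishes; this fixes both the direction of the induction and the need for a
  second cut-off that vanishes on the source.

  Both cut-offs are functions of one profile \<open>w\<close>, compared with the levels 1/6, 1/3 and
  2/3: source below 1/6, transition of \<eta> between 1/3 and 2/3, complement of the ball above
  2/3.\<close>

abbreviation smooth :: "(real^'n::finite \<Rightarrow> 'b::real_normed_vector) \<Rightarrow> bool" where
  "smooth f \<equiv> \<forall>k. Ck k f"

lemma partial_eqI: "(f has_derivative f') (at x) \<Longrightarrow> partial i f x = f' (axis i 1)"
  unfolding partial_def by (metis frechet_derivative_at)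

lemma Ck_differentiable: "Ck (Suc k) f \<Longrightarrow> f differentiable (at x)"
  by (auto simp: differentiable_on_def)

lemma smooth_differentiable: "smooth f \<Longrightarrow> f differentiable (at x)"
  using Ck_differentiable by blast

lemma Ck_continuous: "Ck k f \<Longrightarrow> continuous_on UNIV f"
  by (cases k) (simp_all add: differentiable_imp_continuous_on)

lemma smooth_partial: "smooth f \<Longrightarrow> smooth (partial i f)"
  by (metis Ck.simps(2))

lemma Ck_SucD: "Ck (Suc k) f \<Longrightarrow> Ck k f"
proof (induction k arbitrary: f)
  case 0
  then show ?case using Ck_continuous[OF 0] by simp
qed auto

lemma partial_bounded_linear:
  assumes "bounded_linear L" "f differentiable (at x)"
  shows "partial i (\<lambda>x. L (f x)) x = L (partial i f x)"
  using bounded_linear.has_derivative[OF assms(1) assms(2)[unfolded frechet_derivative_works]]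
  unfolding partial_def by (metis frechet_derivative_at)

lemma partial_add:
  assumes "f differentiable (at x)" "g differentiable (at x)"
  shows "partial i (\<lambda>x. f x + g x) x = partial i f x + partial i g x"
  using has_derivative_add[OF assms[unfolded frechet_derivative_works]]
  unfolding partial_def by (metis (no_types, lifting) frechet_derivative_at)

lemma partial_scaleR:
  fixes f :: "real^'n::finite \<Rightarrow> real"
  assumes "f differentiable (at x)" "g differentiable (at x)"
  shows "partial i (\<lambda>x. f x *\<^sub>R g x) x = f x *\<^sub>R partial i g x + partial i f x *\<^sub>R g x"
  using has_derivative_scaleR[OF assms[unfolded frechet_derivative_works]]
  unfolding partial_def by (metis (no_types, lifting) frechet_derivative_at)

lemma partial_const: "partial i (\<lambda>x. c) x = 0"
  by (rule partial_eqI[of _ "\<lambda>_. 0"]) auto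

lemma partial_compose:
  fixes w :: "real^'n::finite \<Rightarrow> real"
  assumes "(f has_real_derivative d) (at (w x))" "w differentiable (at x)"
  shows "partial i (\<lambda>x. f (w x)) x = d * partial i w x"
proof -
  have "((\<lambda>x. f (w x)) has_derivative (\<lambda>h. d * frechet_derivative w (at x) h)) (at x)"
    using has_derivative_compose[OF assms(2)[unfolded frechet_derivative_works]
        assms(1)[unfolded has_field_derivative_def]] .
  then show ?thesis unfolding partial_def by (metis frechet_derivative_at)
qed

lemma Ck_bounded_linear:
  assumes "bounded_linear L"
  shows "Ck k f \<Longrightarrow> Ck k (\<lambda>x. L (f x))"
proof (induction k arbitrary: f)
  case 0
  then show ?case
    using bounded_linear.continuous_on[OF assms] by auto
next
  case (Suc k)
  have "partial i (\<lambda>x. L (f x)) = (\<lambda>x. L (partial i f x))" for i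
    using partial_bounded_linear[OF assms Ck_differentiable[OF Suc.prems]] by blast
  moreover have "(\<lambda>x. L (f x)) differentiable_on UNIV"
    using differentiable_chain_at[OF Ck_differentiable[OF Suc.prems]
        bounded_linear_imp_differentiable[OF assms]]
    unfolding o_def differentiable_on_def by auto
  ultimately show ?case using Suc by auto
qed

lemma Ck_const: "Ck k (\<lambda>x::real^'n::finite. c)"
proof (induction k arbitrary: c)
  case (Suc k)
  have "partial i (\<lambda>x::real^'n. c) = (\<lambda>x. 0)" for i by (rule ext) (rule partial_const)
  then show ?case using Suc by auto
qed auto

lemma Ck_add: "Ck k f \<Longrightarrow> Ck k g \<Longrightarrow> Ck k (\<lambda>x. f x + g x)"
proof (induction k arbitrary: f g)
  case (Suc k)
  have "partial i (\<lambda>x. f x + g x) = (\<lambda>x. partial i f x + partial i g x)" for i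
    using partial_add[OF Ck_differentiable Ck_differentiable, OF Suc.prems] by blast
  then show ?case using Suc by auto
qed (auto intro: continuous_intros)

lemma Ck_scaleR:
  fixes f :: "real^'n::finite \<Rightarrow> real"
  shows "Ck k f \<Longrightarrow> Ck k g \<Longrightarrow> Ck k (\<lambda>x. f x *\<^sub>R g x)"
proof (induction k arbitrary: f g)
  case (Suc k)
  have "partial i (\<lambda>x. f x *\<^sub>R g x) = (\<lambda>x. f x *\<^sub>R partial i g x + partial i f x *\<^sub>R g x)" for i
    using partial_scaleR[OF Ck_differentiable Ck_differentiable, OF Suc.prems] by blast
  moreover have "(\<lambda>x. f x *\<^sub>R g x) differentiable_on UNIV"
    using Suc.prems by (auto simp: differentiable_on_def)
  ultimately show ?case
    using Suc Ck_SucD[OF Suc.prems(1)] Ck_SucD[OF Suc.prems(2)] by (auto intro!: Ck_add)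
qed (auto intro: continuous_intros)

lemma Ck_mult:
  fixes f g :: "real^'n::finite \<Rightarrow> real"
  shows "Ck k f \<Longrightarrow> Ck k g \<Longrightarrow> Ck k (\<lambda>x. f x * g x)"
  using Ck_scaleR[of k f g] by simp

lemma Ck_diff:
  shows "Ck k f \<Longrightarrow> Ck k g \<Longrightarrow> Ck k (\<lambda>x. f x - g x)"
  using Ck_add[of k f "\<lambda>x. - g x"] Ck_bounded_linear[OF bounded_linear_minus[OF bounded_linear_ident], of k g]
  by simp

lemma Ck_power:
  fixes f :: "real^'n::finite \<Rightarrow> real"
  shows "Ck k f \<Longrightarrow> Ck k (\<lambda>x. f x ^ p)"
  by (induction p) (auto intro: Ck_const Ck_mult)

lemma Ck_prod:
  fixes f :: "'a \<Rightarrow> real^'n::finite \<Rightarrow> real"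
  shows "(\<And>i. Ck k (f i)) \<Longrightarrow> Ck k (\<lambda>x. \<Prod>i\<in>I. f i x)"
  by (induction I rule: infinite_finite_induct) (auto intro: Ck_const Ck_mult)

lemma Ck_sum:
  shows "(\<And>i. Ck k (f i)) \<Longrightarrow> Ck k (\<lambda>x. \<Sum>i\<in>I. f i x)"
  by (induction I rule: infinite_finite_induct) (auto intro: Ck_const Ck_add)

lemma partial_nth: "partial i (\<lambda>x. x $ j) x = (if i = j then 1 else 0)"
  by (subst partial_eqI[OF bounded_linear_imp_has_derivative[OF bounded_linear_vec_nth]])
    (auto simp: axis_def)

lemma Ck_nth: "Ck k (\<lambda>x::real^'n::finite. x $ j)"
proof (cases k)
  case (Suc k')
  have "partial i (\<lambda>x. x $ j) = (\<lambda>x. if i = j then 1 else 0)" for i :: 'n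
    by (rule ext) (rule partial_nth)
  then show ?thesis using Suc Ck_const[of k']
    by (auto intro!: bounded_linear_imp_differentiable_on bounded_linear_vec_nth)
qed (auto intro: continuous_intros)

text \<open>Closure of \<open>S\<close> under differentiation replaces a formula for higher
  derivatives: by the chain rule a partial derivative of the composite is a member of
  \<open>S\<close> composed with \<open>w\<close>, times a partial derivative of \<open>w\<close>,
  so the induction on \<open>k\<close> must run over all of \<open>S\<close> at once.\<close>

lemma Ck_compose:
  fixes w :: "real^'n::finite \<Rightarrow> real"
  assumes S: "\<And>f. f \<in> S \<Longrightarrow> \<exists>f'\<in>S. \<forall>t. (f has_real_derivative f' t) (at t)"
  shows "f \<in> S \<Longrightarrow> Ck k w \<Longrightarrow> Ck k (\<lambda>x. f (w x))"
proof (induction k arbitrary: f)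
  case 0
  obtain f' where "\<forall>t. (f has_real_derivative f' t) (at t)" using S 0 by blast
  then have "continuous_on UNIV f"
    by (meson DERIV_isCont continuous_at_imp_continuous_on)
  then show ?case using 0 continuous_on_compose2[of UNIV f UNIV w] by auto
next
  case (Suc k)
  obtain f' where f': "f' \<in> S" "\<And>t. (f has_real_derivative f' t) (at t)" using S Suc by blast
  have d: "w differentiable (at x)" for x using Ck_differentiable Suc by blast
  have "partial i (\<lambda>x. f (w x)) = (\<lambda>x. f' (w x) * partial i w x)" for i
    using partial_compose[OF f'(2) d] by blast
  moreover have "(\<lambda>x. f (w x)) differentiable_on UNIV"
  proof -
    have "f differentiable (at (w x))" for x
      using f'(2) by (meson real_differentiable_def)
    then show ?thesis
      using d differentiable_chain_at[of w _ f] unfolding o_def differentiable_on_def by auto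
  qed
  ultimately show ?case
    using Suc Ck_SucD[OF Suc.prems(2)] f' by (auto intro!: Ck_mult)
qed

subsection \<open>Cut-off functions\<close>

text \<open>The flat function exp(-1/t) is \<open>expinv 1\<close>; the polynomial factor in 1/t
  makes the family closed under differentiation, as \<open>Ck_compose\<close> requires.\<close>

definition expinv :: "real poly \<Rightarrow> real \<Rightarrow> real" where
  "expinv p t = (if t > 0 then poly p (1 / t) * exp (- (1 / t)) else 0)"

text \<open>The power \<open>s ^ k\<close> is there for the induction: s^k (a + s p(s)) is a
  monomial plus the same expression for p with k + 1.\<close>

lemma poly_div_exp_tendsto:
  fixes p :: "real poly"
  shows "((\<lambda>s. s ^ k * poly p s * exp (- s)) \<longlongrightarrow> 0) at_top"
proof (induction p arbitrary: k)
  case (pCons a p)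
  have "((\<lambda>s::real. a * (s ^ k / exp s) + s ^ Suc k * poly p s * exp (- s)) \<longlongrightarrow> a * 0 + 0) at_top"
    by (intro tendsto_intros tendsto_power_div_exp_0 pCons.IH)
  moreover have "a * (s ^ k / exp s) + s ^ Suc k * poly p s * exp (- s)
      = s ^ k * poly (pCons a p) s * exp (- s)" for s
    by (simp add: exp_minus field_simps)
  ultimately show ?case by simp
qed simp

lemma expinv_at_right:
  fixes p :: "real poly"
  shows "((\<lambda>t. poly p (1 / t) * exp (- (1 / t))) \<longlongrightarrow> 0) (at_right 0)"
  using filterlim_compose[OF poly_div_exp_tendsto[of 0 p] filterlim_inverse_at_top_right]
  by (simp add: inverse_eq_divide)

text \<open>With s = 1/t one has d/dt = - s^2 d/ds, which turns p(s) exp(-s) into s^2 (p(s) - p'(s))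
  exp(-s). At 0 the right difference quotient is s p(s) exp(-s), which tends to 0 as s
  grows.\<close>

lemma expinv_deriv:
  "(expinv p has_real_derivative expinv ([:0, 0, 1:] * (p - pderiv p)) t) (at t)"
proof (cases t "0::real" rule: linorder_cases)
  case less
  have "((\<lambda>t. 0) has_real_derivative 0) (at t)" by simp
  then have "(expinv p has_real_derivative 0) (at t)"
    by (rule has_field_derivative_transform_within_open[of _ _ _ "{..<0}"])
      (use less in \<open>auto simp: expinv_def\<close>)
  then show ?thesis using less by (simp add: expinv_def)
next
  case equal
  have 1: "((\<lambda>h. expinv p h / h) \<longlongrightarrow> 0) (at_left 0)"
    by (rule Lim_transform_eventually[of "\<lambda>h. 0"])
      (auto simp: expinv_def eventually_at_filter)
  have 2: "((\<lambda>h. expinv p h / h) \<longlongrightarrow> 0) (at_right 0)"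
    using expinv_at_right[of "[:0,1:] * p"]
    by (rule Lim_transform_eventually) (auto simp: expinv_def eventually_at_filter)
  have "((\<lambda>h. expinv p h / h) \<longlongrightarrow> 0) (at 0)"
    using filterlim_split_at[OF 1 2] .
  then show ?thesis using equal
    by (simp add: DERIV_def expinv_def[of _ 0])
next
  case greater
  have "((\<lambda>t. poly p (1 / t) * exp (- (1 / t))) has_real_derivative
     poly ([:0, 0, 1:] * (p - pderiv p)) (1 / t) * exp (- (1 / t))) (at t)"
    using greater
    by (auto intro!: derivative_eq_intros DERIV_chain'[OF _ poly_DERIV]
        simp: field_simps power2_eq_square)
  then have "(expinv p has_real_derivative
     poly ([:0, 0, 1:] * (p - pderiv p)) (1 / t) * exp (- (1 / t))) (at t)"
    by (rule has_field_derivative_transform_within_open[of _ _ _ "{0<..}"])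
      (use greater in \<open>auto simp: expinv_def\<close>)
  then show ?thesis using greater by (simp add: expinv_def)
qed

lemma Ck_expinv: "Ck k w \<Longrightarrow> Ck k (\<lambda>x. expinv p (w x))"
  by (rule Ck_compose[of "range expinv"]) (use expinv_deriv in auto)

lemma expinv_1_bounds: "0 \<le> expinv 1 t" "expinv 1 t \<le> 1" "t \<le> 0 \<Longrightarrow> expinv 1 t = 0"
  "t > 0 \<Longrightarrow> expinv 1 t > 0"
  by (auto simp: expinv_def)

lemma expinv_1_mono: "s \<le> t \<Longrightarrow> expinv 1 s \<le> expinv 1 t"
  by (auto simp: expinv_def frac_le)

text \<open>A bound for the derivative of \<open>expinv 1\<close>, from exp s \<ge> 1 + s +
  s^2/2.\<close>

lemma expinv_deriv_bound: "\<bar>expinv [:0, 0, 1:] t\<bar> \<le> 2"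
proof -
  have "s\<^sup>2 * exp (- s) \<le> 2" if "s > 0" for s :: real
    using exp_lower_Taylor_quadratic[of s] that
    by (simp add: exp_minus field_simps)
  from this[of "1 / t"] show ?thesis
    by (auto simp: expinv_def power2_eq_square)
qed

text \<open>A plateau made by nesting the flat function in itself: the inner quotient is 0 up to 1/3
  and reaches 1 at 2/3, where the argument of the outer one stops being positive. Unlike the usual
  quotient of two flat functions it divides by constants only, so smoothness follows from
  composition alone.\<close>

definition step :: "real \<Rightarrow> real" where
  "step t = expinv 1 (1 - expinv 1 (t - 1/3) / expinv 1 (1/3)) / expinv 1 1"

lemma step_eq_1: "t \<le> 1/3 \<Longrightarrow> step t = 1"
  by (simp add: step_def expinv_def)

lemma step_eq_0: "t \<ge> 2/3 \<Longrightarrow> step t = 0"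
proof -
  assume "t \<ge> 2/3"
  then have "expinv 1 (1/3) \<le> expinv 1 (t - 1/3)" by (intro expinv_1_mono) auto
  then have "1 - expinv 1 (t - 1/3) / expinv 1 (1/3) \<le> 0"
    using expinv_1_bounds(4)[of "1/3"] by (simp add: field_simps)
  then show ?thesis unfolding step_def by (simp add: expinv_1_bounds(3))
qed

lemma step_bounds: "0 \<le> step t" "step t \<le> 1"
proof -
  have "1 - expinv 1 (t - 1/3) / expinv 1 (1/3) \<le> 1"
    using expinv_1_bounds(1) by simp
  then have "expinv 1 (1 - expinv 1 (t - 1/3) / expinv 1 (1/3)) \<le> expinv 1 1"
    by (rule expinv_1_mono)
  then show "0 \<le> step t" "step t \<le> 1" unfolding step_def
    using expinv_1_bounds(4)[of 1] expinv_1_bounds(1)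
    by (auto intro: divide_nonneg_nonneg)
qed

definition step' :: "real \<Rightarrow> real" where
  "step' t = - expinv [:0,0,1:] (1 - expinv 1 (t - 1/3) / expinv 1 (1/3)) * expinv [:0,0,1:] (t - 1/3)
      / (expinv 1 (1/3) * expinv 1 1)"

lemma step_deriv: "(step has_real_derivative step' t) (at t)"
proof -
  have d: "(expinv 1 has_real_derivative expinv [:0,0,1:] t) (at t)" for t
    using expinv_deriv[of 1] by (simp add: pderiv_1)
  have e: "((\<lambda>t. expinv 1 (u t)) has_real_derivative expinv [:0,0,1:] (u t) * u') (at t)"
    if "(u has_real_derivative u') (at t)" for u u' t
    using DERIV_chain2[OF d that] .
  have 1: "((\<lambda>t. expinv 1 (t - 1/3)) has_real_derivative expinv [:0,0,1:] (t - 1/3) * 1) (at t)"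
    by (rule e) (auto intro!: derivative_eq_intros)
  have 2: "((\<lambda>t. 1 - expinv 1 (t - 1/3) / expinv 1 (1/3)) has_real_derivative
      0 - expinv [:0,0,1:] (t - 1/3) * 1 / expinv 1 (1/3)) (at t)"
    by (intro DERIV_diff DERIV_const DERIV_cdivide 1)
  show ?thesis unfolding step_def[abs_def]
    by (rule DERIV_cong[OF DERIV_cdivide[OF e[OF 2]]]) (simp add: step'_def)
qed

text \<open>The 4 bounds the product of the two derivative factors in \<open>step'\<close>, each at
  most 2 in absolute value. It is an absolute constant, as uniformity in the operator
  demands.\<close>

definition step_lip :: real where
  "step_lip = 4 / (expinv 1 (1/3) * expinv 1 1)"

lemma step_lip_pos: "step_lip > 0"
  using expinv_1_bounds(4)[of 1] expinv_1_bounds(4)[of "1/3"] by (simp add: step_lip_def)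

lemma step'_bound: "\<bar>step' t\<bar> \<le> step_lip"
proof -
  have "\<bar>expinv [:0,0,1:] a * expinv [:0,0,1:] b\<bar> \<le> 2 * 2" for a b
    unfolding abs_mult by (intro mult_mono expinv_deriv_bound) auto
  then show ?thesis
    using expinv_1_bounds(4)[of 1] expinv_1_bounds(4)[of "1/3"]
    unfolding step'_def step_lip_def by (auto simp: abs_mult intro!: divide_right_mono)
qed

lemma step'_eq_0: "t \<le> 1/3 \<or> t \<ge> 2/3 \<Longrightarrow> step' t = 0"
proof (elim disjE)
  assume "t \<le> 1/3"
  then show ?thesis by (simp add: step'_def expinv_def)
next
  assume "t \<ge> 2/3"
  then have "expinv 1 (1/3) \<le> expinv 1 (t - 1/3)" by (intro expinv_1_mono) auto
  then have "1 - expinv 1 (t - 1/3) / expinv 1 (1/3) \<le> 0"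
    using expinv_1_bounds(4)[of "1/3"] by (simp add: field_simps)
  then show ?thesis unfolding step'_def by (simp add: expinv_def[of "[:0,0,1:]"])
qed

lemma Ck_step: "Ck k w \<Longrightarrow> Ck k (\<lambda>x. step (w x))"
proof -
  assume w: "Ck k w"
  have "Ck k (\<lambda>x. inverse (expinv 1 1) * expinv 1 (1 - inverse (expinv 1 (1/3)) * expinv 1 (w x - 1/3)))"
    by (intro Ck_mult Ck_const Ck_expinv Ck_diff w)
  then show ?thesis unfolding step_def by (simp add: field_simps)
qed

lemma continuous_step': "continuous_on UNIV step'"
proof -
  have e: "continuous_on UNIV (expinv p)" for p
    using expinv_deriv DERIV_isCont continuous_at_imp_continuous_on by blast
  show ?thesis unfolding step'_def[abs_def]
    by (intro continuous_intros continuous_on_compose2[OF e]) (auto simp: expinv_def)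
qed

subsection \<open>A smooth maximum\<close>

definition logistic :: "real \<Rightarrow> real" where "logistic t = 1 / (1 + exp (- t))"

definition softplus :: "real \<Rightarrow> real" where "softplus t = ln (1 + exp t)"

lemma logistic_bounds: "0 \<le> logistic t" "logistic t \<le> 1"
  by (auto simp: logistic_def add_pos_pos divide_le_eq intro: less_imp_le)

lemma logistic_deriv: "(logistic has_real_derivative logistic t - (logistic t)\<^sup>2) (at t)"
proof -
  have "1 + exp (- t) \<noteq> 0" using exp_gt_zero[of "- t"] by linarith
  then have "((\<lambda>t. 1 / (1 + exp (- t))) has_real_derivative exp (- t) / (1 + exp (- t))\<^sup>2) (at t)"
    by (auto intro!: derivative_eq_intros simp: power2_eq_square)
  moreover have "exp (- t) / (1 + exp (- t))\<^sup>2 = logistic t - (logistic t)\<^sup>2"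
    using \<open>1 + exp (- t) \<noteq> 0\<close> unfolding logistic_def
    by (simp add: power_divide divide_simps) (simp add: power2_eq_square algebra_simps)
  ultimately show ?thesis unfolding logistic_def[abs_def] by simp
qed

lemma softplus_deriv: "(softplus has_real_derivative logistic t) (at t)"
proof -
  have "1 + exp t > 0" using exp_gt_zero[of t] by linarith
  then show ?thesis unfolding softplus_def[abs_def] logistic_def
    by (auto intro!: derivative_eq_intros simp: field_simps exp_minus add_pos_pos)
qed

lemma softplus_ge: "softplus t \<ge> t" "softplus t \<ge> 0"
proof -
  have "ln (exp t) \<le> ln (1 + exp t)" by (intro ln_mono) (auto simp: add_pos_pos)
  then show "softplus t \<ge> t" by (simp add: softplus_def)
qed (auto simp: softplus_def)

text \<open>1 + exp t is at most 2 exp(max t 0), and 2 \<le> exp 1. After rescaling by e this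
  additive error 1 becomes the error e of the smooth maximum.\<close>

lemma softplus_le: "softplus t \<le> max t 0 + 1"
proof -
  have "1 + exp t \<le> exp (max t 0 + 1)"
  proof -
    have "1 \<le> exp (max t 0)" "exp t \<le> exp (max t 0)" by auto
    then have "1 + exp t \<le> exp (max t 0) * 2" by linarith
    also have "\<dots> \<le> exp (max t 0) * exp 1"
      using exp_ge_add_one_self[of "1::real"] by (intro mult_left_mono) auto
    finally show ?thesis by (simp add: exp_add)
  qed
  then have "ln (1 + exp t) \<le> ln (exp (max t 0 + 1))"
    by (intro ln_mono) (auto simp: add_pos_pos)
  then show ?thesis by (simp add: softplus_def)
qed

text \<open>The logistic function L solves the autonomous equation L' = L - L^2, so the polynomials
  in L are closed under differentiation; adding softplus itself, whose derivative is L, gives an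
  admissible family for \<open>Ck_compose\<close>.\<close>

lemma Ck_softplus: "Ck k w \<Longrightarrow> Ck k (\<lambda>x. softplus (w x))"
proof (rule Ck_compose[of "insert softplus (range (\<lambda>p t. poly p (logistic t)))" softplus])
  fix f assume "f \<in> insert softplus (range (\<lambda>p t. poly p (logistic t)))"
  then consider "f = softplus" | p where "f = (\<lambda>t. poly p (logistic t))" by auto
  then show "\<exists>f'\<in>insert softplus (range (\<lambda>p t. poly p (logistic t))).
      \<forall>t. (f has_real_derivative f' t) (at t)"
  proof cases
    case 1
    have "logistic = (\<lambda>t. poly [:0,1:] (logistic t))" by auto
    then show ?thesis using 1 softplus_deriv by blast
  next
    case 2
    have "(f has_real_derivative poly (pderiv p * [:0,1,-1:]) (logistic t)) (at t)" for t
      unfolding 2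
      by (rule DERIV_cong[OF DERIV_chain2[OF poly_DERIV logistic_deriv]])
        (simp add: power2_eq_square algebra_simps)
    then show ?thesis by (intro bexI[of _ "\<lambda>t. poly (pderiv p * [:0,1,-1:]) (logistic t)"]) (blast, blast)
  qed
qed auto

section \<open>Square-integrable functions\<close>

text \<open>The common source of Cauchy-Schwarz for forms that may be degenerate, and of the
  approximate Euler equation in \<open>riesz_representation\<close>. For c > 0 the minimiser t =
  -b/c is inserted.\<close>

lemma discriminant_le:
  fixes a b c :: real
  assumes "\<And>t. 0 \<le> a + 2 * t * b + t\<^sup>2 * c" "a \<ge> 0" "c \<ge> 0"
  shows "\<bar>b\<bar> \<le> sqrt a * sqrt c"
proof -
  have "b\<^sup>2 \<le> a * c"
  proof (cases "c = 0")
    case True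
    have "b = 0"
    proof (rule ccontr)
      assume "b \<noteq> 0"
      \<comment> \<open>For c = 0 this t makes the assumed nonnegative expression equal to
        -1.\<close>
      then show False using assms(1)[of "- (a + 1) / (2 * b)"] True by (simp add: field_simps)
    qed
    then show ?thesis using True by simp
  next
    case False
    then show ?thesis using assms(1)[of "- b / c"] assms(3)
      by (simp add: field_simps power2_eq_square)
  qed
  then have "sqrt (b\<^sup>2) \<le> sqrt (a * c)" by (rule real_sqrt_le_mono)
  then show ?thesis by (simp add: real_sqrt_mult)
qed

definition sqint :: "('a::euclidean_space \<Rightarrow> 'b::euclidean_space) set" where
  "sqint = {f \<in> borel_measurable lebesgue. integrable lebesgue (\<lambda>x. (norm (f x))\<^sup>2)}"

text \<open>Real-valued even for complex functions, and usable for functions and gradients alike.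
  All estimates are made with this real product; the complex form identity is recovered at the end
  by testing with \<i> v as well as v.\<close>

definition ip :: "('a::euclidean_space \<Rightarrow> 'b::euclidean_space) \<Rightarrow> ('a \<Rightarrow> 'b) \<Rightarrow> real" where
  "ip f g = (\<integral>x. f x \<bullet> g x \<partial>lebesgue)"

abbreviation dsq :: "('a::euclidean_space \<Rightarrow> 'b::euclidean_space) \<Rightarrow> ('a \<Rightarrow> 'b) \<Rightarrow> real" where
  "dsq f g \<equiv> ip (\<lambda>x. f x - g x) (\<lambda>x. f x - g x)"

lemma sqint_measurable: "f \<in> sqint \<Longrightarrow> f \<in> borel_measurable lebesgue"
  by (simp add: sqint_def)

lemma sqint_integrable: "f \<in> sqint \<Longrightarrow> integrable lebesgue (\<lambda>x. (norm (f x))\<^sup>2)"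
  by (simp add: sqint_def)

lemma sqint_bound:
  assumes f: "f \<in> sqint" and g: "g \<in> borel_measurable lebesgue"
    and le: "AE x in lebesgue. norm (g x) \<le> c * norm (f x)"
  shows "g \<in> sqint"
proof -
  have "integrable lebesgue (\<lambda>x. (norm (g x))\<^sup>2)"
  proof (rule Bochner_Integration.integrable_bound)
    show "integrable lebesgue (\<lambda>x. c\<^sup>2 * (norm (f x))\<^sup>2)" using sqint_integrable[OF f] by simp
    show "(\<lambda>x. (norm (g x))\<^sup>2) \<in> borel_measurable lebesgue" using g by measurable
    show "AE x in lebesgue. norm ((norm (g x))\<^sup>2) \<le> norm (c\<^sup>2 * (norm (f x))\<^sup>2)"
      using le
    proof eventually_elim
      case (elim x)
      then have "(norm (g x))\<^sup>2 \<le> (c * norm (f x))\<^sup>2" by (intro power_mono) auto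
      then show ?case by (simp add: power_mult_distrib)
    qed
  qed
  then show ?thesis using g by (simp add: sqint_def)
qed

lemma sqint_inner_integrable:
  assumes "f \<in> sqint" "g \<in> sqint"
  shows "integrable lebesgue (\<lambda>x. f x \<bullet> g x)"
proof (rule Bochner_Integration.integrable_bound)
  show "integrable lebesgue (\<lambda>x. (norm (f x))\<^sup>2 + (norm (g x))\<^sup>2)"
    using assms by (auto simp: sqint_def)
  show "(\<lambda>x. f x \<bullet> g x) \<in> borel_measurable lebesgue"
    using assms[THEN sqint_measurable] by measurable
  show "AE x in lebesgue. norm (f x \<bullet> g x) \<le> norm ((norm (f x))\<^sup>2 + (norm (g x))\<^sup>2)"
  proof (rule AE_I2)
    fix x
    have "norm (f x \<bullet> g x) \<le> norm (f x) * norm (g x)" by (simp add: Cauchy_Schwarz_ineq2)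
    also have "\<dots> \<le> (norm (f x))\<^sup>2 + (norm (g x))\<^sup>2"
      using sum_squares_bound[of "norm (f x)" "norm (g x)"]
        mult_nonneg_nonneg[of "norm (f x)" "norm (g x)"]
      unfolding mult.assoc by (smt (verit) norm_ge_zero)
    finally show "norm (f x \<bullet> g x) \<le> norm ((norm (f x))\<^sup>2 + (norm (g x))\<^sup>2)" by simp
  qed
qed

lemma sqint_zero: "(\<lambda>x. 0) \<in> sqint"
  by (simp add: sqint_def)

lemma sqint_scaleR: "f \<in> sqint \<Longrightarrow> (\<lambda>x. c *\<^sub>R f x) \<in> sqint"
  by (rule sqint_bound[of f _ "\<bar>c\<bar>"]) (auto dest: sqint_measurable)

lemma sqint_add:
  assumes "f \<in> sqint" "g \<in> sqint"
  shows "(\<lambda>x. f x + g x) \<in> sqint"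
proof -
  have [measurable]: "f \<in> borel_measurable lebesgue" "g \<in> borel_measurable lebesgue"
    using assms[THEN sqint_measurable] by auto
  have "integrable lebesgue (\<lambda>x. (norm (f x + g x))\<^sup>2)"
  proof (rule Bochner_Integration.integrable_bound)
    show "integrable lebesgue (\<lambda>x. 2 * (norm (f x))\<^sup>2 + 2 * (norm (g x))\<^sup>2)"
      using assms by (auto simp: sqint_def)
    have "(norm (f x + g x))\<^sup>2 \<le> 2 * (norm (f x))\<^sup>2 + 2 * (norm (g x))\<^sup>2" for x
    proof -
      have "(norm (f x + g x))\<^sup>2 \<le> (norm (f x) + norm (g x))\<^sup>2"
        by (intro power_mono norm_triangle_ineq) auto
      also have "\<dots> \<le> 2 * (norm (f x))\<^sup>2 + 2 * (norm (g x))\<^sup>2"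
        using sum_squares_bound[of "norm (f x)" "norm (g x)"] by (simp add: power2_sum)
      finally show ?thesis .
    qed
    then show "AE x in lebesgue. norm ((norm (f x + g x))\<^sup>2)
        \<le> norm (2 * (norm (f x))\<^sup>2 + 2 * (norm (g x))\<^sup>2)" by auto
  qed measurable
  then show ?thesis by (simp add: sqint_def)
qed

lemma sqint_diff: "f \<in> sqint \<Longrightarrow> g \<in> sqint \<Longrightarrow> (\<lambda>x. f x - g x) \<in> sqint"
  using sqint_add[of f "\<lambda>x. (-1) *\<^sub>R g x"] sqint_scaleR[of g "-1"] by simp

lemma ip_commute: "ip f g = ip g f"
  by (simp add: ip_def inner_commute)

lemma ip_add_left:
  "f \<in> sqint \<Longrightarrow> g \<in> sqint \<Longrightarrow> h \<in> sqint \<Longrightarrow> ip (\<lambda>x. f x + g x) h = ip f h + ip g h"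
  by (simp add: ip_def inner_add_left sqint_inner_integrable)

lemma ip_scaleR_left: "ip (\<lambda>x. c *\<^sub>R f x) h = c * ip f h"
  by (simp add: ip_def)

lemma ip_add_right:
  "f \<in> sqint \<Longrightarrow> g \<in> sqint \<Longrightarrow> h \<in> sqint \<Longrightarrow> ip h (\<lambda>x. f x + g x) = ip h f + ip h g"
  by (simp add: ip_def inner_add_right sqint_inner_integrable)

lemma ip_diff_right:
  "f \<in> sqint \<Longrightarrow> g \<in> sqint \<Longrightarrow> h \<in> sqint \<Longrightarrow> ip h (\<lambda>x. f x - g x) = ip h f - ip h g"
  by (simp add: ip_def inner_diff_right sqint_inner_integrable)

lemma ip_scaleR_right: "ip h (\<lambda>x. c *\<^sub>R f x) = c * ip h f"
  by (simp add: ip_def)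

lemma ip_self: "ip f f = (\<integral>x. (norm (f x))\<^sup>2 \<partial>lebesgue)"
  by (simp add: ip_def power2_norm_eq_inner)

lemma ip_nonneg: "ip f f \<ge> 0"
  by (simp add: ip_def)

lemma ip_cong_AE:
  assumes "f \<in> borel_measurable lebesgue" "g \<in> borel_measurable lebesgue"
    "f' \<in> borel_measurable lebesgue" "g' \<in> borel_measurable lebesgue"
    "AE x in lebesgue. f x \<bullet> g x = f' x \<bullet> g' x"
  shows "ip f g = ip f' g'"
  unfolding ip_def using assms by (intro integral_cong_AE) auto

lemma ip_mono_self:
  assumes "f \<in> sqint" "g \<in> sqint" "AE x in lebesgue. norm (f x) \<le> norm (g x)"
  shows "ip f f \<le> ip g g"
  unfolding ip_self using assms by (intro integral_mono_AE) (auto dest: sqint_integrable simp: power_mono)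

lemma ip_Cauchy_Schwarz:
  assumes "f \<in> sqint" "g \<in> sqint"
  shows "\<bar>ip f g\<bar> \<le> sqrt (ip f f) * sqrt (ip g g)"
proof (rule discriminant_le)
  fix t
  have "0 \<le> ip (\<lambda>x. f x + t *\<^sub>R g x) (\<lambda>x. f x + t *\<^sub>R g x)" by (rule ip_nonneg)
  also have "\<dots> = ip f f + 2 * t * ip f g + t\<^sup>2 * ip g g"
    using assms by (simp add: ip_add_left ip_add_right ip_scaleR_left ip_scaleR_right sqint_add
        sqint_scaleR ip_commute[of g f] algebra_simps power2_eq_square)
  finally show "0 \<le> ip f f + 2 * t * ip f g + t\<^sup>2 * ip g g" .
qed (rule ip_nonneg)+

lemma nn_integral_sqint:
  "f \<in> sqint \<Longrightarrow> (\<integral>\<^sup>+x. ennreal ((norm (f x))\<^sup>2) \<partial>lebesgue) = ennreal (ip f f)"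
  unfolding ip_self by (intro nn_integral_eq_integral) (auto dest: sqint_integrable)

text \<open>The squared increments decay fast enough to be weighted: 2^k (1/4)^k = 2^(-k), so the
  sum of 2^k |d k|^2 is finite almost everywhere. Then |d k| \<le> 2^(-k) + 2^k |d k|^2 makes the
  increments absolutely summable, without passing to integrable functions on a space of infinite
  measure.\<close>

lemma sqint_complete_AE_lim:
  fixes h :: "nat \<Rightarrow> 'a::euclidean_space \<Rightarrow> 'b::euclidean_space"
  assumes h: "\<And>k. h k \<in> sqint"
    and le: "\<And>k. dsq (h (Suc k)) (h k) \<le> (1/4) ^ k"
  shows "AE x in lebesgue. convergent (\<lambda>k. h k x)"
proof -
  define d where "d k x = h (Suc k) x - h k x" for k x
  have d: "d k \<in> sqint" for k unfolding d_def by (intro sqint_diff h)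
  have [measurable]: "d k \<in> borel_measurable lebesgue" for k using d sqint_measurable by auto
  have "(\<integral>\<^sup>+x. (\<Sum>k. ennreal (2 ^ k * (norm (d k x))\<^sup>2)) \<partial>lebesgue)
      = (\<Sum>k. \<integral>\<^sup>+x. ennreal (2 ^ k * (norm (d k x))\<^sup>2) \<partial>lebesgue)"
    by (intro nn_integral_suminf) measurable
  also have "\<dots> \<le> (\<Sum>k. ennreal ((1/2) ^ k))"
  proof (intro suminf_le)
    fix k
    have "(\<integral>\<^sup>+x. ennreal (2 ^ k * (norm (d k x))\<^sup>2) \<partial>lebesgue) = ennreal (2 ^ k) * ennreal (ip (d k) (d k))"
      using nn_integral_sqint[OF d[of k]] by (simp add: ennreal_mult nn_integral_cmult)
    also have "\<dots> \<le> ennreal (2 ^ k) * ennreal ((1/4) ^ k)"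
      using le[of k] unfolding d_def by (intro mult_left_mono ennreal_leI) auto
    also have "\<dots> = ennreal ((1/2) ^ k)"
      by (simp flip: ennreal_mult power_mult_distrib)
    finally show "(\<integral>\<^sup>+x. ennreal (2 ^ k * (norm (d k x))\<^sup>2) \<partial>lebesgue) \<le> ennreal ((1/2) ^ k)" .
  qed auto
  also have "\<dots> < \<infinity>"
    by (subst suminf_ennreal2) (auto intro: summable_geometric)
  finally have "AE x in lebesgue. (\<Sum>k. ennreal (2 ^ k * (norm (d k x))\<^sup>2)) \<noteq> \<infinity>"
    by (intro nn_integral_PInf_AE) auto
  then show ?thesis
  proof eventually_elim
    case (elim x)
    then have s: "summable (\<lambda>k. 2 ^ k * (norm (d k x))\<^sup>2)"
      by (intro summable_suminf_not_top) auto
    have "summable (\<lambda>k. norm (d k x))"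
    proof (rule summable_comparison_test')
      show "summable (\<lambda>k. (1/2) ^ k + 2 ^ k * (norm (d k x))\<^sup>2)"
        by (intro summable_add s summable_geometric) auto
      fix k :: nat
      define q :: real where "q = 2 ^ k"
      have q: "q > 0" by (simp add: q_def)
      have "0 \<le> (1 - q * norm (d k x))\<^sup>2" by simp
      then have "2 * (q * norm (d k x)) \<le> 1 + q * (q * (norm (d k x))\<^sup>2)"
        by (simp add: power2_diff power_mult_distrib power2_eq_square algebra_simps)
      moreover have "0 \<le> q * norm (d k x)" using q by simp
      ultimately have "q * norm (d k x) \<le> 1 + q * (q * (norm (d k x))\<^sup>2)" by linarith
      then have "q * norm (d k x) \<le> q * (1 / q + q * (norm (d k x))\<^sup>2)" using q by (simp add: algebra_simps)
      then have "norm (d k x) \<le> 1 / q + q * (norm (d k x))\<^sup>2"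
        using q by (simp only: mult_le_cancel_left_pos)
      then show "norm (norm (d k x)) \<le> (1/2) ^ k + 2 ^ k * (norm (d k x))\<^sup>2"
        by (simp add: q_def power_one_over)
    qed
    then have "summable (\<lambda>k. d k x)" by (rule summable_norm_cancel)
    then have "convergent (\<lambda>n. h 0 x + (\<Sum>k<n. d k x))"
      by (intro convergent_add convergent_const) (simp add: summable_iff_convergent)
    moreover have "h 0 x + (\<Sum>k<n. d k x) = h n x" for n
      using sum_lessThan_telescope[of "\<lambda>k. h k x" n] by (simp add: d_def)
    ultimately show ?case by simp
  qed
qed

text \<open>Fatou's lemma is applied with n fixed while the index of the subsequence tends to
  infinity. This bounds the distance to the limit for every late \<open>f n\<close>, so the whole
  sequence converges and not only the subsequence.\<close>

lemma sqint_complete: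
  fixes f :: "nat \<Rightarrow> 'a::euclidean_space \<Rightarrow> 'b::euclidean_space"
  assumes f: "\<And>n. f n \<in> sqint"
    and Cauchy: "\<And>e. e > 0 \<Longrightarrow> \<exists>N. \<forall>m\<ge>N. \<forall>n\<ge>N. dsq (f m) (f n) \<le> e"
  obtains g where "g \<in> sqint" "(\<lambda>n. dsq (f n) g) \<longlonglongrightarrow> 0"
proof -
  have [measurable]: "f n \<in> borel_measurable lebesgue" for n using f sqint_measurable by auto
  have "\<exists>N. \<forall>k. (\<forall>m\<ge>N k. \<forall>n\<ge>N k. dsq (f m) (f n) \<le> (1/4) ^ k)
      \<and> N k < N (Suc k)"
  proof (rule dependent_nat_choice)
    show "\<exists>N. \<forall>m\<ge>N. \<forall>n\<ge>N. dsq (f m) (f n) \<le> (1/4) ^ 0"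
      using Cauchy[of 1] by simp
    fix M k :: nat
    obtain N where N: "\<forall>m\<ge>N. \<forall>n\<ge>N. dsq (f m) (f n) \<le> (1/4) ^ Suc k"
      using Cauchy[of "(1/4) ^ Suc k"] by auto
    show "\<exists>N. (\<forall>m\<ge>N. \<forall>n\<ge>N. dsq (f m) (f n) \<le> (1/4) ^ Suc k) \<and> M < N"
      by (rule exI[of _ "max N (Suc M)"]) (use N in auto)
  qed
  then obtain N where N: "\<And>k m n. m \<ge> N k \<Longrightarrow> n \<ge> N k \<Longrightarrow>
      dsq (f m) (f n) \<le> (1/4) ^ k" and N': "\<And>k. N k < N (Suc k)"
    by blast
  define h where "h k = f (N k)" for k
  have [measurable]: "h k \<in> borel_measurable lebesgue" for k unfolding h_def by auto
  have "AE x in lebesgue. convergent (\<lambda>k. h k x)"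
  proof (rule sqint_complete_AE_lim)
    show "h k \<in> sqint" for k unfolding h_def by (rule f)
    show "dsq (h (Suc k)) (h k) \<le> (1/4) ^ k" for k
      unfolding h_def by (intro N) (use N'[of k] in auto)
  qed
  then have conv: "AE x in lebesgue. (\<lambda>k. h k x) \<longlonglongrightarrow> lim (\<lambda>k. h k x)"
    by eventually_elim (simp add: convergent_LIMSEQ_iff)
  define g where "g x = lim (\<lambda>k. h k x)" for x
  have [measurable]: "g \<in> borel_measurable lebesgue"
    unfolding g_def by (intro borel_measurable_lim_metric) measurable
  have Nk: "k \<le> N k" for k
  proof (induction k)
    case (Suc k)
    then show ?case using N'[of k] by linarith
  qed auto
  have fatou: "(\<integral>\<^sup>+x. ennreal ((norm (f n x - g x))\<^sup>2) \<partial>lebesgue) \<le> ennreal ((1/4) ^ k)" if n: "n \<ge> N k" for n k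
  proof -
    have "AE x in lebesgue. ennreal ((norm (f n x - g x))\<^sup>2) = liminf (\<lambda>j. ennreal ((norm (f n x - h j x))\<^sup>2))"
      using conv
    proof eventually_elim
      case (elim x)
      then have "(\<lambda>j. ennreal ((norm (f n x - h j x))\<^sup>2)) \<longlonglongrightarrow> ennreal ((norm (f n x - g x))\<^sup>2)"
        unfolding g_def by (intro tendsto_intros)
      then show ?case by (rule lim_imp_Liminf[OF sequentially_bot, symmetric])
    qed
    then have "(\<integral>\<^sup>+x. ennreal ((norm (f n x - g x))\<^sup>2) \<partial>lebesgue)
        = (\<integral>\<^sup>+x. liminf (\<lambda>j. ennreal ((norm (f n x - h j x))\<^sup>2)) \<partial>lebesgue)"
      by (rule nn_integral_cong_AE)
    also have "\<dots> \<le> liminf (\<lambda>j. \<integral>\<^sup>+x. ennreal ((norm (f n x - h j x))\<^sup>2) \<partial>lebesgue)"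
      by (rule nn_integral_liminf) measurable
    also have "\<dots> \<le> ennreal ((1/4) ^ k)"
    proof (rule Liminf_le)
      show "\<forall>\<^sub>F j in sequentially. (\<integral>\<^sup>+x. ennreal ((norm (f n x - h j x))\<^sup>2) \<partial>lebesgue) \<le> ennreal ((1/4) ^ k)"
        using eventually_ge_at_top[of "N k"]
      proof eventually_elim
        case (elim j)
        have "(\<integral>\<^sup>+x. ennreal ((norm (f n x - h j x))\<^sup>2) \<partial>lebesgue)
            = ennreal (dsq (f n) (h j))"
          unfolding h_def by (rule nn_integral_sqint[OF sqint_diff[OF f f]])
        also have "\<dots> \<le> ennreal ((1/4) ^ k)"
          unfolding h_def by (intro ennreal_leI N n) (use elim Nk[of j] in linarith)
        finally show ?case .
      qed
    qed auto
    finally show ?thesis .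
  qed
  have fg: "(\<lambda>x. f n x - g x) \<in> sqint" if "n \<ge> N 0" for n
  proof -
    have "(\<integral>\<^sup>+x. ennreal ((norm (f n x - g x))\<^sup>2) \<partial>lebesgue) < \<infinity>"
      by (rule le_less_trans[OF fatou[OF that]]) simp
    then have "integrable lebesgue (\<lambda>x. (norm (f n x - g x))\<^sup>2)"
      by (intro integrableI_bounded) auto
    then show ?thesis by (simp add: sqint_def)
  qed
  have "g \<in> sqint" using sqint_diff[OF f[of "N 0"] fg[of "N 0"]] by simp
  moreover have "(\<lambda>n. dsq (f n) g) \<longlonglongrightarrow> 0"
  proof (rule LIMSEQ_I)
    fix e :: real assume "e > 0"
    then obtain k where k: "(1/4) ^ k < e" using real_arch_pow_inv[of e "1/4"] by auto
    have "norm (dsq (f n) g - 0) < e" if n: "n \<ge> max (N k) (N 0)" for n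
    proof -
      have "ennreal (dsq (f n) g) \<le> ennreal ((1/4) ^ k)"
        using fatou[of k n] nn_integral_sqint[OF fg[of n]] n by simp
      then show ?thesis using k ip_nonneg[of "\<lambda>x. f n x - g x"] by (simp add: ennreal_le_iff)
    qed
    then show "\<exists>no. \<forall>n\<ge>no. norm (dsq (f n) g - 0) < e" by blast
  qed
  ultimately show ?thesis by (rule that)
qed

section \<open>Test functions\<close>

lemma test_functionI:
  assumes "smooth f" "\<And>x. norm x > R \<Longrightarrow> f x = 0"
  shows "f \<in> test_functions"
proof -
  have "closure {x. f x \<noteq> 0} \<subseteq> cball 0 R"
    by (rule closure_minimal) (use assms(2) in \<open>force simp: not_less\<close>)+
  then have "compact (closure {x. f x \<noteq> 0})"
    using bounded_subset[OF bounded_cball] by (auto simp: compact_eq_bounded_closed)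
  then show ?thesis using assms(1) by (simp add: test_functions_def)
qed

lemma test_function_smooth: "f \<in> test_functions \<Longrightarrow> smooth f"
  by (simp add: test_functions_def)

lemma test_function_support:
  assumes "f \<in> test_functions"
  obtains R where "R > 0" "\<And>x. norm x > R \<Longrightarrow> f x = 0"
proof -
  have "bounded (closure {x. f x \<noteq> 0})"
    using assms by (simp add: test_functions_def compact_imp_bounded)
  then obtain R where "R > 0" "\<And>x. x \<in> closure {x. f x \<noteq> 0} \<Longrightarrow> norm x \<le> R"
    using bounded_pos by blast
  then have "f x = 0" if "norm x > R" for x
    using closure_subset[of "{x. f x \<noteq> 0}"] that by (force simp: not_less[symmetric])
  then show ?thesis using that \<open>R > 0\<close> by blast
qed

lemma partial_eq_0:
  assumes "open S" "x \<in> S" "\<And>y. y \<in> S \<Longrightarrow> f y = c"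
  shows "partial i f x = 0"
proof -
  have "(f has_derivative (\<lambda>h. 0)) (at x)"
    by (rule has_derivative_transform_within_open[OF has_derivative_const[of c] assms(1,2)])
      (use assms(3) in auto)
  then show ?thesis by (rule partial_eqI)
qed

lemma test_function_partial:
  assumes "f \<in> test_functions"
  shows "partial i f \<in> test_functions"
proof -
  obtain R where R: "\<And>x. norm x > R \<Longrightarrow> f x = 0" using test_function_support[OF assms] by blast
  show ?thesis
  proof (rule test_functionI)
    show "smooth (partial i f)" by (rule smooth_partial[OF test_function_smooth[OF assms]])
    show "partial i f x = 0" if "norm x > R" for x
      by (rule partial_eq_0[of "- cball 0 R" _ _ 0]) (use R that in \<open>auto simp: not_le\<close>)
  qed
qed

lemma test_function_scaleR:
  assumes "smooth \<zeta>" "f \<in> test_functions"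
  shows "(\<lambda>x. \<zeta> x *\<^sub>R f x) \<in> test_functions"
proof -
  obtain R where "\<And>x. norm x > R \<Longrightarrow> f x = 0" using test_function_support[OF assms(2)] by blast
  then show ?thesis
    using assms test_function_smooth[OF assms(2)] by (intro test_functionI[of _ R]) (auto intro: Ck_scaleR)
qed

lemma test_function_of_real:
  assumes "f \<in> test_functions"
  shows "(\<lambda>x. complex_of_real (f x)) \<in> test_functions"
proof -
  obtain R where "\<And>x. norm x > R \<Longrightarrow> f x = 0" using test_function_support[OF assms] by blast
  then show ?thesis
    using test_function_smooth[OF assms]
    by (intro test_functionI[of _ R]) (auto intro: Ck_bounded_linear bounded_linear_of_real)
qed

lemma measurable_lebesgue_of_continuous:
  "continuous_on UNIV f \<Longrightarrow> f \<in> borel_measurable lebesgue"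
  by (intro measurable_completion) (simp add: borel_measurable_continuous_onI)

lemma smooth_measurable:
  fixes f :: "real^'n::finite \<Rightarrow> 'b::real_normed_vector"
  shows "smooth f \<Longrightarrow> f \<in> borel_measurable lebesgue"
  using Ck_continuous[of 0 f] by (intro measurable_lebesgue_of_continuous) auto

lemma integrable_continuous_support:
  fixes f :: "'a::euclidean_space \<Rightarrow> 'b::{banach, second_countable_topology}"
  assumes "continuous_on UNIV f" "\<And>x. norm x > R \<Longrightarrow> f x = 0"
  shows "integrable lebesgue f" "integrable lborel f"
proof -
  have "integrable lborel (\<lambda>x. indicator (cball 0 R) x *\<^sub>R f x)"
    using assms(1) by (intro borel_integrable_compact) (auto intro: continuous_on_subset)
  moreover have "(\<lambda>x. indicator (cball 0 R) x *\<^sub>R f x) = f"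
    using assms(2) by (force simp: indicator_def not_le)
  ultimately show "integrable lborel f" by simp
  then show "integrable lebesgue f"
    using assms(1) by (subst integrable_completion) (auto intro: borel_measurable_continuous_onI)
qed

lemma test_function_sqint:
  fixes f :: "real^'n::finite \<Rightarrow> 'b::euclidean_space"
  assumes "f \<in> test_functions"
  shows "f \<in> sqint"
proof -
  obtain R where R: "\<And>x. norm x > R \<Longrightarrow> f x = 0" using test_function_support[OF assms] by blast
  have c: "continuous_on UNIV f" using Ck_continuous test_function_smooth[OF assms] by blast
  have "integrable lebesgue (\<lambda>x. (norm (f x))\<^sup>2)"
    by (rule integrable_continuous_support[of _ R]) (use R c in \<open>auto intro!: continuous_intros\<close>)
  then show ?thesis using measurable_lebesgue_of_continuous[OF c] by (simp add: sqint_def)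
qed

lemma test_function_integrable:
  fixes f :: "real^'n::finite \<Rightarrow> 'b::euclidean_space"
  assumes "f \<in> test_functions"
  shows "integrable lebesgue f"
proof -
  obtain R where R: "\<And>x. norm x > R \<Longrightarrow> f x = 0" using test_function_support[OF assms] by blast
  have c: "continuous_on UNIV f" using Ck_continuous test_function_smooth[OF assms] by blast
  show ?thesis using integrable_continuous_support(1)[OF c R] .
qed

lemma test_function_bounded:
  assumes "f \<in> test_functions"
  obtains c where "c \<ge> 0" "\<And>x. norm (f x) \<le> c"
proof -
  obtain R where R: "\<And>x. norm x > R \<Longrightarrow> f x = 0" using test_function_support[OF assms] by blast
  have c: "continuous_on UNIV f" using Ck_continuous test_function_smooth[OF assms] by blast
  have "compact (f ` cball 0 R)"
    by (intro compact_continuous_image compact_cball continuous_on_subset[OF c]) auto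
  then obtain B where B: "B > 0" "\<And>x. x \<in> cball 0 R \<Longrightarrow> norm (f x) \<le> B"
    using compact_imp_bounded bounded_pos by (metis image_eqI)
  have "norm (f x) \<le> B" for x
    using B(1) B(2)[of x] R[of x] by (cases "norm x > R") auto
  then show ?thesis using that[of B] B(1) by simp
qed

lemma integral_lebesgue_translation:
  fixes f :: "'a::euclidean_space \<Rightarrow> 'b::{banach, second_countable_topology}"
  assumes "continuous_on UNIV f"
  shows "(\<integral>x. f (h + x) \<partial>lebesgue) = (\<integral>x. f x \<partial>lebesgue)"
proof -
  have [measurable]: "f \<in> borel_measurable borel"
    using assms by (rule borel_measurable_continuous_onI)
  have "(\<integral>x. f (h + x) \<partial>lebesgue) = (\<integral>x. f (h + x) \<partial>lborel)"
    by (rule integral_completion) measurable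
  also have "\<dots> = (\<integral>x. f x \<partial>distr lborel borel ((+) h))"
    by (subst integral_distr) auto
  also have "\<dots> = (\<integral>x. f x \<partial>lebesgue)"
    unfolding lborel_distr_plus by (rule integral_completion[symmetric]) measurable
  finally show ?thesis .
qed

section \<open>Integration by parts through translation invariance\<close>

lemma has_vector_derivative_line:
  assumes "f differentiable (at (x + t *\<^sub>R axis i 1))"
  shows "((\<lambda>t. f (x + t *\<^sub>R axis i 1)) has_vector_derivative partial i f (x + t *\<^sub>R axis i 1)) (at t)"
proof -
  let ?y = "x + t *\<^sub>R axis i 1"
  have f: "(f has_derivative frechet_derivative f (at ?y)) (at ?y)"
    using assms frechet_derivative_works by blast
  have "((\<lambda>t. x + t *\<^sub>R axis i 1) has_derivative (\<lambda>h. h *\<^sub>R axis i 1)) (at t)"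
    by (auto intro!: derivative_eq_intros)
  from has_derivative_compose[OF this f]
  have "((\<lambda>t. f (x + t *\<^sub>R axis i 1)) has_derivative (\<lambda>h. frechet_derivative f (at ?y) (h *\<^sub>R axis i 1))) (at t)" .
  moreover have "frechet_derivative f (at ?y) (h *\<^sub>R axis i 1) = h *\<^sub>R partial i f ?y" for h
    using has_derivative_linear[OF f] by (simp add: linear_scale partial_def)
  ultimately show ?thesis by (simp add: has_vector_derivative_def)
qed

text \<open>Difference quotients have integral 0 by translation invariance, and they converge to the
  partial derivative under a common bound. This avoids integrating one coordinate at a time.\<close>

lemma integral_partial_eq_0:
  fixes f :: "real^'n::finite \<Rightarrow> 'b::euclidean_space"
  assumes f: "f \<in> test_functions"
  shows "(\<integral>x. partial i f x \<partial>lebesgue) = 0"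
proof -
  obtain R where R: "R > 0" "\<And>x. norm x > R \<Longrightarrow> f x = 0" using test_function_support[OF f] by blast
  have c: "continuous_on UNIV f" using Ck_continuous test_function_smooth[OF f] by blast
  obtain B where B: "B \<ge> 0" "\<And>x. norm (partial i f x) \<le> B"
    using test_function_bounded[OF test_function_partial[OF f]] by blast
  note line = has_vector_derivative_line[OF smooth_differentiable[OF test_function_smooth[OF f]]]
  define e :: "real^'n" where "e = axis i 1"
  \<comment> \<open>Shifts of length at most 1 keep all supports inside the ball of radius R + 1,
    which carries the dominating function.\<close>
  define t where "t n = inverse (real (Suc n))" for n
  have t: "t n > 0" "t n \<le> 1" for n by (auto simp: t_def inverse_le_1_iff)
  define D where "D n x = (1 / t n) *\<^sub>R (f (t n *\<^sub>R e + x) - f x)" for n x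
  have cont: "continuous_on UNIV (\<lambda>x. f (t n *\<^sub>R e + x))" for n
    by (rule continuous_on_compose2[OF c]) (auto intro!: continuous_intros)
  have far: "norm (t n *\<^sub>R e + x) > R" if "norm x > R + 1" for n x
  proof -
    have "norm (t n *\<^sub>R e) \<le> 1" using t[of n] by (simp add: e_def norm_axis_1)
    then show ?thesis using that norm_triangle_ineq4[of "t n *\<^sub>R e + x" "t n *\<^sub>R e"] by simp
  qed
  have "(\<lambda>n. \<integral>x. D n x \<partial>lebesgue) \<longlonglongrightarrow> (\<integral>x. partial i f x \<partial>lebesgue)"
  proof (rule integral_dominated_convergence[where w = "\<lambda>x. indicator (cball 0 (R + 1)) x *\<^sub>R B"])
    show "partial i f \<in> borel_measurable lebesgue"
      by (intro smooth_measurable test_function_smooth test_function_partial f)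
    show "D n \<in> borel_measurable lebesgue" for n
      unfolding D_def by (intro measurable_lebesgue_of_continuous continuous_intros cont c)
    have "integrable lborel (\<lambda>x::real^'n. indicator (cball 0 (R + 1)) x *\<^sub>R B)"
      by (intro borel_integrable_compact) auto
    then show "integrable lebesgue (\<lambda>x::real^'n. indicator (cball 0 (R + 1)) x *\<^sub>R B)"
      by (subst integrable_completion) auto
    show "AE x in lebesgue. (\<lambda>n. D n x) \<longlonglongrightarrow> partial i f x"
    proof (rule AE_I2)
      fix x
      have "((\<lambda>h. norm (f (x + h *\<^sub>R e) - f x - h *\<^sub>R partial i f x) / norm h) \<longlongrightarrow> 0) (at 0)"
        using line[where x = x and t = 0 and i = i]
        unfolding has_vector_derivative_def has_derivative_at e_def by simp
      moreover have "norm (f (x + h *\<^sub>R e) - f x - h *\<^sub>R partial i f x) / norm h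
          = norm ((1 / h) *\<^sub>R (f (h *\<^sub>R e + x) - f x) - partial i f x)" if "h \<noteq> 0" for h
      proof -
        have "(1 / h) *\<^sub>R (f (h *\<^sub>R e + x) - f x) - partial i f x
            = (1 / h) *\<^sub>R (f (x + h *\<^sub>R e) - f x - h *\<^sub>R partial i f x)"
          using that by (simp add: algebra_simps)
        then show ?thesis by (simp add: divide_inverse)
      qed
      ultimately have "((\<lambda>h. norm ((1 / h) *\<^sub>R (f (h *\<^sub>R e + x) - f x) - partial i f x)) \<longlongrightarrow> 0) (at 0)"
        by (elim Lim_transform_eventually) (auto simp: eventually_at_filter)
      then have d: "((\<lambda>s. (1 / s) *\<^sub>R (f (s *\<^sub>R e + x) - f x)) \<longlongrightarrow> partial i f x) (at 0)"
        by (rule Lim_null[THEN iffD2, OF tendsto_norm_zero_cancel])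
      have "filterlim t (at 0) sequentially"
        using t LIMSEQ_inverse_real_of_nat unfolding filterlim_at t_def
        by (auto simp del: of_nat_Suc)
      from filterlim_compose[OF d this] show "(\<lambda>n. D n x) \<longlonglongrightarrow> partial i f x"
        by (simp add: D_def o_def)
    qed
    fix n
    show "AE x in lebesgue. norm (D n x) \<le> indicator (cball 0 (R + 1)) x *\<^sub>R B"
    proof (rule AE_I2)
      fix x
      show "norm (D n x) \<le> indicator (cball 0 (R + 1)) x *\<^sub>R B"
      proof (cases "norm x > R + 1")
        case True
        then show ?thesis using far[OF True, of n] R by (simp add: D_def)
      next
        case False
        have "norm (f (x + t n *\<^sub>R e) - f (x + 0 *\<^sub>R e)) \<le> B * norm (t n - 0)"
        proof (rule differentiable_bound)
          fix s assume "s \<in> {0..t n}"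
          show "((\<lambda>s. f (x + s *\<^sub>R e)) has_derivative (\<lambda>h. h *\<^sub>R partial i f (x + s *\<^sub>R e))) (at s within {0..t n})"
            using line[where x = x and t = s and i = i] unfolding has_vector_derivative_def e_def by (rule has_derivative_at_withinI)
          show "onorm (\<lambda>h. h *\<^sub>R partial i f (x + s *\<^sub>R e)) \<le> B"
            using B(2)[of "x + s *\<^sub>R e"] by (intro onorm_le) (simp add: mult.commute[of B] mult_left_mono)
        qed (use t[of n] in auto)
        then have "norm (f (t n *\<^sub>R e + x) - f x) \<le> B * t n" using t[of n] by (simp add: add.commute)
        moreover have "norm (D n x) = norm (f (t n *\<^sub>R e + x) - f x) / t n"
          using t[of n] by (simp add: D_def divide_inverse mult.commute)
        ultimately show ?thesis using t[of n] False by (simp add: pos_divide_le_eq)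
      qed
    qed
  qed
  moreover have "(\<integral>x. D n x \<partial>lebesgue) = 0" for n
  proof -
    have "integrable lebesgue (\<lambda>x. f (t n *\<^sub>R e + x))"
      by (rule integrable_continuous_support[of _ "R + 1"]) (use cont far R in auto)
    then have "(\<integral>x. D n x \<partial>lebesgue) = (1 / t n) *\<^sub>R ((\<integral>x. f (t n *\<^sub>R e + x) \<partial>lebesgue) - (\<integral>x. f x \<partial>lebesgue))"
      unfolding D_def using test_function_integrable[OF f] by simp
    then show ?thesis by (simp add: integral_lebesgue_translation[OF c])
  qed
  ultimately show ?thesis by (simp add: LIMSEQ_const_iff)
qed

lemma integral_by_parts:
  fixes f :: "real^'n::finite \<Rightarrow> real" and g :: "real^'n \<Rightarrow> complex"
  assumes f: "smooth f" and g: "g \<in> test_functions"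
  shows "(\<integral>x. f x *\<^sub>R partial i g x \<partial>lebesgue) = - (\<integral>x. partial i f x *\<^sub>R g x \<partial>lebesgue)"
proof -
  have "(\<integral>x. f x *\<^sub>R partial i g x \<partial>lebesgue) + (\<integral>x. partial i f x *\<^sub>R g x \<partial>lebesgue)
      = (\<integral>x. f x *\<^sub>R partial i g x + partial i f x *\<^sub>R g x \<partial>lebesgue)"
    using f g by (intro Bochner_Integration.integral_add[symmetric] test_function_integrable
        test_function_scaleR test_function_partial) (auto intro: smooth_partial[rule_format])
  also have "\<dots> = (\<integral>x. partial i (\<lambda>x. f x *\<^sub>R g x) x \<partial>lebesgue)"
    by (subst partial_scaleR[OF smooth_differentiable smooth_differentiable])
      (use f test_function_smooth[OF g] in auto)
  also have "\<dots> = 0" by (intro integral_partial_eq_0 test_function_scaleR f g)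
  finally show ?thesis by (simp add: add_eq_0_iff)
qed

subsection \<open>The fundamental lemma of the calculus of variations\<close>

text \<open>A product of smooth ramps, one for each face of the box. The factor n sharpens them: at
  an interior point all ramps eventually equal 1, outside one of them is always 0, so the sequence
  is even eventually constant at every point.\<close>

lemma box_indicator_approx:
  fixes a b :: "real^'n::finite"
  obtains \<phi> :: "nat \<Rightarrow> real^'n \<Rightarrow> real" where
    "\<And>n. \<phi> n \<in> test_functions" "\<And>n x. \<bar>\<phi> n x\<bar> \<le> 1" "\<And>n x. x \<notin> box a b \<Longrightarrow> \<phi> n x = 0"
    "\<And>x. (\<lambda>n. \<phi> n x) \<longlonglongrightarrow> indicator (box a b) x"
proof -
  define s where "s t = 1 - step t" for t
  have s: "0 \<le> s t" "s t \<le> 1" for t using step_bounds[of t] by (auto simp: s_def)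
  have s0: "s t = 0" if "t \<le> 0" for t using step_eq_1[of t] that by (simp add: s_def)
  have s1: "s t = 1" if "t \<ge> 1" for t using step_eq_0[of t] that by (simp add: s_def)
  define \<phi> where "\<phi> n x = (\<Prod>i\<in>UNIV. s (real n * (x $ i - a $ i)) * s (real n * (b $ i - x $ i)))"
    for n and x :: "real^'n"
  have zero: "\<phi> n x = 0" if "x \<notin> box a b" for n x
  proof -
    have "\<not> (\<forall>i. a $ i < x $ i \<and> x $ i < b $ i)"
      using that by (simp add: mem_box_cart)
    then obtain i where "x $ i \<le> a $ i \<or> x $ i \<ge> b $ i"
      by (auto simp: not_less)
    then have "s (real n * (x $ i - a $ i)) * s (real n * (b $ i - x $ i)) = 0"
      by (auto intro!: s0 mult_nonneg_nonpos)
    then show ?thesis unfolding \<phi>_def by (intro prod_zero) auto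
  qed
  show ?thesis
  proof (rule that)
    fix n
    have sm: "Ck k (\<lambda>x::real^'n. s (real n * (x $ i - a $ i)) * s (real n * (b $ i - x $ i)))" for k i
      unfolding s_def by (intro Ck_mult Ck_diff Ck_step Ck_const Ck_nth)
    have smooth: "Ck k (\<phi> n)" for k
      using Ck_prod[of k "\<lambda>i x. s (real n * (x $ i - a $ i)) * s (real n * (b $ i - x $ i))" UNIV, OF sm]
      unfolding \<phi>_def[abs_def] .
    obtain R where R: "box a b \<subseteq> cball 0 R"
      using bounded_box[of a b] bounded_iff by (metis mem_cball_0 subsetI)
    show "\<phi> n \<in> test_functions"
      by (rule test_functionI[of _ R]) (use smooth zero R in \<open>force simp: not_le\<close>)+
    fix x
    show "\<bar>\<phi> n x\<bar> \<le> 1"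
    proof -
      have "0 \<le> \<phi> n x" unfolding \<phi>_def by (intro prod_nonneg) (auto simp: s)
      moreover have "\<phi> n x \<le> 1" unfolding \<phi>_def
        by (intro prod_le_1 conjI mult_nonneg_nonneg mult_le_one s)
      ultimately show ?thesis by simp
    qed
    show "\<phi> n x = 0" if "x \<notin> box a b" using zero that .
  next
    fix x
    show "(\<lambda>n. \<phi> n x) \<longlonglongrightarrow> indicator (box a b) x"
    proof (cases "x \<in> box a b")
      case True
      have ev: "\<forall>\<^sub>F n in sequentially. s (real n * d) = 1" if d: "d > 0" for d
      proof -
        obtain N where N: "1 < real N * d" using reals_Archimedean3[OF d] by blast
        show ?thesis using eventually_ge_at_top[of N]
        proof eventually_elim
          case (elim n)
          then have "real N * d \<le> real n * d" using that by simp
          then show ?case using N by (intro s1) linarith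
        qed
      qed
      have "\<forall>\<^sub>F n in sequentially. \<forall>i\<in>UNIV. s (real n * (x $ i - a $ i)) = 1 \<and> s (real n * (b $ i - x $ i)) = 1"
        using True by (intro eventually_ball_finite ballI eventually_conj ev) (auto simp: mem_box_cart)
      then have "\<forall>\<^sub>F n in sequentially. indicator (box a b) x = \<phi> n x"
        by eventually_elim (use True in \<open>simp add: \<phi>_def\<close>)
      then show ?thesis by (rule Lim_transform_eventually[OF tendsto_const])
    qed (simp add: zero)
  qed
qed

lemma integrable_indicator_box:
  fixes g :: "'a::euclidean_space \<Rightarrow> 'b::euclidean_space"
  assumes "g \<in> sqint"
  shows "integrable lebesgue (\<lambda>x. indicator (box a b) x *\<^sub>R g x)"
proof (rule Bochner_Integration.integrable_bound)
  have "integrable lebesgue (indicator (box a b) :: 'a \<Rightarrow> real)"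
    using emeasure_lborel_box_finite[of a b] by (intro integrable_real_indicator) simp_all
  then show "integrable lebesgue (\<lambda>x. indicator (box a b) x + (norm (g x))\<^sup>2)"
    using assms by (intro Bochner_Integration.integrable_add sqint_integrable) auto
  have [measurable]: "g \<in> borel_measurable lebesgue" by (rule sqint_measurable[OF assms])
  show "(\<lambda>x. indicator (box a b) x *\<^sub>R g x) \<in> borel_measurable lebesgue"
    by (intro borel_measurable_scaleR borel_measurable_indicator) auto
  have "n \<le> 1 + n\<^sup>2" for n :: real
    using sum_squares_bound[of 1 n] by (cases "n \<ge> 0") (auto simp: algebra_simps intro: order_trans[of _ 0])
  then show "AE x in lebesgue. norm (indicator (box a b) x *\<^sub>R g x) \<le> norm (indicator (box a b) x + (norm (g x))\<^sup>2)"
    by (auto simp: indicator_def)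
qed

lemma sigma_finite_lebesgue: "sigma_finite_measure (lebesgue :: 'a::euclidean_space measure)"
proof
  let ?A = "range (\<lambda>n. box (- (real n *\<^sub>R One)) (real n *\<^sub>R One :: 'a))"
  have "emeasure lebesgue (box (- (real n *\<^sub>R One)) (real n *\<^sub>R One :: 'a)) \<noteq> \<infinity>" for n
    using emeasure_lborel_box_finite[of "- (real n *\<^sub>R One)" "real n *\<^sub>R One :: 'a"] by auto
  moreover have "\<Union>?A = UNIV" by (rule UN_box_eq_UNIV)
  ultimately show "\<exists>A. countable A \<and> A \<subseteq> sets lebesgue \<and> \<Union>A = space lebesgue \<and>
      (\<forall>a\<in>A. emeasure (lebesgue :: 'a measure) a \<noteq> \<infinity>)"
    by (intro exI[of _ ?A]) auto
qed

text \<open>Boxes are stable under intersection and generate the Borel sets, so vanishing integrals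
  spread by Dynkin's argument. A square-integrable function need not be integrable; hence it is
  first restricted to a fixed box, and the intersection of two boxes is again a box.\<close>

lemma AE_eq_0_of_box_integrals:
  fixes g :: "'a::euclidean_space \<Rightarrow> 'b::euclidean_space"
  assumes g: "g \<in> sqint" and box: "\<And>a b. (\<integral>x. indicator (box a b) x *\<^sub>R g x \<partial>lebesgue) = 0"
  shows "AE x in lebesgue. g x = 0"
proof -
  have "AE x in lebesgue. indicator (box c d) x *\<^sub>R g x = 0" for c d
  proof (rule sigma_finite_measure.density_zero[OF sigma_finite_lebesgue])
    define G where "G x = indicator (box c d) x *\<^sub>R g x" for x
    have G: "integrable lebesgue G" unfolding G_def by (rule integrable_indicator_box[OF g])
    show "integrable lebesgue (\<lambda>x. indicator (box c d) x *\<^sub>R g x)" by (rule integrable_indicator_box[OF g])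
    have UN: "(\<integral>x. G x \<partial>lebesgue) = 0" unfolding G_def by (rule box)
    have borel: "set_lebesgue_integral lebesgue A G = 0" if "A \<in> sets borel" for A
    proof -
      have si: "set_integrable lebesgue A G" if "A \<in> sets borel" for A
        unfolding set_integrable_def using that by (intro integrable_mult_indicator G) auto
      have "Int_stable (range (\<lambda>(a, b). box a b :: 'a set))"
        by (auto simp: Int_stable_def box_Int_box)
      moreover have "range (\<lambda>(a, b). box a b :: 'a set) \<subseteq> Pow UNIV" by simp
      moreover have eq: "sigma_sets UNIV (range (\<lambda>(a, b). box a b :: 'a set)) = sets borel"
        by (subst borel_eq_box) simp
      then have "A \<in> sigma_sets UNIV (range (\<lambda>(a, b). box a b :: 'a set))" using that by simp
      ultimately show ?thesis
      proof (induction rule: sigma_sets_induct_disjoint)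
        case (basic A)
        then obtain a b where A: "A = box a b" by auto
        have "indicator A x *\<^sub>R G x = indicator (A \<inter> box c d) x *\<^sub>R g x" for x
          by (simp add: G_def indicator_def)
        then show ?case unfolding set_lebesgue_integral_def A by (simp add: box_Int_box box)
      next
        case (compl A)
        then have A: "A \<in> sets borel" by (simp add: eq)
        have "indicator (UNIV - A) x *\<^sub>R G x = G x - indicator A x *\<^sub>R G x" for x
          by (simp add: indicator_def)
        then show ?case
          using compl(2) G UN si[OF A] unfolding set_lebesgue_integral_def set_integrable_def by simp
      next
        case (union A)
        have A: "A i \<in> sets borel" for i using union(2) eq by auto
        have "set_lebesgue_integral lebesgue (\<Union>i. A i) G = (\<Sum>i. set_lebesgue_integral lebesgue (A i) G)"
          by (rule lebesgue_integral_countable_add)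
            (use A union(1) in \<open>auto simp: disjoint_family_on_def intro!: si\<close>)
        then show ?case using union(3) by simp
      qed (simp add: set_lebesgue_integral_def)
    qed
    \<comment> \<open>A Lebesgue set is a Borel set up to part of a null set, and the integral does
      not see the difference.\<close>
    fix A :: "'a set" assume "A \<in> sets lebesgue"
    then obtain S N N' where S: "A = S \<union> N" "N \<subseteq> N'" "N' \<in> null_sets lborel" "S \<in> sets lborel"
      by (rule sets_completionE)
    have "AE x in lebesgue. x \<notin> N'"
      using S(3) by (intro AE_not_in) (simp add: null_sets_completionI)
    then have "AE x in lebesgue. indicator A x *\<^sub>R G x = indicator S x *\<^sub>R G x"
      by eventually_elim (use S in \<open>auto simp: indicator_def\<close>)
    then have "set_lebesgue_integral lebesgue A G = set_lebesgue_integral lebesgue S G"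
      unfolding set_lebesgue_integral_def
      using G \<open>A \<in> sets lebesgue\<close> S(4)
      by (intro integral_cong_AE borel_measurable_scaleR borel_measurable_indicator) auto
    then show "set_lebesgue_integral lebesgue A (\<lambda>x. indicator (box c d) x *\<^sub>R g x) = 0"
      using borel[of S] S(4) by (simp add: G_def[abs_def])
  qed
  then have "AE x in lebesgue. \<forall>n. indicator (box (- (real n *\<^sub>R One)) (real n *\<^sub>R One)) x *\<^sub>R g x = 0"
    by (intro AE_all_countable[THEN iffD2] allI)
  then show ?thesis
  proof eventually_elim
    case (elim x)
    obtain n where "x \<in> box (- (real n *\<^sub>R One)) (real n *\<^sub>R One)"
      using UN_box_eq_UNIV by blast
    then show ?case using elim[rule_format, of n] by simp
  qed
qed

lemma fundamental_lemma:
  fixes g :: "real^'n::finite \<Rightarrow> complex"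
  assumes g: "g \<in> sqint" and zero: "\<And>\<phi>. \<phi> \<in> test_functions \<Longrightarrow> (\<integral>x. g x * \<phi> x \<partial>lebesgue) = 0"
  shows "AE x in lebesgue. g x = 0"
proof (rule AE_eq_0_of_box_integrals[OF g])
  fix a b :: "real^'n"
  obtain \<phi> :: "nat \<Rightarrow> real^'n \<Rightarrow> real" where \<phi>: "\<And>n. \<phi> n \<in> test_functions"
      "\<And>n x. \<bar>\<phi> n x\<bar> \<le> 1" "\<And>n x. x \<notin> box a b \<Longrightarrow> \<phi> n x = 0"
      "\<And>x. (\<lambda>n. \<phi> n x) \<longlonglongrightarrow> indicator (box a b) x"
    using box_indicator_approx[of a b] by blast
  have [measurable]: "g \<in> borel_measurable lebesgue" by (rule sqint_measurable[OF g])
  have [measurable]: "\<phi> n \<in> borel_measurable lebesgue" for n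
    using \<phi>(1) by (intro smooth_measurable test_function_smooth)
  have "(\<lambda>n. \<integral>x. \<phi> n x *\<^sub>R g x \<partial>lebesgue) \<longlonglongrightarrow> (\<integral>x. indicator (box a b) x *\<^sub>R g x \<partial>lebesgue)"
  proof (rule integral_dominated_convergence[where w = "\<lambda>x. norm (indicator (box a b) x *\<^sub>R g x)"])
    show "integrable lebesgue (\<lambda>x. norm (indicator (box a b) x *\<^sub>R g x))"
      by (intro integrable_norm integrable_indicator_box g)
    show "AE x in lebesgue. (\<lambda>n. \<phi> n x *\<^sub>R g x) \<longlonglongrightarrow> indicator (box a b) x *\<^sub>R g x"
      by (intro AE_I2 tendsto_intros \<phi>(4))
    show "AE x in lebesgue. norm (\<phi> n x *\<^sub>R g x) \<le> norm (indicator (box a b) x *\<^sub>R g x)" for n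
      using \<phi>(2,3) by (intro AE_I2) (auto simp: indicator_def mult_left_le_one_le)
    show "(\<lambda>x. indicator (box a b) x *\<^sub>R g x) \<in> borel_measurable lebesgue"
    by (intro borel_measurable_scaleR borel_measurable_indicator) auto
    show "(\<lambda>x. \<phi> n x *\<^sub>R g x) \<in> borel_measurable lebesgue" for n by measurable
  qed
  moreover have "(\<integral>x. \<phi> n x *\<^sub>R g x \<partial>lebesgue) = 0" for n
    using zero[OF test_function_of_real[OF \<phi>(1)[of n]]] by (simp add: scaleR_conv_of_real mult.commute)
  ultimately show "(\<integral>x. indicator (box a b) x *\<^sub>R g x \<partial>lebesgue) = 0"
    by (simp add: LIMSEQ_const_iff)
qed

section \<open>Weak gradients\<close>

lemma L2_eq_sqint: "L2 = sqint"
  by (simp add: L2_def sqint_def)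

lemma sqint_norm: "f \<in> sqint \<Longrightarrow> (\<lambda>x. norm (f x)) \<in> sqint"
  by (rule sqint_bound[of f _ 1]) (auto dest: sqint_measurable)

lemma sqint_mult_integrable:
  fixes f g :: "'a::euclidean_space \<Rightarrow> complex"
  assumes "f \<in> sqint" "g \<in> sqint"
  shows "integrable lebesgue (\<lambda>x. f x * g x)"
proof (rule Bochner_Integration.integrable_bound[OF sqint_inner_integrable[OF assms[THEN sqint_norm]]])
  show "(\<lambda>x. f x * g x) \<in> borel_measurable lebesgue"
    using assms by (intro borel_measurable_times sqint_measurable)
qed (simp add: norm_mult)

lemma norm_integral_mult_le:
  fixes f g :: "'a::euclidean_space \<Rightarrow> complex"
  assumes "f \<in> sqint" "g \<in> sqint"
  shows "norm (\<integral>x. f x * g x \<partial>lebesgue) \<le> sqrt (ip f f) * sqrt (ip g g)"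
proof -
  have "norm (\<integral>x. f x * g x \<partial>lebesgue) \<le> (\<integral>x. norm (f x * g x) \<partial>lebesgue)" by (rule integral_norm_bound)
  also have "\<dots> = ip (\<lambda>x. norm (f x)) (\<lambda>x. norm (g x))" by (simp add: ip_def norm_mult)
  also have "\<dots> \<le> sqrt (ip (\<lambda>x. norm (f x)) (\<lambda>x. norm (f x))) * sqrt (ip (\<lambda>x. norm (g x)) (\<lambda>x. norm (g x)))"
    using ip_Cauchy_Schwarz[OF assms[THEN sqint_norm]] by linarith
  finally show ?thesis by (simp add: ip_self)
qed

lemma sqint_cnj:
  assumes "f \<in> sqint"
  shows "(\<lambda>x. cnj (f x)) \<in> sqint"
proof (rule sqint_bound[OF assms, of _ 1])
  show "(\<lambda>x. cnj (f x)) \<in> borel_measurable lebesgue"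
    by (rule borel_measurable_continuous_on[OF _ sqint_measurable[OF assms]]) (intro continuous_intros)
qed simp

lemma sqint_cmult: 
  fixes c :: complex
  shows "f \<in> sqint \<Longrightarrow> (\<lambda>x. c * f x) \<in> sqint"
  by (rule sqint_bound[of f _ "norm c"]) (auto dest: sqint_measurable simp: norm_mult)

lemma L2_inner_integrable: "f \<in> sqint \<Longrightarrow> g \<in> sqint \<Longrightarrow> integrable lebesgue (\<lambda>x. cnj (f x) * g x)"
  by (intro sqint_mult_integrable sqint_cnj)

lemma Re_L2_inner: "f \<in> sqint \<Longrightarrow> g \<in> sqint \<Longrightarrow> Re (L2_inner f g) = ip f g"
  unfolding L2_inner_def ip_def
  by (subst integral_Re[symmetric]) (auto intro: L2_inner_integrable simp: inner_complex_def)

lemma Im_L2_inner: "f \<in> sqint \<Longrightarrow> g \<in> sqint \<Longrightarrow> Im (L2_inner f g) = ip (\<lambda>x. \<i> * f x) g"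
  unfolding L2_inner_def ip_def
  by (subst integral_Im[symmetric]) (auto intro: L2_inner_integrable simp: inner_complex_def)

lemma borel_measurable_vec:
  fixes F :: "'a \<Rightarrow> 'b::euclidean_space^'n::finite"
  assumes "\<And>i. (\<lambda>x. F x $ i) \<in> borel_measurable M"
  shows "F \<in> borel_measurable M"
proof -
  have "(\<lambda>x. \<Sum>i\<in>UNIV. axis i (F x $ i)) \<in> borel_measurable M"
  proof (intro borel_measurable_sum)
    fix i :: 'n
    have "linear (axis i :: 'b \<Rightarrow> 'b^'n)"
      by (rule linearI) (simp_all add: axis_def vec_eq_iff)
    then have "continuous_on UNIV (axis i :: 'b \<Rightarrow> 'b^'n)"
      by (intro linear_continuous_on) (simp add: linear_conv_bounded_linear)
    then show "(\<lambda>x. axis i (F x $ i)) \<in> borel_measurable M"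
      by (rule borel_measurable_continuous_on) (rule assms)
  qed
  moreover have "(\<Sum>i\<in>UNIV. axis i (F x $ i)) = F x" for x
    unfolding vec_eq_iff sum_component axis_def by simp
  ultimately show ?thesis by simp
qed

lemma sqint_vec_iff:
  fixes G :: "real^'n::finite \<Rightarrow> complex^'n"
  shows "G \<in> sqint \<longleftrightarrow> (\<forall>i. (\<lambda>x. G x $ i) \<in> sqint)"
proof
  assume G: "G \<in> sqint"
  show "\<forall>i. (\<lambda>x. G x $ i) \<in> sqint"
  proof
    fix i
    show "(\<lambda>x. G x $ i) \<in> sqint"
    proof (rule sqint_bound[OF G, of _ 1])
      show "(\<lambda>x. G x $ i) \<in> borel_measurable lebesgue"
        by (rule borel_measurable_continuous_on[OF _ sqint_measurable[OF G]]) (intro continuous_intros)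
      show "AE x in lebesgue. norm (G x $ i) \<le> 1 * norm (G x)"
        by (simp add: Finite_Cartesian_Product.norm_nth_le)
    qed
  qed
next
  assume G: "\<forall>i. (\<lambda>x. G x $ i) \<in> sqint"
  have "G \<in> borel_measurable lebesgue"
    using G by (intro borel_measurable_vec) (auto dest: sqint_measurable)
  moreover have "(norm (G x))\<^sup>2 = (\<Sum>i\<in>UNIV. (norm (G x $ i))\<^sup>2)" for x
    by (simp add: norm_vec_def L2_set_def sum_nonneg)
  ultimately show "G \<in> sqint" using G
    by (auto simp: sqint_def)
qed

text \<open>A gradient travels with its function as explicit data, so that sums, products and limits
  come with explicit gradients. The chosen \<open>weak_gradient\<close> returns only in
  \<open>resolvent_of_sol\<close>, where \<open>wgrad_unique\<close> makes the choice
  harmless.\<close>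

definition wgrad :: "(real^'n::finite \<Rightarrow> complex) \<Rightarrow> (real^'n \<Rightarrow> complex^'n) \<Rightarrow> bool" where
  "wgrad u G \<longleftrightarrow> u \<in> sqint \<and> is_weak_gradient u G"

lemma wgrad_sqint: "wgrad u G \<Longrightarrow> u \<in> sqint" "wgrad u G \<Longrightarrow> G \<in> sqint"
  by (auto simp: wgrad_def is_weak_gradient_def sqint_vec_iff L2_eq_sqint)

lemma wgrad_eq:
  "wgrad u G \<Longrightarrow> \<phi> \<in> test_functions \<Longrightarrow>
    (\<integral>x. u x * partial i \<phi> x \<partial>lebesgue) = - (\<integral>x. G x $ i * \<phi> x \<partial>lebesgue)"
  by (simp add: wgrad_def is_weak_gradient_def)

lemma wgradI:
  assumes "u \<in> sqint" "G \<in> sqint"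
    "\<And>i \<phi>. \<phi> \<in> test_functions \<Longrightarrow>
      (\<integral>x. u x * partial i \<phi> x \<partial>lebesgue) = - (\<integral>x. G x $ i * \<phi> x \<partial>lebesgue)"
  shows "wgrad u G"
  using assms by (simp add: wgrad_def is_weak_gradient_def L2_eq_sqint sqint_vec_iff)

lemma wgrad_weak_gradient: "u \<in> W12 \<Longrightarrow> wgrad u (weak_gradient u)"
  unfolding W12_def weak_gradient_def wgrad_def L2_eq_sqint by (metis (mono_tags, lifting) mem_Collect_eq someI_ex)

lemma wgrad_W12: "wgrad u G \<Longrightarrow> u \<in> W12"
  by (auto simp: W12_def wgrad_def L2_eq_sqint)

lemma wgrad_nth_sqint: "wgrad u G \<Longrightarrow> (\<lambda>x. G x $ i) \<in> sqint"
  using wgrad_sqint(2) sqint_vec_iff by blast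

lemma wgrad_add:
  assumes "wgrad u G" "wgrad v G'"
  shows "wgrad (\<lambda>x. u x + v x) (\<lambda>x. G x + G' x)"
proof (rule wgradI)
  fix i and \<phi> :: "real^'a \<Rightarrow> complex" assume \<phi>: "\<phi> \<in> test_functions"
  note s = test_function_sqint[OF \<phi>] test_function_sqint[OF test_function_partial[OF \<phi>]]
  show "(\<integral>x. (u x + v x) * partial i \<phi> x \<partial>lebesgue) = - (\<integral>x. (G x + G' x) $ i * \<phi> x \<partial>lebesgue)"
    using wgrad_eq[OF assms(1) \<phi>] wgrad_eq[OF assms(2) \<phi>]
      wgrad_sqint(1)[OF assms(1)] wgrad_sqint(1)[OF assms(2)]
      wgrad_nth_sqint[OF assms(1)] wgrad_nth_sqint[OF assms(2)] s
    by (simp add: distrib_right sqint_mult_integrable)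
qed (intro sqint_add wgrad_sqint(1)[OF assms(1)] wgrad_sqint(1)[OF assms(2)]
    wgrad_sqint(2)[OF assms(1)] wgrad_sqint(2)[OF assms(2)])+

lemma wgrad_cmult:
  assumes "wgrad u G"
  shows "wgrad (\<lambda>x. c * u x) (\<lambda>x. \<chi> i. c * G x $ i)"
proof (rule wgradI)
  fix i and \<phi> :: "real^'a \<Rightarrow> complex" assume \<phi>: "\<phi> \<in> test_functions"
  show "(\<integral>x. c * u x * partial i \<phi> x \<partial>lebesgue) = - (\<integral>x. (\<chi> i. c * G x $ i) $ i * \<phi> x \<partial>lebesgue)"
    using wgrad_eq[OF assms \<phi>, of i] by (simp add: mult.assoc)
next
  show "(\<lambda>x. c * u x) \<in> sqint" by (intro sqint_cmult wgrad_sqint(1)[OF assms])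
  show "(\<lambda>x. \<chi> i. c * G x $ i) \<in> sqint"
    by (simp add: sqint_vec_iff sqint_cmult wgrad_nth_sqint[OF assms])
qed

lemma wgrad_scaleR:
  assumes "wgrad u G"
  shows "wgrad (\<lambda>x. c *\<^sub>R u x) (\<lambda>x. c *\<^sub>R G x)"
proof -
  have "(\<chi> i. complex_of_real c * G x $ i) = c *\<^sub>R G x" for x
    by (simp add: vec_eq_iff) (simp add: scaleR_conv_of_real)
  moreover have "complex_of_real c * u x = c *\<^sub>R u x" for x by (simp add: scaleR_conv_of_real)
  ultimately show ?thesis using wgrad_cmult[OF assms, of "of_real c"] by simp
qed

lemma wgrad_unique:
  assumes "wgrad u G" "wgrad u G'"
  shows "AE x in lebesgue. G x = G' x"
proof -
  have "AE x in lebesgue. G x $ i - G' x $ i = 0" for i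
  proof (rule fundamental_lemma)
    show "(\<lambda>x. G x $ i - G' x $ i) \<in> sqint"
      by (intro sqint_diff wgrad_nth_sqint[OF assms(1)] wgrad_nth_sqint[OF assms(2)])
    fix \<phi> :: "real^'a \<Rightarrow> complex" assume \<phi>: "\<phi> \<in> test_functions"
    show "(\<integral>x. (G x $ i - G' x $ i) * \<phi> x \<partial>lebesgue) = 0"
      using wgrad_eq[OF assms(1) \<phi>, of i] wgrad_eq[OF assms(2) \<phi>, of i]
        wgrad_nth_sqint[OF assms(1)] wgrad_nth_sqint[OF assms(2)] test_function_sqint[OF \<phi>]
      by (simp add: left_diff_distrib sqint_mult_integrable)
  qed
  then have "AE x in lebesgue. \<forall>i. G x $ i - G' x $ i = 0"
    by (simp add: AE_all_countable)
  then show ?thesis by eventually_elim (simp add: vec_eq_iff)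
qed

section \<open>Product rule and closedness for weak gradients\<close>

definition grad :: "(real^'n::finite \<Rightarrow> real) \<Rightarrow> real^'n \<Rightarrow> real^'n" where
  "grad f x = (\<chi> i. partial i f x)"

text \<open>The tensor product of a real vector with a complex number: differentiating \<zeta> u
  contributes grad \<zeta> times the value of u.\<close>

definition cvec :: "real^'n::finite \<Rightarrow> complex \<Rightarrow> complex^'n" where
  "cvec \<xi> z = (\<chi> i. \<xi> $ i *\<^sub>R z)"

lemma grad_measurable: "smooth f \<Longrightarrow> grad f \<in> borel_measurable lebesgue"
  unfolding grad_def[abs_def]
  by (intro borel_measurable_vec) (simp add: smooth_measurable smooth_partial)

lemma norm_cvec: "norm (cvec \<xi> z) = norm \<xi> * norm z"
  by (simp add: cvec_def norm_vec_def L2_set_def power_mult_distrib real_sqrt_mult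
      flip: sum_distrib_right)

lemma cvec_measurable:
  assumes "F \<in> borel_measurable lebesgue" "u \<in> borel_measurable lebesgue"
  shows "(\<lambda>x. cvec (F x) (u x)) \<in> borel_measurable lebesgue"
proof (rule borel_measurable_vec)
  fix i
  have "(\<lambda>x. F x $ i) \<in> borel_measurable lebesgue"
    by (rule borel_measurable_continuous_on[OF _ assms(1)]) (intro continuous_intros)
  then show "(\<lambda>x. cvec (F x) (u x) $ i) \<in> borel_measurable lebesgue"
    using assms(2) by (simp add: cvec_def)
qed

text \<open>The weak identity of u is used with the test function \<zeta> \<phi>. The gradient of
  \<zeta> is bounded almost everywhere rather than everywhere because it is derived from energy
  bounds, and the coefficients are only measurable.\<close>

lemma wgrad_mult:
  assumes u: "wgrad u G" and \<zeta>: "smooth \<zeta>" and b: "\<And>x. \<bar>\<zeta> x\<bar> \<le> c" "AE x in lebesgue. norm (grad \<zeta> x) \<le> c'"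
  shows "wgrad (\<lambda>x. \<zeta> x *\<^sub>R u x) (\<lambda>x. \<zeta> x *\<^sub>R G x + cvec (grad \<zeta> x) (u x))"
proof (rule wgradI)
  note us = wgrad_sqint[OF u]
  have [measurable]: "\<zeta> \<in> borel_measurable lebesgue" by (rule smooth_measurable[OF \<zeta>])
  show 1: "(\<lambda>x. \<zeta> x *\<^sub>R u x) \<in> sqint"
    by (rule sqint_bound[OF us(1), of _ c])
      (use b us(1) in \<open>auto intro!: borel_measurable_scaleR mult_right_mono dest: sqint_measurable\<close>)
  have 2: "(\<lambda>x. \<zeta> x *\<^sub>R G x) \<in> sqint"
    by (rule sqint_bound[OF us(2), of _ c])
      (use b us(2) in \<open>auto intro!: borel_measurable_scaleR mult_right_mono dest: sqint_measurable\<close>)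
  have 3: "(\<lambda>x. cvec (grad \<zeta> x) (u x)) \<in> sqint"
  proof (rule sqint_bound[OF us(1), of _ c'])
    show "(\<lambda>x. cvec (grad \<zeta> x) (u x)) \<in> borel_measurable lebesgue"
      by (intro cvec_measurable grad_measurable \<zeta> sqint_measurable us)
    show "AE x in lebesgue. norm (cvec (grad \<zeta> x) (u x)) \<le> c' * norm (u x)"
      using b(2) by eventually_elim (simp add: norm_cvec mult_right_mono)
  qed
  show "(\<lambda>x. \<zeta> x *\<^sub>R G x + cvec (grad \<zeta> x) (u x)) \<in> sqint" by (intro sqint_add 2 3)
  fix i and \<phi> :: "real^'a \<Rightarrow> complex" assume \<phi>: "\<phi> \<in> test_functions"
  have z\<phi>: "(\<lambda>x. \<zeta> x *\<^sub>R \<phi> x) \<in> test_functions" by (rule test_function_scaleR[OF \<zeta> \<phi>])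
  have d\<phi>: "(\<lambda>x. partial i \<zeta> x *\<^sub>R \<phi> x) \<in> test_functions"
    by (rule test_function_scaleR[OF smooth_partial[OF \<zeta>] \<phi>])
  have zd\<phi>: "(\<lambda>x. \<zeta> x *\<^sub>R partial i \<phi> x) \<in> test_functions"
    by (rule test_function_scaleR[OF \<zeta> test_function_partial[OF \<phi>]])
  have p: "partial i (\<lambda>x. \<zeta> x *\<^sub>R \<phi> x) x = \<zeta> x *\<^sub>R partial i \<phi> x + partial i \<zeta> x *\<^sub>R \<phi> x" for x
    by (intro partial_scaleR smooth_differentiable \<zeta> test_function_smooth[OF \<phi>])
  have i1: "integrable lebesgue (\<lambda>x. u x * (\<zeta> x *\<^sub>R partial i \<phi> x))"
    by (intro sqint_mult_integrable us test_function_sqint zd\<phi>)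
  have i2: "integrable lebesgue (\<lambda>x. u x * (partial i \<zeta> x *\<^sub>R \<phi> x))"
    by (intro sqint_mult_integrable us test_function_sqint d\<phi>)
  have i3: "integrable lebesgue (\<lambda>x. G x $ i * (\<zeta> x *\<^sub>R \<phi> x))"
    by (intro sqint_mult_integrable wgrad_nth_sqint[OF u] test_function_sqint z\<phi>)
  have "(\<integral>x. \<zeta> x *\<^sub>R u x * partial i \<phi> x \<partial>lebesgue)
      = (\<integral>x. u x * partial i (\<lambda>x. \<zeta> x *\<^sub>R \<phi> x) x - u x * (partial i \<zeta> x *\<^sub>R \<phi> x) \<partial>lebesgue)"
    by (simp add: p algebra_simps)
  also have "\<dots> = (\<integral>x. u x * partial i (\<lambda>x. \<zeta> x *\<^sub>R \<phi> x) x \<partial>lebesgue)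
      - (\<integral>x. u x * (partial i \<zeta> x *\<^sub>R \<phi> x) \<partial>lebesgue)"
    using i1 i2 by (intro Bochner_Integration.integral_diff) (simp_all add: p algebra_simps)
  also have "\<dots> = - ((\<integral>x. G x $ i * (\<zeta> x *\<^sub>R \<phi> x) \<partial>lebesgue) + (\<integral>x. u x * (partial i \<zeta> x *\<^sub>R \<phi> x) \<partial>lebesgue))"
    using wgrad_eq[OF u z\<phi>, of i] by simp
  also have "(\<integral>x. G x $ i * (\<zeta> x *\<^sub>R \<phi> x) \<partial>lebesgue) + (\<integral>x. u x * (partial i \<zeta> x *\<^sub>R \<phi> x) \<partial>lebesgue)
     = (\<integral>x. (\<zeta> x *\<^sub>R G x + cvec (grad \<zeta> x) (u x)) $ i * \<phi> x \<partial>lebesgue)"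
    using i2 i3 by (subst Bochner_Integration.integral_add[symmetric])
      (auto simp: cvec_def grad_def algebra_simps)
  finally show "(\<integral>x. \<zeta> x *\<^sub>R u x * partial i \<phi> x \<partial>lebesgue)
      = - (\<integral>x. (\<zeta> x *\<^sub>R G x + cvec (grad \<zeta> x) (u x)) $ i * \<phi> x \<partial>lebesgue)" .
qed

lemma wgrad_test_function:
  fixes \<eta> :: "real^'n::finite \<Rightarrow> real"
  assumes \<eta>: "\<eta> \<in> test_functions"
  shows "wgrad (\<lambda>x. complex_of_real (\<eta> x)) (\<lambda>x. cvec (grad \<eta> x) 1)"
proof (rule wgradI)
  show "(\<lambda>x. complex_of_real (\<eta> x)) \<in> sqint" by (intro test_function_sqint test_function_of_real \<eta>)
  have "(\<lambda>x. complex_of_real (partial i \<eta> x)) \<in> sqint" for i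
    by (intro test_function_sqint test_function_of_real test_function_partial \<eta>)
  then show "(\<lambda>x. cvec (grad \<eta> x) 1) \<in> sqint"
    by (simp add: sqint_vec_iff cvec_def grad_def scaleR_conv_of_real)
  fix i and \<phi> :: "real^'n \<Rightarrow> complex" assume "\<phi> \<in> test_functions"
  then show "(\<integral>x. complex_of_real (\<eta> x) * partial i \<phi> x \<partial>lebesgue)
      = - (\<integral>x. cvec (grad \<eta> x) 1 $ i * \<phi> x \<partial>lebesgue)"
    using integral_by_parts[OF test_function_smooth[OF \<eta>], of \<phi> i]
    by (simp add: cvec_def grad_def scaleR_conv_of_real)
qed

lemma integral_mult_tendsto:
  fixes g \<phi> :: "'a::euclidean_space \<Rightarrow> complex"
  assumes "\<And>n. f n \<in> sqint" "g \<in> sqint" "\<phi> \<in> sqint"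
    and "(\<lambda>n. dsq (f n) g) \<longlonglongrightarrow> 0"
  shows "(\<lambda>n. \<integral>x. f n x * \<phi> x \<partial>lebesgue) \<longlonglongrightarrow> (\<integral>x. g x * \<phi> x \<partial>lebesgue)"
proof (rule Lim_null[THEN iffD2], rule tendsto_norm_zero_cancel, rule tendsto_sandwich)
  show "\<forall>\<^sub>F n in sequentially. 0 \<le> norm ((\<integral>x. f n x * \<phi> x \<partial>lebesgue) - (\<integral>x. g x * \<phi> x \<partial>lebesgue))" by simp
  have "norm ((\<integral>x. f n x * \<phi> x \<partial>lebesgue) - (\<integral>x. g x * \<phi> x \<partial>lebesgue))
      \<le> sqrt (dsq (f n) g) * sqrt (ip \<phi> \<phi>)" for n
    using norm_integral_mult_le[OF sqint_diff[OF assms(1)[of n] assms(2)] assms(3)] assms(1-3)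
    by (simp add: left_diff_distrib sqint_mult_integrable)
  then show "\<forall>\<^sub>F n in sequentially. norm ((\<integral>x. f n x * \<phi> x \<partial>lebesgue) - (\<integral>x. g x * \<phi> x \<partial>lebesgue))
      \<le> sqrt (dsq (f n) g) * sqrt (ip \<phi> \<phi>)" by simp
  show "(\<lambda>n. sqrt (dsq (f n) g) * sqrt (ip \<phi> \<phi>)) \<longlonglongrightarrow> 0"
    using tendsto_mult_right[OF tendsto_real_sqrt[OF assms(4)], of "sqrt (ip \<phi> \<phi>)"] by simp
qed simp

text \<open>The weak identity sees u and G only through integrals against square-integrable
  functions, so it survives L2 limits. This yields completeness of the form domain.\<close>

lemma wgrad_closed:
  assumes w: "\<And>n. wgrad (u n) (G n)" and v: "v \<in> sqint" "G' \<in> sqint"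
    and lim: "(\<lambda>n. dsq (u n) v) \<longlonglongrightarrow> 0"
    "(\<lambda>n. dsq (G n) G') \<longlonglongrightarrow> 0"
  shows "wgrad v G'"
proof (rule wgradI)
  fix i and \<phi> :: "real^'a \<Rightarrow> complex" assume \<phi>: "\<phi> \<in> test_functions"
  note s = test_function_sqint[OF \<phi>] test_function_sqint[OF test_function_partial[OF \<phi>]]
  have 1: "(\<lambda>n. \<integral>x. u n x * partial i \<phi> x \<partial>lebesgue) \<longlonglongrightarrow> (\<integral>x. v x * partial i \<phi> x \<partial>lebesgue)"
    by (intro integral_mult_tendsto wgrad_sqint(1)[OF w] v s lim)
  have Gi: "(\<lambda>x. G' x $ i) \<in> sqint" using v(2) sqint_vec_iff by blast
  have "(\<lambda>n. ip (\<lambda>x. G n x $ i - G' x $ i) (\<lambda>x. G n x $ i - G' x $ i)) \<longlonglongrightarrow> 0"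
  proof (rule tendsto_sandwich[OF _ _ tendsto_const lim(2)])
    show "\<forall>\<^sub>F n in sequentially. ip (\<lambda>x. G n x $ i - G' x $ i) (\<lambda>x. G n x $ i - G' x $ i)
        \<le> dsq (G n) G'"
      unfolding ip_self
    proof (intro always_eventually allI integral_mono sqint_integrable sqint_diff Gi wgrad_nth_sqint[OF w]
        wgrad_sqint(2)[OF w] v)
      fix n x
      show "(norm (G n x $ i - G' x $ i))\<^sup>2 \<le> (norm (G n x - G' x))\<^sup>2"
        using Finite_Cartesian_Product.norm_nth_le[of "G n x - G' x" i] by (intro power_mono) auto
    qed
  qed (simp add: ip_nonneg)
  then have 2: "(\<lambda>n. - (\<integral>x. G n x $ i * \<phi> x \<partial>lebesgue)) \<longlonglongrightarrow> - (\<integral>x. G' x $ i * \<phi> x \<partial>lebesgue)"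
    by (intro tendsto_minus integral_mult_tendsto wgrad_nth_sqint[OF w] Gi s)
  show "(\<integral>x. v x * partial i \<phi> x \<partial>lebesgue) = - (\<integral>x. G' x $ i * \<phi> x \<partial>lebesgue)"
    by (rule LIMSEQ_unique[OF 1]) (use 2 wgrad_eq[OF w \<phi>] in simp)
qed (rule v)+

section \<open>Representation of bounded functionals\<close>

text \<open>Functions are not identified modulo null sets, so \<open>B\<close> is only semidefinite
  and \<open>V\<close> is a mere set with named operations; this rules out an inner product type.
  The representing element is the limit of a minimising sequence for B v v - 2 l v.\<close>

lemma riesz_representation:
  fixes V :: "'v set" and add :: "'v \<Rightarrow> 'v \<Rightarrow> 'v" and sc :: "real \<Rightarrow> 'v \<Rightarrow> 'v"
    and B :: "'v \<Rightarrow> 'v \<Rightarrow> real" and l :: "'v \<Rightarrow> real"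
  assumes ne: "V \<noteq> {}"
    and V: "\<And>x y. x \<in> V \<Longrightarrow> y \<in> V \<Longrightarrow> add x y \<in> V" "\<And>c x. x \<in> V \<Longrightarrow> sc c x \<in> V"
    and B: "\<And>x y z. x \<in> V \<Longrightarrow> y \<in> V \<Longrightarrow> z \<in> V \<Longrightarrow> B (add x y) z = B x z + B y z"
      "\<And>c x y. x \<in> V \<Longrightarrow> y \<in> V \<Longrightarrow> B (sc c x) y = c * B x y"
      "\<And>x y. x \<in> V \<Longrightarrow> y \<in> V \<Longrightarrow> B x y = B y x"
      "\<And>x. x \<in> V \<Longrightarrow> B x x \<ge> 0"
    and l: "\<And>x y. x \<in> V \<Longrightarrow> y \<in> V \<Longrightarrow> l (add x y) = l x + l y" "\<And>c x. x \<in> V \<Longrightarrow> l (sc c x) = c * l x"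
      "\<And>x. x \<in> V \<Longrightarrow> \<bar>l x\<bar> \<le> C * sqrt (B x x)"
    and complete: "\<And>x. (\<And>n. x n \<in> V) \<Longrightarrow>
      (\<And>e. e > 0 \<Longrightarrow> \<exists>N. \<forall>m\<ge>N. \<forall>n\<ge>N. B (add (x m) (sc (-1) (x n))) (add (x m) (sc (-1) (x n))) \<le> e) \<Longrightarrow>
      \<exists>y\<in>V. (\<lambda>n::nat. B (add (x n) (sc (-1) y)) (add (x n) (sc (-1) y))) \<longlonglongrightarrow> 0"
  shows "\<exists>u\<in>V. \<forall>v\<in>V. B v u = l v"
proof -
  have B1: "B z (add x y) = B z x + B z y" if "x \<in> V" "y \<in> V" "z \<in> V" for x y z
    using that B(1,3) V by metis
  have B2: "B z (sc c x) = c * B z x" if "x \<in> V" "z \<in> V" for x z c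
    using that B(2,3) V by metis
  note BB = B(1,2) B1 B2 V
  have CS: "\<bar>B x y\<bar> \<le> sqrt (B x x) * sqrt (B y y)" if "x \<in> V" "y \<in> V" for x y
  proof (rule discriminant_le)
    fix t
    have "0 \<le> B (add x (sc t y)) (add x (sc t y))" using that by (intro B(4) V)
    also have "\<dots> = B x x + 2 * t * B x y + t\<^sup>2 * B y y"
      using that B(3)[of y x] by (simp add: BB power2_eq_square algebra_simps)
    finally show "0 \<le> B x x + 2 * t * B x y + t\<^sup>2 * B y y" .
  qed (use that B(4) in auto)
  define J where "J v = B v v - 2 * l v" for v
  have J: "J v \<ge> - C\<^sup>2" if "v \<in> V" for v
  proof -
    have "0 \<le> (sqrt (B v v) - C)\<^sup>2" by simp
    also have "\<dots> = B v v - 2 * (C * sqrt (B v v)) + C\<^sup>2"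
      using B(4)[OF that] by (simp add: power2_diff)
    finally show ?thesis using l(3)[OF that] by (simp add: J_def)
  qed
  define d where "d = Inf (J ` V)"
  have bdd: "bdd_below (J ` V)" using J by (auto intro!: bdd_belowI[of _ "- C\<^sup>2"])
  have d: "d \<le> J v" if "v \<in> V" for v
    unfolding d_def using bdd that by (intro cInf_lower) auto
  define \<epsilon> where "\<epsilon> n = inverse (real (Suc n))" for n
  have \<epsilon>: "\<epsilon> n > 0" for n by (simp add: \<epsilon>_def)
  have "\<exists>v\<in>V. J v < d + \<epsilon> n" for n
    using cInf_lessD[of "J ` V" "d + \<epsilon> n"] ne \<epsilon>[of n] by (auto simp: d_def)
  then obtain x where x: "\<And>n. x n \<in> V" "\<And>n. J (x n) < d + \<epsilon> n" by metis
  have "\<exists>u\<in>V. (\<lambda>n. B (add (x n) (sc (-1) u)) (add (x n) (sc (-1) u))) \<longlonglongrightarrow> 0"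
  proof (rule complete[OF x(1)])
    fix e :: real assume e: "e > 0"
    have par: "B (add (x m) (sc (-1) (x n))) (add (x m) (sc (-1) (x n))) \<le> 2 * \<epsilon> m + 2 * \<epsilon> n" for m n
    proof -
      \<comment> \<open>The midpoint of two near-minimisers still has value at least d; by the
        parallelogram law they must be close to each other.\<close>
      have "d \<le> J (sc (1/2) (add (x m) (x n)))" by (intro d V x)
      also have "\<dots> = (B (x m) (x m) + 2 * B (x m) (x n) + B (x n) (x n)) / 4 - (l (x m) + l (x n))"
        using x(1) B(3)[of "x n" "x m"] by (simp add: J_def BB l field_simps)
      finally have "4 * d \<le> B (x m) (x m) + 2 * B (x m) (x n) + B (x n) (x n) - 4 * l (x m) - 4 * l (x n)"
        by (simp add: field_simps)
      moreover have "B (add (x m) (sc (-1) (x n))) (add (x m) (sc (-1) (x n)))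
          = B (x m) (x m) - 2 * B (x m) (x n) + B (x n) (x n)"
        using x(1) B(3)[of "x n" "x m"] by (simp add: BB)
      ultimately show ?thesis using x(2)[of m] x(2)[of n] unfolding J_def by linarith
    qed
    obtain N where N: "\<epsilon> N < e / 4" using reals_Archimedean[of "e / 4"] e unfolding \<epsilon>_def by auto
    have mono: "\<epsilon> n \<le> \<epsilon> N" if "n \<ge> N" for n using that by (simp add: \<epsilon>_def)
    have "B (add (x m) (sc (-1) (x n))) (add (x m) (sc (-1) (x n))) \<le> e" if "m \<ge> N" "n \<ge> N" for m n
      using par[of m n] mono[OF that(1)] mono[OF that(2)] N by linarith
    then show "\<exists>N. \<forall>m\<ge>N. \<forall>n\<ge>N. B (add (x m) (sc (-1) (x n))) (add (x m) (sc (-1) (x n))) \<le> e" by blast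
  qed
  then obtain u where u: "u \<in> V" "(\<lambda>n. B (add (x n) (sc (-1) u)) (add (x n) (sc (-1) u))) \<longlonglongrightarrow> 0" by blast
  have "B v u = l v" if v: "v \<in> V" for v
  proof -
    have 1: "\<bar>B v (x n) - l v\<bar> \<le> sqrt (\<epsilon> n) * sqrt (B v v)" for n
    proof (rule discriminant_le)
      fix t
      \<comment> \<open>A move from \<open>x n\<close> along v can lower J by at most
        \<open>\<epsilon> n\<close>; the discriminant of this quadratic in t then bounds the defect
        B v (x n) - l v.\<close>
      have "d \<le> J (add (x n) (sc t v))" by (intro d V x v)
      also have "\<dots> = J (x n) + 2 * t * (B v (x n) - l v) + t\<^sup>2 * B v v"
        using x(1) v B(3)[of "x n" v] by (simp add: J_def BB l power2_eq_square algebra_simps)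
      finally show "0 \<le> \<epsilon> n + 2 * t * (B v (x n) - l v) + t\<^sup>2 * B v v" using x(2)[of n] by linarith
    qed (use \<epsilon>[of n] B(4)[OF v] in auto)
    have 2: "\<bar>B v (x n) - B v u\<bar> \<le> sqrt (B v v) * sqrt (B (add (x n) (sc (-1) u)) (add (x n) (sc (-1) u)))" for n
      using CS[of v "add (x n) (sc (-1) u)"] x(1) u(1) v by (simp add: BB)
    have "norm (B v u - l v) \<le> sqrt (\<epsilon> n) * sqrt (B v v)
        + sqrt (B v v) * sqrt (B (add (x n) (sc (-1) u)) (add (x n) (sc (-1) u)))" for n
      using 1[of n] 2[of n] by simp
    moreover have "(\<lambda>n. sqrt (\<epsilon> n) * sqrt (B v v)
        + sqrt (B v v) * sqrt (B (add (x n) (sc (-1) u)) (add (x n) (sc (-1) u))))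
        \<longlonglongrightarrow> sqrt 0 * sqrt (B v v) + sqrt (B v v) * sqrt 0"
      unfolding \<epsilon>_def by (intro tendsto_intros u(2) LIMSEQ_inverse_real_of_nat)
    ultimately have "norm (B v u - l v) \<le> sqrt 0 * sqrt (B v v) + sqrt (B v v) * sqrt 0"
      by (intro LIMSEQ_le_const) auto
    then show ?thesis by simp
  qed
  then show ?thesis using u(1) by blast
qed

section \<open>The resolvent of the elliptic operator\<close>

definition act :: "real^'n::finite^'n \<Rightarrow> complex^'n \<Rightarrow> complex^'n" where
  "act M \<xi> = (\<chi> i. \<Sum>j\<in>UNIV. M $ i $ j *\<^sub>R \<xi> $ j)"

lemma act_add: "act M (\<xi> + \<eta>) = act M \<xi> + act M \<eta>"
  by (simp add: act_def vec_eq_iff sum.distrib scaleR_add_right)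

lemma act_scaleR: "act M (c *\<^sub>R \<xi>) = c *\<^sub>R act M \<xi>"
  by (simp add: act_def vec_eq_iff scaleR_sum_right mult.commute)

lemma inner_act: "\<xi> \<bullet> act M \<eta> = (\<Sum>i\<in>UNIV. \<Sum>j\<in>UNIV. M $ i $ j * (\<xi> $ i \<bullet> \<eta> $ j))"
  by (simp add: act_def inner_vec_def inner_sum_right)

lemma inner_act_commute:
  assumes "transpose M = M"
  shows "\<xi> \<bullet> act M \<eta> = \<eta> \<bullet> act M \<xi>"
proof -
  have "M $ i $ j = M $ j $ i" for i j
    using assms by (metis transpose_def vec_lambda_beta)
  then show ?thesis unfolding inner_act
    by (subst sum.swap) (simp add: inner_commute)
qed

lemma inner_act_cvec: "cvec \<xi> a \<bullet> act M (cvec \<xi> b) = (\<xi> \<bullet> (M *v \<xi>)) * (a \<bullet> b)"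
  unfolding inner_act
  by (simp add: cvec_def inner_vec_def matrix_vector_mult_def sum_distrib_right
      sum_distrib_left algebra_simps)

text \<open>A real matrix does not mix real and imaginary parts, so the real hypothesis is applied
  to each of them.\<close>

lemma inner_act_ge:
  assumes "\<forall>\<xi>. \<mu> * (\<xi> \<bullet> \<xi>) \<le> \<xi> \<bullet> (M *v \<xi>)"
  shows "\<mu> * (norm \<xi>)\<^sup>2 \<le> \<xi> \<bullet> act M \<xi>"
proof -
  define a b where "a = (\<chi> i. Re (\<xi> $ i))" and "b = (\<chi> i. Im (\<xi> $ i))"
  have "(norm \<xi>)\<^sup>2 = a \<bullet> a + b \<bullet> b"
    by (simp add: power2_norm_eq_inner inner_vec_def inner_complex_def a_def b_def sum.distrib)
  moreover have "\<xi> \<bullet> act M \<xi> = a \<bullet> (M *v a) + b \<bullet> (M *v b)"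
    unfolding inner_act
    by (simp add: inner_vec_def inner_complex_def a_def b_def sum.distrib
        matrix_vector_mult_def sum_distrib_left algebra_simps)
  ultimately show ?thesis using assms[rule_format, of a] assms[rule_format, of b]
    by (simp add: algebra_simps)
qed

lemma norm_act_le:
  fixes M :: "real^'n::finite^'n"
  assumes "\<forall>i j. \<bar>M $ i $ j\<bar> \<le> L"
  shows "norm (act M \<xi>) \<le> (real CARD('n))\<^sup>2 * L * norm \<xi>"
proof -
  have L: "L \<ge> 0" using assms by (meson abs_ge_zero order_trans)
  have "norm (act M \<xi>) \<le> (\<Sum>i\<in>UNIV. norm (act M \<xi> $ i))"
    unfolding norm_vec_def[of "act M \<xi>"] by (rule L2_set_le_sum) simp
  also have "\<dots> \<le> (\<Sum>i\<in>(UNIV::'n set). \<Sum>j\<in>(UNIV::'n set). L * norm \<xi>)"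
  proof (rule sum_mono)
    fix i
    have "norm (act M \<xi> $ i) \<le> (\<Sum>j\<in>UNIV. norm (M $ i $ j *\<^sub>R \<xi> $ j))"
      unfolding act_def by (simp only: vec_lambda_beta norm_sum)
    also have "\<dots> \<le> (\<Sum>j\<in>(UNIV::'n set). L * norm \<xi>)"
      using assms L by (intro sum_mono) (auto intro!: mult_mono Finite_Cartesian_Product.norm_nth_le)
    finally show "norm (act M \<xi> $ i) \<le> (\<Sum>j\<in>(UNIV::'n set). L * norm \<xi>)" .
  qed
  also have "\<dots> = (real CARD('n))\<^sup>2 * L * norm \<xi>" by (simp add: power2_eq_square)
  finally show ?thesis .
qed

text \<open>Interpreted below with A = r^2 C, which turns I + r^2 H into I plus the operator of A,
  so that r occurs in no estimate made inside the locale.\<close>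

locale elliptic =
  fixes A :: "real^'n::finite \<Rightarrow> real^'n^'n" and \<mu> \<Lambda> :: real
  assumes meas: "\<And>i j. (\<lambda>x. A x $ i $ j) \<in> borel_measurable lebesgue"
    and bounded: "AE x in lebesgue. \<forall>i j. \<bar>A x $ i $ j\<bar> \<le> \<Lambda>"
    and symmetric: "AE x in lebesgue. transpose (A x) = A x"
    and elliptic: "AE x in lebesgue. \<forall>\<xi>. \<mu> * (\<xi> \<bullet> \<xi>) \<le> \<xi> \<bullet> (A x *v \<xi>)"
    and \<mu>_pos: "\<mu> > 0"
begin

definition Q :: "(real^'n \<Rightarrow> complex^'n) \<Rightarrow> (real^'n \<Rightarrow> complex^'n) \<Rightarrow> real" where
  "Q G G' = ip G (\<lambda>x. act (A x) (G' x))"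

definition act_bound :: real where "act_bound = (real CARD('n))\<^sup>2 * \<Lambda>"

lemma act_le: "AE x in lebesgue. norm (act (A x) (G x)) \<le> act_bound * norm (G x)"
  using bounded by eventually_elim (simp add: act_bound_def norm_act_le)

lemma act_sqint:
  assumes "G \<in> sqint"
  shows "(\<lambda>x. act (A x) (G x)) \<in> sqint"
proof (rule sqint_bound[OF assms _ act_le])
  have "(\<lambda>x. G x $ j) \<in> borel_measurable lebesgue" for j
    using assms by (simp add: sqint_vec_iff sqint_measurable)
  then show "(\<lambda>x. act (A x) (G x)) \<in> borel_measurable lebesgue"
    unfolding act_def using meas
    by (intro borel_measurable_vec) (auto intro!: borel_measurable_sum borel_measurable_scaleR)
qed

lemma Q_commute:
  assumes "G \<in> sqint" "G' \<in> sqint"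
  shows "Q G G' = Q G' G"
  unfolding Q_def
proof (rule ip_cong_AE)
  show "AE x in lebesgue. G x \<bullet> act (A x) (G' x) = G' x \<bullet> act (A x) (G x)"
    using symmetric by eventually_elim (rule inner_act_commute)
qed (use assms in \<open>auto intro: sqint_measurable act_sqint\<close>)

lemma Q_add_left:
  "F \<in> sqint \<Longrightarrow> G \<in> sqint \<Longrightarrow> H \<in> sqint \<Longrightarrow> Q (\<lambda>x. F x + G x) H = Q F H + Q G H"
  by (simp add: Q_def ip_add_left act_sqint)

lemma Q_add_right:
  "F \<in> sqint \<Longrightarrow> G \<in> sqint \<Longrightarrow> H \<in> sqint \<Longrightarrow> Q H (\<lambda>x. F x + G x) = Q H F + Q H G"
  by (simp add: Q_def ip_add_right act_sqint act_add)

lemma Q_scaleR_left: "Q (\<lambda>x. c *\<^sub>R G x) H = c * Q G H"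
  by (simp add: Q_def ip_scaleR_left)

lemma Q_scaleR_right: "Q H (\<lambda>x. c *\<^sub>R G x) = c * Q H G"
  by (simp add: Q_def ip_scaleR_right act_scaleR)

text \<open>\<open>act\<close> is real-linear at each point, so only the product of the two weights
  matters. Powers of a cut-off can thus be shared freely between the two arguments of the
  form.\<close>

lemma Q_shift:
  assumes "\<And>x. a x * b x = c x * d x"
  shows "Q (\<lambda>x. a x *\<^sub>R G x) (\<lambda>x. b x *\<^sub>R H x) = Q (\<lambda>x. c x *\<^sub>R G x) (\<lambda>x. d x *\<^sub>R H x)"
proof -
  have "(a x *\<^sub>R \<xi>) \<bullet> (b x *\<^sub>R \<eta>) = (c x *\<^sub>R \<xi>) \<bullet> (d x *\<^sub>R \<eta>)" for x and \<xi> \<eta> :: "complex^'n"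
    by (simp add: assms mult.assoc[symmetric] mult.commute[of "b x" "a x"] mult.commute[of "d x" "c x"])
  then show ?thesis unfolding Q_def ip_def act_scaleR by presburger
qed

lemma Q_ge: 
  assumes "G \<in> sqint"
  shows "\<mu> * ip G G \<le> Q G G"
proof -
  have "\<mu> * ip G G = (\<integral>x. \<mu> * (norm (G x))\<^sup>2 \<partial>lebesgue)" by (simp add: ip_self)
  also have "\<dots> \<le> Q G G" unfolding Q_def ip_def
  proof (rule integral_mono_AE)
    show "AE x in lebesgue. \<mu> * (norm (G x))\<^sup>2 \<le> G x \<bullet> act (A x) (G x)"
      using elliptic by eventually_elim (rule inner_act_ge)
  qed (use assms in \<open>auto intro: sqint_integrable sqint_inner_integrable act_sqint\<close>)
  finally show ?thesis .
qed

lemma Q_nonneg: "G \<in> sqint \<Longrightarrow> 0 \<le> Q G G"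
  using Q_ge[of G] ip_nonneg[of G] \<mu>_pos by (meson mult_nonneg_nonneg less_imp_le order_trans)

text \<open>Continuity of the form in the gradients; it turns separate L2 convergence of functions
  and gradients into convergence in the form norm in \<open>sol_exists\<close>.\<close>

lemma Q_le:
  assumes "G \<in> sqint"
  shows "Q G G \<le> \<bar>act_bound\<bar> * ip G G"
proof -
  have "ip (\<lambda>x. act (A x) (G x)) (\<lambda>x. act (A x) (G x)) \<le> ip (\<lambda>x. act_bound *\<^sub>R G x) (\<lambda>x. act_bound *\<^sub>R G x)"
  proof (rule ip_mono_self)
    show "AE x in lebesgue. norm (act (A x) (G x)) \<le> norm (act_bound *\<^sub>R G x)"
      using act_le[of G] by eventually_elim (simp, meson abs_ge_self mult_right_mono norm_ge_zero order_trans)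
  qed (intro act_sqint sqint_scaleR assms)+
  also have "\<dots> = \<bar>act_bound\<bar>\<^sup>2 * ip G G"
    by (simp add: ip_scaleR_left ip_scaleR_right power2_eq_square)
  finally have "sqrt (ip (\<lambda>x. act (A x) (G x)) (\<lambda>x. act (A x) (G x))) \<le> \<bar>act_bound\<bar> * sqrt (ip G G)"
    by (metis real_sqrt_le_mono real_sqrt_mult real_sqrt_abs abs_abs)
  then have "sqrt (ip G G) * sqrt (ip (\<lambda>x. act (A x) (G x)) (\<lambda>x. act (A x) (G x)))
      \<le> sqrt (ip G G) * (\<bar>act_bound\<bar> * sqrt (ip G G))"
    by (intro mult_left_mono) (simp_all add: ip_nonneg)
  also have "\<dots> = \<bar>act_bound\<bar> * ip G G" using ip_nonneg[of G] by simp
  finally show ?thesis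
    using ip_Cauchy_Schwarz[OF assms act_sqint[OF assms]] unfolding Q_def by linarith
qed

lemma Q_Cauchy_Schwarz:
  assumes "F \<in> sqint" "G \<in> sqint"
  shows "\<bar>Q F G\<bar> \<le> sqrt (Q F F) * sqrt (Q G G)"
proof (rule discriminant_le)
  fix t
  have "0 \<le> Q (\<lambda>x. F x + t *\<^sub>R G x) (\<lambda>x. F x + t *\<^sub>R G x)"
    by (intro Q_nonneg sqint_add sqint_scaleR assms)
  also have "\<dots> = Q F F + 2 * t * Q F G + t\<^sup>2 * Q G G"
    using assms by (simp add: Q_add_left Q_add_right Q_scaleR_left Q_scaleR_right sqint_add
        sqint_scaleR Q_commute[of G F] algebra_simps power2_eq_square)
  finally show "0 \<le> Q F F + 2 * t * Q F G + t\<^sup>2 * Q G G" .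
qed (intro Q_nonneg assms)+

text \<open>The real part of the weak equation (I + H) u = f, with the gradient of u as part of the
  data. Real test identities suffice because \<i> v is admissible whenever v is.\<close>

definition sol :: "(real^'n \<Rightarrow> complex) \<Rightarrow> (real^'n \<Rightarrow> complex^'n) \<Rightarrow> (real^'n \<Rightarrow> complex) \<Rightarrow> bool" where
  "sol u G f \<longleftrightarrow> wgrad u G \<and> f \<in> sqint \<and> (\<forall>v H. wgrad v H \<longrightarrow> ip v u + Q H G = ip v f)"

text \<open>Riesz representation of v -> (v, f) for the form (u, v) + Q on pairs of a function and
  its gradient. For completeness, \<open>\<mu>\<close> makes the gradients Cauchy in L2, both
  components converge separately, and \<open>wgrad_closed\<close> shows that the limits still belong
  together.\<close>

lemma sol_exists:
  assumes f: "f \<in> sqint"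
  shows "\<exists>u G. sol u G f"
proof -
  define V where "V = {(u :: real^'n \<Rightarrow> complex, G). wgrad u G}"
  define add where "add p q = ((\<lambda>x. fst p x + fst q x), (\<lambda>x. snd p x + snd q x))"
    for p q :: "(real^'n \<Rightarrow> complex) \<times> (real^'n \<Rightarrow> complex^'n)"
  define sc where "sc c p = ((\<lambda>x. c *\<^sub>R fst p x), (\<lambda>x. c *\<^sub>R snd p x))"
    for c and p :: "(real^'n \<Rightarrow> complex) \<times> (real^'n \<Rightarrow> complex^'n)"
  define B where "B p q = ip (fst p) (fst q) + Q (snd p) (snd q)"
    for p q :: "(real^'n \<Rightarrow> complex) \<times> (real^'n \<Rightarrow> complex^'n)"
  define l where "l p = ip (fst p) f" for p :: "(real^'n \<Rightarrow> complex) \<times> (real^'n \<Rightarrow> complex^'n)"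
  have V: "fst p \<in> sqint" "snd p \<in> sqint" if "p \<in> V" for p
    using that wgrad_sqint by (auto simp: V_def)
  have diff: "fst (add p (sc (-1) q)) = (\<lambda>x. fst p x - fst q x)"
      "snd (add p (sc (-1) q)) = (\<lambda>x. snd p x - snd q x)" for p q
    by (simp_all add: add_def sc_def)
  have "\<exists>u\<in>V. \<forall>v\<in>V. B v u = l v"
  proof (rule riesz_representation[of V add sc B l "sqrt (ip f f)"])
    have "wgrad (\<lambda>x::real^'n. 0) (\<lambda>x. 0)"
      by (rule wgradI) (simp_all add: sqint_zero)
    then show "V \<noteq> {}" by (auto simp: V_def)
    fix p q assume p: "p \<in> V" and q: "q \<in> V"
    show "add p q \<in> V" using p q by (auto simp: V_def add_def intro: wgrad_add)
    show "l (add p q) = l p + l q" using V[OF p] V[OF q] f by (simp add: l_def add_def ip_add_left)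
    show "B p q = B q p" using V[OF p] V[OF q] by (simp add: B_def ip_commute[of "fst p"] Q_commute)
    show "B (sc c p) q = c * B p q" for c
      by (simp add: B_def sc_def ip_scaleR_left Q_scaleR_left distrib_left)
    show "B (add p q) z = B p z + B q z" if "z \<in> V" for z
      using V[OF p] V[OF q] V[OF that] by (simp add: B_def add_def ip_add_left Q_add_left)
  next
    fix p c assume p: "p \<in> V"
    show "sc c p \<in> V" using p by (auto simp: V_def sc_def intro: wgrad_scaleR)
    show "B p p \<ge> 0" using V[OF p] by (simp add: B_def ip_nonneg Q_nonneg)
    show "l (sc c p) = c * l p" by (simp add: l_def sc_def ip_scaleR_left)
    have "\<bar>l p\<bar> \<le> sqrt (ip (fst p) (fst p)) * sqrt (ip f f)"
      unfolding l_def by (intro ip_Cauchy_Schwarz V p f)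
    also have "\<dots> \<le> sqrt (B p p) * sqrt (ip f f)"
      using V[OF p] by (intro mult_right_mono real_sqrt_le_mono) (auto simp: B_def Q_nonneg ip_nonneg)
    finally show "\<bar>l p\<bar> \<le> sqrt (ip f f) * sqrt (B p p)" by (simp add: mult.commute)
  next
    fix x :: "nat \<Rightarrow> _" assume x: "\<And>n. x n \<in> V"
      and cau: "\<And>e. e > 0 \<Longrightarrow> \<exists>N. \<forall>m\<ge>N. \<forall>n\<ge>N. B (add (x m) (sc (-1) (x n))) (add (x m) (sc (-1) (x n))) \<le> e"
    have le: "dsq (fst p) (fst q) \<le> B (add p (sc (-1) q)) (add p (sc (-1) q))"
        "\<mu> * dsq (snd p) (snd q) \<le> B (add p (sc (-1) q)) (add p (sc (-1) q))"
      if "p \<in> V" "q \<in> V" for p q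
      using Q_ge[OF sqint_diff[OF V(2)[OF that(1)] V(2)[OF that(2)]]]
        Q_nonneg[OF sqint_diff[OF V(2)[OF that(1)] V(2)[OF that(2)]]]
        ip_nonneg[of "\<lambda>y. fst p y - fst q y"]
      unfolding B_def diff by linarith+
    obtain u where u: "u \<in> sqint" "(\<lambda>n. dsq (fst (x n)) u) \<longlonglongrightarrow> 0"
    proof (rule sqint_complete)
      show "fst (x n) \<in> sqint" for n by (intro V x)
      show "\<exists>N. \<forall>m\<ge>N. \<forall>n\<ge>N. dsq (fst (x m)) (fst (x n)) \<le> e"
        if "e > 0" for e
        using cau[OF that] le(1)[OF x x] by (meson order_trans)
    qed
    obtain G where G: "G \<in> sqint" "(\<lambda>n. dsq (snd (x n)) G) \<longlonglongrightarrow> 0"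
    proof (rule sqint_complete)
      show "snd (x n) \<in> sqint" for n by (intro V x)
      fix e :: real assume "e > 0"
      then have "\<mu> * e > 0" using \<mu>_pos by simp
      from cau[OF this] have "\<exists>N. \<forall>m\<ge>N. \<forall>n\<ge>N.
          \<mu> * dsq (snd (x m)) (snd (x n)) \<le> \<mu> * e"
        using le(2)[OF x x] by (meson order_trans)
      then show "\<exists>N. \<forall>m\<ge>N. \<forall>n\<ge>N. dsq (snd (x m)) (snd (x n)) \<le> e"
        using \<mu>_pos by simp
    qed
    have "wgrad u G"
      by (rule wgrad_closed[of "\<lambda>n. fst (x n)" "\<lambda>n. snd (x n)", OF _ u(1) G(1) u(2) G(2)])
        (use x in \<open>simp add: V_def case_prod_beta\<close>)
    then have uG: "(u, G) \<in> V" by (simp add: V_def)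
    have "(\<lambda>n. B (add (x n) (sc (-1) (u, G))) (add (x n) (sc (-1) (u, G)))) \<longlonglongrightarrow> 0"
    proof (rule tendsto_sandwich)
      show "\<forall>\<^sub>F n in sequentially. 0 \<le> B (add (x n) (sc (-1) (u, G))) (add (x n) (sc (-1) (u, G)))"
        unfolding B_def diff using V(2)[OF x] G(1)
        by (auto intro!: always_eventually add_nonneg_nonneg ip_nonneg Q_nonneg sqint_diff)
      show "(\<lambda>n. dsq (fst (x n)) u
          + \<bar>act_bound\<bar> * dsq (snd (x n)) G) \<longlonglongrightarrow> 0"
        using tendsto_add[OF u(2) tendsto_mult_left[OF G(2), of "\<bar>act_bound\<bar>"]] by simp
      show "\<forall>\<^sub>F n in sequentially. B (add (x n) (sc (-1) (u, G))) (add (x n) (sc (-1) (u, G)))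
          \<le> dsq (fst (x n)) u
          + \<bar>act_bound\<bar> * dsq (snd (x n)) G"
        unfolding B_def diff using V(2)[OF x] G(1) by (auto intro!: always_eventually Q_le sqint_diff)
    qed simp
    then show "\<exists>y\<in>V. (\<lambda>n. B (add (x n) (sc (-1) y)) (add (x n) (sc (-1) y))) \<longlonglongrightarrow> 0" using uG by blast
  qed
  then obtain u G where "(u, G) \<in> V" "\<And>v H. (v, H) \<in> V \<Longrightarrow> B (v, H) (u, G) = l (v, H)" by force
  then have "sol u G f" using f by (simp add: sol_def V_def B_def l_def)
  then show ?thesis by blast
qed

lemma sol_sqint: "sol u G f \<Longrightarrow> u \<in> sqint" "sol u G f \<Longrightarrow> G \<in> sqint" "sol u G f \<Longrightarrow> f \<in> sqint"
  using wgrad_sqint by (auto simp: sol_def)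

lemma sol_eq: "sol u G f \<Longrightarrow> wgrad v H \<Longrightarrow> ip v u + Q H G = ip v f"
  by (simp add: sol_def)

lemma Q_cong_AE:
  assumes "G \<in> sqint" "G' \<in> sqint" "H \<in> sqint" "H' \<in> sqint"
    and "AE x in lebesgue. G x = G' x" "AE x in lebesgue. H x = H' x"
  shows "Q G H = Q G' H'"
  unfolding Q_def
proof (rule ip_cong_AE)
  show "AE x in lebesgue. G x \<bullet> act (A x) (H x) = G' x \<bullet> act (A x) (H' x)"
    using assms(5,6) by eventually_elim simp
qed (use assms in \<open>auto intro: sqint_measurable act_sqint\<close>)

end

text \<open>Solving u + r^2 H u = f for H u leaves the candidate \<open>h\<close> = (f - u) / r^2.
  The real identity tested with v gives the real part of the form equation; tested with \<i> v it
  gives the imaginary part.\<close>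

lemma resolvent_of_sol:
  fixes C :: "real^'n::finite \<Rightarrow> real^'n^'n"
  assumes ell: "elliptic (\<lambda>x. r\<^sup>2 *\<^sub>R C x) \<mu> \<Lambda>" and sol: "elliptic.sol (\<lambda>x. r\<^sup>2 *\<^sub>R C x) u G f" and r: "r > 0"
  shows "(f, u) \<in> {(u, \<lambda>x. u x + complex_of_real (r\<^sup>2) * f x) | u f. (u, f) \<in> elliptic_operator C}\<inverse>"
proof -
  interpret elliptic "\<lambda>x. r\<^sup>2 *\<^sub>R C x" \<mu> \<Lambda> by (rule ell)
  have u: "wgrad u G" using sol by (simp add: sol_def)
  note s = sol_sqint[OF sol]
  define h where "h = (\<lambda>x. (1 / r\<^sup>2) *\<^sub>R (f x - u x))"
  have h: "h \<in> sqint" unfolding h_def by (intro sqint_scaleR sqint_diff s)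
  let ?wu = "weak_gradient u"
  have wu: "wgrad u ?wu" by (intro wgrad_weak_gradient wgrad_W12[OF u])
  have Re: "Re (elliptic_form C v u) = ip v h"
    and Re_i: "Im (elliptic_form C v u) = ip (\<lambda>x. \<i> * v x) h" if v: "v \<in> W12" for v
  proof -
    let ?wv = "weak_gradient v"
    have wv: "wgrad v ?wv" by (intro wgrad_weak_gradient v)
    have *: "ip w h = (\<integral>x. (H x \<bullet> act (C x) (?wu x)) \<partial>lebesgue)" if w: "wgrad w H" for w H
    proof -
      have "r\<^sup>2 * ip w h = ip w f - ip w u"
        using r wgrad_sqint(1)[OF w] s by (simp add: h_def ip_scaleR_right ip_diff_right)
      also have "\<dots> = Q H G" using sol_eq[OF sol w] by simp
      also have "\<dots> = Q H ?wu"
        using wgrad_unique[OF u wu] wgrad_sqint[OF w] wgrad_sqint[OF u] wgrad_sqint[OF wu]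
        by (intro Q_cong_AE) auto
      also have "\<dots> = r\<^sup>2 * (\<integral>x. (H x \<bullet> act (C x) (?wu x)) \<partial>lebesgue)"
        by (simp add: Q_def ip_def inner_act sum_distrib_left mult.assoc flip: integral_mult_right_zero)
      finally show ?thesis using r by simp
    qed
    let ?Cu = "\<lambda>i j x. complex_of_real (C x $ i $ j) * ?wu x $ j"
    have Cu: "(?Cu i j) \<in> sqint" for i j
    proof (rule sqint_bound[OF wgrad_nth_sqint[OF wu, of j], of _ "\<Lambda> / r\<^sup>2"])
      have "(\<lambda>x. (1 / r\<^sup>2) * (r\<^sup>2 *\<^sub>R C x) $ i $ j) \<in> borel_measurable lebesgue"
        by (intro borel_measurable_times borel_measurable_const meas)
      then have "(\<lambda>x. C x $ i $ j) \<in> borel_measurable lebesgue" using r by simp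
      then show "(?Cu i j) \<in> borel_measurable lebesgue"
        using sqint_measurable[OF wgrad_nth_sqint[OF wu, of j]]
        unfolding scaleR_conv_of_real[symmetric] by (intro borel_measurable_scaleR)
      show "AE x in lebesgue. norm (complex_of_real (C x $ i $ j) * ?wu x $ j) \<le> \<Lambda> / r\<^sup>2 * norm (?wu x $ j)"
        using bounded
      proof eventually_elim
        case (elim x)
        then have "\<bar>C x $ i $ j\<bar> \<le> \<Lambda> / r\<^sup>2"
          using r by (simp add: abs_mult field_simps)
        then show ?case
          using mult_right_mono[of "\<bar>C x $ i $ j\<bar>" "\<Lambda> / r\<^sup>2" "norm (?wu x $ j)"]
          by (simp add: norm_mult)
      qed
    qed
    have form: "(\<Sum>i\<in>UNIV. \<Sum>j\<in>UNIV. ip (\<lambda>x. H x $ i) (?Cu i j))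
      = (\<integral>x. (H x \<bullet> act (C x) (?wu x)) \<partial>lebesgue)" if "H \<in> sqint" for H
    proof -
      have Hi: "(\<lambda>x. H x $ i) \<in> sqint" for i using that sqint_vec_iff by blast
      have "(\<integral>x. (H x \<bullet> act (C x) (?wu x)) \<partial>lebesgue)
        = (\<integral>x. (\<Sum>i\<in>UNIV. \<Sum>j\<in>UNIV. H x $ i \<bullet> (complex_of_real (C x $ i $ j) * ?wu x $ j)) \<partial>lebesgue)"
        by (simp add: inner_act flip: scaleR_conv_of_real)
      also have "\<dots> = (\<Sum>i\<in>UNIV. \<Sum>j\<in>UNIV. ip (\<lambda>x. H x $ i) (?Cu i j))"
        unfolding ip_def
        by (subst Bochner_Integration.integral_sum, intro Bochner_Integration.integrable_sum
            sqint_inner_integrable Hi Cu)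
          (intro sum.cong refl Bochner_Integration.integral_sum sqint_inner_integrable Hi Cu)
      finally show ?thesis by simp
    qed
    have "Re (elliptic_form C v u)
        = (\<Sum>i\<in>UNIV. \<Sum>j\<in>UNIV. ip (\<lambda>x. ?wv x $ i) (?Cu i j))"
      unfolding elliptic_form_def by (simp add: Re_L2_inner[OF wgrad_nth_sqint[OF wv] Cu])
    then show "Re (elliptic_form C v u) = ip v h"
      using form[OF wgrad_sqint(2)[OF wv]] *[OF wv] by simp
    have iw: "wgrad (\<lambda>x. \<i> * v x) (\<lambda>x. \<chi> i. \<i> * ?wv x $ i)" by (rule wgrad_cmult[OF wv])
    have "Im (elliptic_form C v u)
        = (\<Sum>i\<in>UNIV. \<Sum>j\<in>UNIV. ip (\<lambda>x. \<i> * ?wv x $ i) (?Cu i j))"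
      unfolding elliptic_form_def by (simp add: Im_L2_inner[OF wgrad_nth_sqint[OF wv] Cu])
    then show "Im (elliptic_form C v u) = ip (\<lambda>x. \<i> * v x) h"
      using form[OF wgrad_sqint(2)[OF iw]] *[OF iw] by simp
  qed
  have "(u, h) \<in> elliptic_operator C"
  proof -
    have "elliptic_form C v u = L2_inner v h" if v: "v \<in> W12" for v
    proof (rule complex_eqI)
      have vs: "v \<in> sqint" using v by (simp add: W12_def L2_eq_sqint)
      show "Re (elliptic_form C v u) = Re (L2_inner v h)" using Re[OF v] Re_L2_inner[OF vs h] by simp
      show "Im (elliptic_form C v u) = Im (L2_inner v h)" using Re_i[OF v] Im_L2_inner[OF vs h] by simp
    qed
    then show ?thesis using h wgrad_W12[OF u] by (simp add: elliptic_operator_def L2_eq_sqint)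
  qed
  moreover have "f = (\<lambda>x. u x + complex_of_real (r\<^sup>2) * h x)"
    using r by (simp add: h_def fun_eq_iff scaleR_conv_of_real)
  ultimately show ?thesis by (auto simp: converse_iff)
qed

section \<open>Iterated Caccioppoli estimates\<close>

text \<open>The recursion is read off from the induction step of \<open>chain_estimate\<close>: with
  c the previous value, s = c + M and t = M s + 2 M + 1, the next value is 1 + (s + 1) t, large
  enough for both of the new bounds t and 1 + s t.\<close>

primrec chain_const :: "real \<Rightarrow> nat \<Rightarrow> real" where
  "chain_const M 0 = M"
| "chain_const M (Suc j) =
    1 + (chain_const M j + M + 1) * (M * (chain_const M j + M) + 2 * M + 1)"

lemma chain_const_ge: "M \<ge> 1 \<Longrightarrow> chain_const M j \<ge> 1"
  by (induction j) auto

lemma chain_const_mono: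
  assumes "M \<ge> 1" "i \<le> j"
  shows "chain_const M i \<le> chain_const M j"
proof (rule lift_Suc_mono_le[OF _ assms(2)])
  fix j
  have c: "chain_const M j \<ge> 1" by (rule chain_const_ge[OF assms(1)])
  then have "M * (chain_const M j + M) + 2 * M + 1 \<ge> 1" using assms(1) by simp
  then have "(chain_const M j + M + 1) * 1 \<le> (chain_const M j + M + 1) * (M * (chain_const M j + M) + 2 * M + 1)"
    using c assms(1) by (intro mult_left_mono) auto
  then show "chain_const M j \<le> chain_const M (Suc j)" using assms(1) by simp
qed

lemma le_of_square_le:
  fixes a b :: real
  assumes "a\<^sup>2 \<le> a * b" "b \<ge> 0"
  shows "a \<le> b"
  using assms by (cases "a > 0") (auto simp: power2_eq_square)

text \<open>\<open>A j\<close> and \<open>D j\<close> model the weighted norms of the j-th function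
  and of its gradient; \<open>D_le\<close> is Caccioppoli's inequality and \<open>A_le\<close>
  compares neighbours. The induction starts from A 0 = 0: once D (j+1) is dominated by A (j+1), both
  A (j+1) and D (j+2) are dominated by A (j+2). So the last function controls all earlier ones,
  against the smoothing direction of the resolvent.\<close>

lemma chain_estimate:
  fixes A D :: "nat \<Rightarrow> real"
  assumes M: "M \<ge> 1" and nonneg: "\<And>j. A j \<ge> 0" "\<And>j. D j \<ge> 0" and A0: "A 0 = 0"
    and D_le: "\<And>j. j < m \<Longrightarrow> (D (Suc j))\<^sup>2 \<le> M * (A j * A (Suc j) + (A (Suc j))\<^sup>2)"
    and A_le: "\<And>j. Suc j < m \<Longrightarrow>
      (A (Suc j))\<^sup>2 \<le> A (Suc j) * A (Suc (Suc j)) + D (Suc (Suc j)) * D (Suc j) + M * A (Suc j) * D (Suc (Suc j))"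
    and j: "j < m"
  shows "D (Suc j) \<le> chain_const M m ^ Suc m * A m"
proof -
  have step: "A j \<le> chain_const M j * A (Suc j) \<and> D (Suc j) \<le> chain_const M j * A (Suc j)" if "j < m" for j
    using that
  proof (induction j)
    case 0
    have "(D (Suc 0))\<^sup>2 \<le> (M * A (Suc 0))\<^sup>2"
    proof -
      have "(D (Suc 0))\<^sup>2 \<le> M * (A (Suc 0))\<^sup>2" using D_le[OF 0] A0 by simp
      also have "\<dots> \<le> M\<^sup>2 * (A (Suc 0))\<^sup>2"
        using M by (intro mult_right_mono) (auto simp: power2_eq_square)
      finally show ?thesis by (simp add: power_mult_distrib)
    qed
    then have "D (Suc 0) \<le> M * A (Suc 0)"
      by (rule power2_le_imp_le) (use M nonneg in simp)
    then show ?case using A0 M nonneg by simp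
  next
    case (Suc j)
    define c where "c = chain_const M j"
    define s where "s = c + M"
    define t where "t = M * s + 2 * M + 1"
    define a a' d where "a = A (Suc j)" and "a' = A (Suc (Suc j))" and "d = D (Suc (Suc j))"
    have c: "c \<ge> 1" using chain_const_ge[OF M] by (simp add: c_def)
    have s: "s \<ge> 1" using c M by (simp add: s_def)
    have "M * s \<ge> 0" using M s by simp
    then have t: "t \<ge> 1" using M by (simp add: t_def)
    have nn: "a \<ge> 0" "a' \<ge> 0" "d \<ge> 0" by (auto simp: a_def a'_def d_def nonneg)
    have Dj: "D (Suc j) \<le> c * a" using Suc by (simp add: c_def a_def)
    have "a\<^sup>2 \<le> a * a' + d * D (Suc j) + M * a * d"
      using A_le[OF Suc.prems] by (simp add: a_def a'_def d_def)
    also have "\<dots> \<le> a * a' + d * (c * a) + M * a * d"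
      using Dj nn by (simp add: mult_left_mono)
    also have "\<dots> = a * (a' + s * d)" by (simp add: s_def algebra_simps)
    finally have "a\<^sup>2 \<le> a * (a' + s * d)" .
    then have a: "a \<le> a' + s * d" by (rule le_of_square_le) (use nn s in simp)
    \<comment> \<open>Inserting the bound for a into \<open>D_le\<close> gives d^2 \<le> M s d a' +
      2 M a'^2. If d exceeded t a', then a' \<le> d because t \<ge> 1, and the right side would be
      at most t a' d < d^2.\<close>
    have d: "d \<le> t * a'"
    proof (rule ccontr)
      assume "\<not> d \<le> t * a'"
      then have gt: "t * a' < d" by simp
      have ta: "a' \<le> t * a'" using t nn by (simp add: mult_le_cancel_right1)
      then have dpos: "d > 0" "a' \<le> d" using gt nn by auto
      have "d\<^sup>2 \<le> M * (a * a' + a'\<^sup>2)" using D_le[OF Suc.prems] by (simp add: a_def a'_def d_def)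
      also have "\<dots> \<le> M * ((a' + s * d) * a' + a'\<^sup>2)"
        using M a nn by (intro mult_left_mono add_right_mono mult_right_mono) auto
      also have "\<dots> = (M * s) * (d * a') + 2 * M * (a' * a')" by (simp add: power2_eq_square algebra_simps)
      also have "\<dots> \<le> (M * s) * (d * a') + 2 * M * (d * a')"
        using M dpos nn by (intro add_left_mono mult_left_mono mult_right_mono) auto
      also have "\<dots> \<le> t * (d * a')" using dpos nn by (simp add: t_def algebra_simps)
      also have "\<dots> = d * (t * a')" by simp
      also have "\<dots> < d * d" using gt dpos by simp
      finally show False by (simp add: power2_eq_square)
    qed
    have "s * d \<le> s * (t * a')" using d s by (intro mult_left_mono) auto
    then have "a \<le> (1 + s * t) * a'" using a by (simp add: algebra_simps)
    moreover have cc: "chain_const M (Suc j) = 1 + (s + 1) * t" by (simp add: c_def s_def t_def)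
    moreover have "(1 + s * t) * a' \<le> (1 + (s + 1) * t) * a'"
      using t nn by (intro mult_right_mono) (auto simp: algebra_simps)
    moreover have "t * a' \<le> (1 + (s + 1) * t) * a'"
      using t s nn by (intro mult_right_mono) (auto simp: algebra_simps)
    ultimately show ?case using d unfolding a_def[symmetric] a'_def[symmetric] d_def[symmetric]
      by (metis (no_types, lifting) order_trans)
  qed
  define c where "c = chain_const M m"
  have c: "c \<ge> 1" using chain_const_ge[OF M] by (simp add: c_def)
  have cj: "chain_const M j \<le> c" if "j < m" for j
    using chain_const_mono[OF M, of j m] that by (simp add: c_def)
  \<comment> \<open>One factor c for each index between m - k and m. Passing from D to A costs one
    more, whence the exponent \<open>Suc m\<close>.\<close>
  have A_m: "A (m - k) \<le> c ^ k * A m" if "k \<le> m" for k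
    using that
  proof (induction k)
    case (Suc k)
    then have eq: "Suc (m - Suc k) = m - k" and lt: "m - Suc k < m" by auto
    have "A (m - Suc k) \<le> chain_const M (m - Suc k) * A (m - k)" using step[OF lt] eq by simp
    also have "\<dots> \<le> c * A (m - k)" using cj[OF lt] nonneg by (intro mult_right_mono) auto
    also have "\<dots> \<le> c * (c ^ k * A m)" using Suc c by (intro mult_left_mono) auto
    finally show ?case by (simp add: mult.assoc)
  qed simp
  have "D (Suc j) \<le> chain_const M j * A (Suc j)" using step[OF j] by simp
  also have "\<dots> \<le> c * A (Suc j)" using cj[OF j] nonneg by (intro mult_right_mono) auto
  also have "A (Suc j) \<le> c ^ (m - Suc j) * A m" using A_m[of "m - Suc j"] j by simp
  also have "\<dots> \<le> c ^ m * A m" using c nonneg by (intro mult_right_mono power_increasing) auto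
  finally show ?thesis using c by (simp add: c_def mult.assoc)
qed

text \<open>Dominates the coefficients 2 and 4 (p + 1)^2 K^2 of \<open>caccioppoli\<close>, applied
  with p \<le> 2 m, and 2 (p + 2) K of \<open>interpolation\<close>, applied with p + 2 \<le> 2
  m.\<close>

definition energy_const :: "real \<Rightarrow> nat \<Rightarrow> real" where
  "energy_const K m = 2 + 4 * (real (2 * m + 1))\<^sup>2 * K\<^sup>2 + 2 * real (2 * m) * K"

section \<open>Energies of cut-off gradients and weighted estimates\<close>

context elliptic
begin

lemma energy_grad_bound:
  assumes "AE x in lebesgue. grad f x \<bullet> (A x *v grad f x) \<le> K\<^sup>2"
  shows "AE x in lebesgue. norm (grad f x) \<le> \<bar>K\<bar> / sqrt \<mu>"
  using assms elliptic
proof eventually_elim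
  case (elim x)
  then have "\<mu> * (norm (grad f x))\<^sup>2 \<le> K\<^sup>2" by (metis order_trans power2_norm_eq_inner)
  then have "(sqrt \<mu> * norm (grad f x))\<^sup>2 \<le> \<bar>K\<bar>\<^sup>2" using \<mu>_pos by (simp add: power_mult_distrib)
  then have "sqrt \<mu> * norm (grad f x) \<le> \<bar>K\<bar>" by (rule power2_le_imp_le) simp
  then show ?case using \<mu>_pos by (simp add: field_simps)
qed

lemma cvec_grad_sqint:
  assumes "smooth f" "AE x in lebesgue. grad f x \<bullet> (A x *v grad f x) \<le> K\<^sup>2" "v \<in> sqint"
  shows "(\<lambda>x. cvec (grad f x) (v x)) \<in> sqint"
proof (rule sqint_bound[OF assms(3)])
  show "(\<lambda>x. cvec (grad f x) (v x)) \<in> borel_measurable lebesgue"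
    by (intro cvec_measurable grad_measurable sqint_measurable assms)
  show "AE x in lebesgue. norm (cvec (grad f x) (v x)) \<le> \<bar>K\<bar> / sqrt \<mu> * norm (v x)"
    using energy_grad_bound[OF assms(2)] by eventually_elim (simp only: norm_cvec mult_right_mono norm_ge_zero)
qed

text \<open>The cut-off enters only through its energy density with respect to A. Its Euclidean
  gradient, whose bound involves \<open>\<mu>\<close>, serves for integrability alone; this is how
  the constants stay free of the ellipticity bounds.\<close>

lemma Q_cvec_grad_le:
  assumes "smooth f" "AE x in lebesgue. grad f x \<bullet> (A x *v grad f x) \<le> K\<^sup>2" "v \<in> sqint"
  shows "Q (\<lambda>x. cvec (grad f x) (v x)) (\<lambda>x. cvec (grad f x) (v x)) \<le> K\<^sup>2 * ip v v"
proof -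
  have "Q (\<lambda>x. cvec (grad f x) (v x)) (\<lambda>x. cvec (grad f x) (v x)) \<le> (\<integral>x. K\<^sup>2 * (norm (v x))\<^sup>2 \<partial>lebesgue)"
    unfolding Q_def ip_def
  proof (rule integral_mono_AE)
    show "AE x in lebesgue. cvec (grad f x) (v x) \<bullet> act (A x) (cvec (grad f x) (v x)) \<le> K\<^sup>2 * (norm (v x))\<^sup>2"
      using assms(2) by eventually_elim (simp add: inner_act_cvec mult_right_mono power2_norm_eq_inner)
  qed (use assms in \<open>auto intro!: sqint_integrable sqint_inner_integrable act_sqint cvec_grad_sqint\<close>)
  then show ?thesis by (simp add: ip_self)
qed

end

locale cutoff = elliptic A \<mu> \<Lambda>
  for A :: "real^'n::finite \<Rightarrow> real^'n^'n" and \<mu> \<Lambda> :: real +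
  fixes z :: "real^'n \<Rightarrow> real" and K :: real
  assumes z_smooth: "smooth z" and z_bounds: "0 \<le> z x" "z x \<le> 1"
    and z_energy: "AE x in lebesgue. grad z x \<bullet> (A x *v grad z x) \<le> K\<^sup>2" and K_nonneg: "K \<ge> 0"
begin

definition N :: "nat \<Rightarrow> (real^'n \<Rightarrow> complex) \<Rightarrow> real" where
  "N k f = sqrt (ip (\<lambda>x. z x ^ k *\<^sub>R f x) (\<lambda>x. z x ^ k *\<^sub>R f x))"

definition E :: "nat \<Rightarrow> (real^'n \<Rightarrow> complex^'n) \<Rightarrow> real" where
  "E k G = sqrt (Q (\<lambda>x. z x ^ k *\<^sub>R G x) (\<lambda>x. z x ^ k *\<^sub>R G x))"

lemma z_power_bounds: "0 \<le> z x ^ k" "z x ^ k \<le> 1" "\<bar>z x ^ k\<bar> \<le> 1"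
  using z_bounds[of x] by (auto simp: power_le_one)

lemma z_power_smooth: "smooth (\<lambda>x. z x ^ k)"
  by (simp add: Ck_power z_smooth)

lemma z_sqint:
  fixes f :: "real^'n \<Rightarrow> 'c::euclidean_space"
  assumes "f \<in> sqint"
  shows "(\<lambda>x. z x ^ k *\<^sub>R f x) \<in> sqint"
proof (rule sqint_bound[OF assms, of _ 1])
  show "(\<lambda>x. z x ^ k *\<^sub>R f x) \<in> borel_measurable lebesgue"
    by (intro borel_measurable_scaleR smooth_measurable z_power_smooth sqint_measurable assms)
  show "AE x in lebesgue. norm (z x ^ k *\<^sub>R f x) \<le> 1 * norm (f x)"
    using z_power_bounds by (auto simp: mult_left_le_one_le)
qed

lemma N_nonneg: "N k f \<ge> 0" and E_nonneg: "G \<in> sqint \<Longrightarrow> E k G \<ge> 0"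
  by (auto simp: N_def E_def ip_nonneg Q_nonneg z_sqint)

lemma N_square: "(N k f)\<^sup>2 = ip (\<lambda>x. z x ^ k *\<^sub>R f x) (\<lambda>x. z x ^ k *\<^sub>R f x)"
  by (simp add: N_def ip_nonneg)

lemma E_square: "G \<in> sqint \<Longrightarrow> (E k G)\<^sup>2 = Q (\<lambda>x. z x ^ k *\<^sub>R G x) (\<lambda>x. z x ^ k *\<^sub>R G x)"
  by (simp add: E_def Q_nonneg z_sqint)

lemma N_antimono:
  assumes "f \<in> sqint" "k \<le> l"
  shows "N l f \<le> N k f"
  unfolding N_def
proof (intro real_sqrt_le_mono ip_mono_self z_sqint assms)
  have "z x ^ l \<le> z x ^ k" for x using z_bounds[of x] assms(2) by (intro power_decreasing) auto
  then show "AE x in lebesgue. norm (z x ^ l *\<^sub>R f x) \<le> norm (z x ^ k *\<^sub>R f x)"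
    using z_power_bounds by (auto intro!: mult_right_mono)
qed

lemma ip_shift:
  assumes "a + b = c + d"
  shows "ip (\<lambda>x. z x ^ a *\<^sub>R f x) (\<lambda>x. z x ^ b *\<^sub>R g x) = ip (\<lambda>x. z x ^ c *\<^sub>R f x) (\<lambda>x. z x ^ d *\<^sub>R g x)"
proof -
  have "(z x ^ a *\<^sub>R f x) \<bullet> (z x ^ b *\<^sub>R g x) = z x ^ (a + b) * (f x \<bullet> g x)"
      "(z x ^ c *\<^sub>R f x) \<bullet> (z x ^ d *\<^sub>R g x) = z x ^ (c + d) * (f x \<bullet> g x)" for x
    by (simp_all add: power_add)
  then show ?thesis unfolding ip_def by (simp only: assms)
qed

lemma ip_shift_le:
  assumes "f \<in> sqint" "g \<in> sqint" "k = c + d"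
  shows "\<bar>ip (\<lambda>x. z x ^ k *\<^sub>R f x) g\<bar> \<le> N c f * N d g"
proof -
  have "ip (\<lambda>x. z x ^ k *\<^sub>R f x) g = ip (\<lambda>x. z x ^ c *\<^sub>R f x) (\<lambda>x. z x ^ d *\<^sub>R g x)"
    using ip_shift[of k 0 c d f g] assms(3) by simp
  then show ?thesis unfolding N_def by (simp only: ip_Cauchy_Schwarz[OF z_sqint z_sqint] assms)
qed

lemma Q_shift_z:
  assumes "k = c + d"
  shows "Q (\<lambda>x. z x ^ k *\<^sub>R F x) G = Q (\<lambda>x. z x ^ c *\<^sub>R F x) (\<lambda>x. z x ^ d *\<^sub>R G x)"
  using Q_shift[of "\<lambda>x. z x ^ k" "\<lambda>x. 1" "\<lambda>x. z x ^ c" "\<lambda>x. z x ^ d" F G] assms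
  by (simp add: power_add)

lemma Q_shift_le:
  assumes "F \<in> sqint" "G \<in> sqint" "k = c + d"
  shows "\<bar>Q (\<lambda>x. z x ^ k *\<^sub>R F x) G\<bar> \<le> E c F * E d G"
  unfolding Q_shift_z[OF assms(3)] E_def by (intro Q_Cauchy_Schwarz z_sqint assms)

lemma cvec_grad_z_sqint: "v \<in> sqint \<Longrightarrow> (\<lambda>x. cvec (grad z x) (v x)) \<in> sqint"
  by (rule cvec_grad_sqint[OF z_smooth z_energy])

lemma E_cvec_le:
  assumes "v \<in> sqint"
  shows "E k (\<lambda>x. cvec (grad z x) (v x)) \<le> K * N k v"
proof -
  have "z x ^ k *\<^sub>R cvec (grad z x) (v x) = cvec (grad z x) (z x ^ k *\<^sub>R v x)" for x
    by (simp add: cvec_def vec_eq_iff mult.commute)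
  then have "E k (\<lambda>x. cvec (grad z x) (v x)) \<le> sqrt (K\<^sup>2 * ip (\<lambda>x. z x ^ k *\<^sub>R v x) (\<lambda>x. z x ^ k *\<^sub>R v x))"
    unfolding E_def by (simp only:) (intro real_sqrt_le_mono Q_cvec_grad_le z_smooth z_energy z_sqint assms)
  also have "\<dots> = K * N k v" using K_nonneg by (simp add: N_def real_sqrt_mult)
  finally show ?thesis .
qed

lemma grad_power: "grad (\<lambda>x. z x ^ Suc k) x = (real (Suc k) * z x ^ k) *\<^sub>R grad z x"
proof -
  have "partial i (\<lambda>x. z x ^ Suc k) x = (real (Suc k) * z x ^ k) * partial i z x" for i
    by (rule partial_compose[of "\<lambda>t. t ^ Suc k"])
      (use DERIV_pow[of "Suc k" "z x"] smooth_differentiable[OF z_smooth] in auto)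
  then show ?thesis by (simp add: grad_def vec_eq_iff)
qed

lemma wgrad_z:
  assumes "wgrad v H"
  shows "wgrad (\<lambda>x. z x ^ Suc k *\<^sub>R v x)
    (\<lambda>x. z x ^ Suc k *\<^sub>R H x + real (Suc k) *\<^sub>R (z x ^ k *\<^sub>R cvec (grad z x) (v x)))"
proof -
  have "AE x in lebesgue. norm (grad (\<lambda>x. z x ^ Suc k) x) \<le> real (Suc k) * (\<bar>K\<bar> / sqrt \<mu>)"
    using energy_grad_bound[OF z_energy]
  proof eventually_elim
    case (elim x)
    have "norm (grad (\<lambda>x. z x ^ Suc k) x) = real (Suc k) * (z x ^ k * norm (grad z x))"
      unfolding grad_power using z_power_bounds[of x k] by (simp add: abs_mult)
    also have "\<dots> \<le> real (Suc k) * (1 * (\<bar>K\<bar> / sqrt \<mu>))"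
      using z_power_bounds[of x k] elim by (intro mult_left_mono mult_mono) auto
    finally show ?case by simp
  qed
  from wgrad_mult[OF assms z_power_smooth z_power_bounds(3) this]
  have "wgrad (\<lambda>x. z x ^ Suc k *\<^sub>R v x)
    (\<lambda>x. z x ^ Suc k *\<^sub>R H x + cvec (grad (\<lambda>x. z x ^ Suc k) x) (v x))" .
  moreover have "cvec (grad (\<lambda>x. z x ^ Suc k) x) (v x) = real (Suc k) *\<^sub>R (z x ^ k *\<^sub>R cvec (grad z x) (v x))" for x
    unfolding grad_power by (simp add: cvec_def vec_eq_iff)
  ultimately show ?thesis by simp
qed

text \<open>The test function is a power of z times v; differentiating that weight produces the
  factor \<open>Suc k\<close> and loses one power of z.\<close>

lemma sol_test:
  assumes s: "sol u G f" and v: "wgrad v H"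
  shows "ip (\<lambda>x. z x ^ Suc k *\<^sub>R v x) u + Q (\<lambda>x. z x ^ Suc k *\<^sub>R H x) G
      + real (Suc k) * Q (\<lambda>x. z x ^ k *\<^sub>R cvec (grad z x) (v x)) G
    = ip (\<lambda>x. z x ^ Suc k *\<^sub>R v x) f"
proof -
  have "Q (\<lambda>x. z x ^ Suc k *\<^sub>R H x + real (Suc k) *\<^sub>R (z x ^ k *\<^sub>R cvec (grad z x) (v x))) G
      = Q (\<lambda>x. z x ^ Suc k *\<^sub>R H x) G + real (Suc k) * Q (\<lambda>x. z x ^ k *\<^sub>R cvec (grad z x) (v x)) G"
    by (subst Q_add_left[OF z_sqint[OF wgrad_sqint(2)[OF v]]
          sqint_scaleR[OF z_sqint[OF cvec_grad_z_sqint[OF wgrad_sqint(1)[OF v]]]] sol_sqint(2)[OF s]])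
      (simp only: Q_scaleR_left)
  then show ?thesis using sol_eq[OF s wgrad_z[OF v, of k]] by simp
qed

text \<open>Test with z^(2p+2) u. The exponent splits as p + (p+2) in the source term and as (p+1) +
  (p+1) in the energy; in the term with grad z the remaining 2p+1 splits as p + (p+1). The
  zero-order term is nonnegative and dropped, and Young's inequality absorbs half of the energy,
  which doubles the other coefficients.\<close>

lemma caccioppoli:
  assumes s: "sol u G f"
  shows "(E (Suc p) G)\<^sup>2 \<le> 2 * (N (p + 2) f * N p u) + 4 * (real (p + 1))\<^sup>2 * K\<^sup>2 * (N p u)\<^sup>2"
proof -
  have u: "wgrad u G" using s by (simp add: sol_def)
  note us = sol_sqint[OF s]
  define a d where "a = N p u" and "d = E (Suc p) G"
  have "ip (\<lambda>x. z x ^ Suc (2 * p + 1) *\<^sub>R u x) u = ip (\<lambda>x. z x ^ Suc p *\<^sub>R u x) (\<lambda>x. z x ^ Suc p *\<^sub>R u x)"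
    using ip_shift[of "Suc (2 * p + 1)" 0 "Suc p" "Suc p" u u] by simp
  then have 1: "ip (\<lambda>x. z x ^ Suc (2 * p + 1) *\<^sub>R u x) u \<ge> 0" by (simp add: ip_nonneg)
  have 2: "Q (\<lambda>x. z x ^ Suc (2 * p + 1) *\<^sub>R G x) G = d\<^sup>2"
    unfolding d_def E_square[OF us(2)] by (rule Q_shift_z) simp
  have "\<bar>Q (\<lambda>x. z x ^ (2 * p + 1) *\<^sub>R cvec (grad z x) (u x)) G\<bar>
      \<le> E p (\<lambda>x. cvec (grad z x) (u x)) * E (Suc p) G"
    by (rule Q_shift_le) (use us in \<open>auto intro: cvec_grad_z_sqint\<close>)
  also have "\<dots> \<le> K * a * d"
    unfolding a_def d_def using E_cvec_le[OF us(1)] E_nonneg[OF us(2)] by (intro mult_right_mono) auto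
  finally have 3: "\<bar>Q (\<lambda>x. z x ^ (2 * p + 1) *\<^sub>R cvec (grad z x) (u x)) G\<bar> \<le> K * a * d" .
  have "ip (\<lambda>x. z x ^ Suc (2 * p + 1) *\<^sub>R u x) f \<le> N p u * N (p + 2) f"
    using ip_shift_le[OF us(1,3), of "Suc (2 * p + 1)" p "p + 2"] by simp
  then have 4: "ip (\<lambda>x. z x ^ Suc (2 * p + 1) *\<^sub>R u x) f \<le> N (p + 2) f * a" by (simp add: a_def mult.commute)
  have eq: "real (Suc (2 * p + 1)) = 2 * real (p + 1)" by simp
  have "d\<^sup>2 \<le> N (p + 2) f * a + 2 * real (p + 1) * (K * a * d)"
  proof -
    have "- (2 * real (p + 1) * Q (\<lambda>x. z x ^ (2 * p + 1) *\<^sub>R cvec (grad z x) (u x)) G)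
        \<le> 2 * real (p + 1) * (K * a * d)"
      using 3 mult_left_mono[of "- Q (\<lambda>x. z x ^ (2 * p + 1) *\<^sub>R cvec (grad z x) (u x)) G" "K * a * d" "2 * real (p + 1)"]
      by auto
    then show ?thesis using sol_test[OF s u, of "2 * p + 1"] 1 2 4 unfolding eq by linarith
  qed
  moreover have "2 * real (p + 1) * (K * a * d) \<le> 2 * (real (p + 1))\<^sup>2 * K\<^sup>2 * a\<^sup>2 + d\<^sup>2 / 2"
  proof -
    define e where "e = real (p + 1) * K * a"
    have "2 * (2 * e) * d \<le> (2 * e)\<^sup>2 + d\<^sup>2" by (rule sum_squares_bound)
    then have "2 * (e * d) \<le> 2 * e\<^sup>2 + d\<^sup>2 / 2" by (simp add: power_mult_distrib)
    moreover have "e\<^sup>2 = (real (p + 1))\<^sup>2 * K\<^sup>2 * a\<^sup>2" by (simp only: e_def power_mult_distrib)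
    ultimately have "2 * (e * d) \<le> 2 * ((real (p + 1))\<^sup>2 * K\<^sup>2 * a\<^sup>2) + d\<^sup>2 / 2" by (simp only:)
    then show ?thesis by (simp only: e_def mult.assoc)
  qed
  ultimately show ?thesis unfolding a_def[symmetric] d_def[symmetric] by linarith
qed

text \<open>Test the equation of u with z^(2p+4) f; this is possible since f has a weak gradient,
  being itself a solution in the chain. The uneven split (p+1) + (p+3) of the energy weight gives
  each gradient the weight that belongs to its index.\<close>

lemma interpolation:
  assumes s: "sol u G f" and f: "wgrad f H"
  shows "(N (p + 2) f)\<^sup>2 \<le> N (p + 2) f * N p u + E (p + 1) G * E (p + 3) H
    + 2 * real (p + 2) * K * N (p + 2) f * E (p + 1) G"
proof -
  note us = sol_sqint[OF s]
  note fs = wgrad_sqint[OF f]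
  let ?k = "2 * p + 3"
  have 1: "ip (\<lambda>x. z x ^ Suc ?k *\<^sub>R f x) u \<le> N (p + 2) f * N p u"
    using ip_shift_le[OF fs(1) us(1), of "Suc ?k" "p + 2" "p + 2"] N_antimono[OF us(1), of p "p + 2"]
      mult_left_mono[OF N_antimono[OF us(1), of p "p + 2"] N_nonneg[of "p + 2" f]] by simp
  have 2: "Q (\<lambda>x. z x ^ Suc ?k *\<^sub>R H x) G \<le> E (p + 1) G * E (p + 3) H"
    using Q_shift_le[OF fs(2) us(2), of "Suc ?k" "p + 3" "p + 1"] by (simp add: mult.commute)
  have "\<bar>Q (\<lambda>x. z x ^ ?k *\<^sub>R cvec (grad z x) (f x)) G\<bar>
      \<le> E (p + 2) (\<lambda>x. cvec (grad z x) (f x)) * E (p + 1) G"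
    by (rule Q_shift_le) (use us fs in \<open>auto intro: cvec_grad_z_sqint\<close>)
  also have "\<dots> \<le> K * N (p + 2) f * E (p + 1) G"
    using E_cvec_le[OF fs(1)] E_nonneg[OF us(2)] by (intro mult_right_mono) auto
  finally have "Q (\<lambda>x. z x ^ ?k *\<^sub>R cvec (grad z x) (f x)) G \<le> K * N (p + 2) f * E (p + 1) G" by simp
  from mult_left_mono[OF this, of "real (Suc ?k)"]
  have 3: "real (Suc ?k) * Q (\<lambda>x. z x ^ ?k *\<^sub>R cvec (grad z x) (f x)) G
      \<le> 2 * real (p + 2) * K * N (p + 2) f * E (p + 1) G" by (simp add: algebra_simps)
  have "ip (\<lambda>x. z x ^ Suc ?k *\<^sub>R f x) f = ip (\<lambda>x. z x ^ (p + 2) *\<^sub>R f x) (\<lambda>x. z x ^ (p + 2) *\<^sub>R f x)"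
    using ip_shift[of "Suc ?k" 0 "p + 2" "p + 2" f f] by simp
  then have "(N (p + 2) f)\<^sup>2 = ip (\<lambda>x. z x ^ Suc ?k *\<^sub>R f x) f" by (simp add: N_square)
  then show ?thesis using sol_test[OF s f, of ?k] 1 2 3 by linarith
qed

text \<open>The weights \<open>z\<^sup>2\<^sup>(\<^sup>m\<^sup>-\<^sup>j\<^sup>)\<close> make the estimates close up with a single cut-off: each use of
  an equation costs one power of \<open>z\<close> per derivative, so the weight of \<open>u\<^sub>j\<close> exceeds that of
  \<open>u\<^sub>j\<^sub>+\<^sub>1\<close> by two powers.\<close>

lemma energy_away_from_source:
  assumes s: "\<And>j. sol (u (Suc j)) (G (Suc j)) (u j)" and u0: "\<And>x. z x * norm (u 0 x) = 0" and j: "j < m"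
  shows "E (2 * (m - Suc j) + 1) (G (Suc j)) \<le> chain_const (energy_const K m) m ^ Suc m * N 0 (u m)"
proof -
  have us: "u j \<in> sqint" for j using sol_sqint(3)[OF s[of j]] .
  have Gs: "G (Suc j) \<in> sqint" for j using sol_sqint(2)[OF s[of j]] .
  define a where "a j = N (2 * (m - j)) (u j)" for j
  \<comment> \<open>No equation is attached to index 0, so \<open>G 0\<close> is arbitrary; the
    value 0 meets the sign condition that \<open>chain_estimate\<close> imposes at every
    index.\<close>
  define d where "d j = (if j = 0 then 0 else E (2 * (m - j) + 1) (G j))" for j
  have M1: "energy_const K m \<ge> 1" using K_nonneg by (simp add: energy_const_def)
  have "d (Suc j) \<le> chain_const (energy_const K m) m ^ Suc m * a m"
  proof (rule chain_estimate[OF M1 _ _ _ _ _ j])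
    show "a j \<ge> 0" for j by (simp add: a_def N_nonneg)
    show "d j \<ge> 0" for j by (cases j) (auto simp: d_def E_nonneg Gs)
    have "m > 0" using j by simp
    then have eq: "(\<lambda>x. z x ^ (2 * m) *\<^sub>R u 0 x) = (\<lambda>x. 0)"
      using u0 by (auto simp: fun_eq_iff)
    show "a 0 = 0" unfolding a_def N_def minus_nat.diff_0 eq by (simp add: ip_def)
    fix j
    show "(d (Suc j))\<^sup>2 \<le> energy_const K m * (a j * a (Suc j) + (a (Suc j))\<^sup>2)" if "j < m"
    proof -
      \<comment> \<open>With this p the weight p + 2 that \<open>caccioppoli\<close> puts on the
        source is exactly the weight of \<open>u j\<close>.\<close>
      define p where "p = 2 * (m - Suc j)"
      have p: "2 * (m - j) = p + 2" "p \<le> 2 * m" using that by (auto simp: p_def)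
      have nn: "0 \<le> a j * a (Suc j)" by (simp add: a_def N_nonneg)
      have "(d (Suc j))\<^sup>2 \<le> 2 * (a j * a (Suc j)) + 4 * (real (p + 1))\<^sup>2 * K\<^sup>2 * (a (Suc j))\<^sup>2"
        using caccioppoli[OF s[of j], of p] p(1) by (simp add: d_def a_def p_def[symmetric])
      also have "4 * (real (p + 1))\<^sup>2 * K\<^sup>2 * (a (Suc j))\<^sup>2 \<le> 4 * (real (2 * m + 1))\<^sup>2 * K\<^sup>2 * (a (Suc j))\<^sup>2"
        using p(2) by (intro mult_right_mono mult_left_mono power_mono) auto
      also have "\<dots> \<le> energy_const K m * (a (Suc j))\<^sup>2"
        using K_nonneg by (intro mult_right_mono) (auto simp: energy_const_def)
      also have "2 * (a j * a (Suc j)) \<le> energy_const K m * (a j * a (Suc j))"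
        using nn K_nonneg by (intro mult_right_mono) (auto simp: energy_const_def)
      finally show ?thesis by (simp add: distrib_left)
    qed
    show "(a (Suc j))\<^sup>2 \<le> a (Suc j) * a (Suc (Suc j)) + d (Suc (Suc j)) * d (Suc j)
        + energy_const K m * a (Suc j) * d (Suc (Suc j))" if "Suc j < m"
    proof -
      define p where "p = 2 * (m - Suc (Suc j))"
      have p: "2 * (m - Suc j) = p + 2" "p + 2 \<le> 2 * m" using that by (auto simp: p_def)
      have w: "wgrad (u (Suc j)) (G (Suc j))" using s[of j] by (simp add: sol_def)
      have nn: "0 \<le> a (Suc j) * d (Suc (Suc j))" by (simp add: a_def d_def N_nonneg E_nonneg Gs)
      have "(a (Suc j))\<^sup>2 \<le> a (Suc j) * a (Suc (Suc j)) + d (Suc (Suc j)) * d (Suc j)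
          + 2 * real (p + 2) * K * a (Suc j) * d (Suc (Suc j))"
        using interpolation[OF s[of "Suc j"] w, of p] p(1)
        by (simp add: a_def d_def p_def[symmetric] numeral_3_eq_3)
      also have "2 * real (p + 2) * K * a (Suc j) * d (Suc (Suc j)) = (2 * real (p + 2) * K) * (a (Suc j) * d (Suc (Suc j)))"
        by simp
      also have "(2 * real (p + 2) * K) * (a (Suc j) * d (Suc (Suc j))) \<le> energy_const K m * (a (Suc j) * d (Suc (Suc j)))"
      proof (rule mult_right_mono[OF _ nn])
        have "2 * real (p + 2) * K \<le> 2 * real (2 * m) * K"
          using p(2) K_nonneg by (intro mult_right_mono mult_left_mono) auto
        then show "2 * real (p + 2) * K \<le> energy_const K m" by (simp add: energy_const_def add_increasing)
      qed
      finally show ?thesis by (simp add: mult.assoc)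
    qed
  qed
  then show ?thesis by (simp add: a_def d_def)
qed

end

section \<open>From a profile of bounded energy to a lower bound for the norm of
  \<open>u m\<close>\<close>

lemma grad_compose:
  assumes "(f has_real_derivative d) (at (w x))" "w differentiable (at x)"
  shows "grad (\<lambda>x. f (w x)) x = d *\<^sub>R grad w x"
  by (simp add: grad_def vec_eq_iff partial_compose[OF assms])

lemma quadratic_scaleR:
  fixes M :: "real^'n::finite^'n" and \<xi> :: "real^'n"
  shows "(c *\<^sub>R \<xi>) \<bullet> (M *v (c *\<^sub>R \<xi>)) = c\<^sup>2 * (\<xi> \<bullet> (M *v \<xi>))"
  by (simp add: linear_scale[OF matrix_vector_mul_linear] power2_eq_square)

text \<open>The 1 pays for the pairing of \<eta> with \<open>u m\<close>. Each of the
  \<open>m\<close> energy terms costs \<open>step_lip\<close> for the gradient of \<eta> and the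
  chain constant for the energy of \<open>u j\<close>; \<open>2 * step_lip\<close> is the energy
  bound of the second cut-off 1 - step (2 w).\<close>

definition lower_const :: "nat \<Rightarrow> real" where
  "lower_const m = 1 + real m * step_lip * chain_const (energy_const (2 * step_lip) m) m ^ Suc m"

lemma lower_const_pos: "lower_const m > 0"
proof -
  have "energy_const (2 * step_lip) m \<ge> 1"
    using step_lip_pos by (simp add: energy_const_def)
  then have "chain_const (energy_const (2 * step_lip) m) m \<ge> 1" by (rule chain_const_ge)
  then show ?thesis using step_lip_pos by (simp add: lower_const_def add_pos_nonneg)
qed

context elliptic
begin

text \<open>One profile gives two cut-offs: \<eta> = step w is 1 for w \<le> 1/3 and 0 for w \<ge>
  2/3, while z = 1 - step (2 w) is 0 for w \<le> 1/6 and 1 for w \<ge> 1/3. So z removes the source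
  and equals 1 wherever the gradient of \<eta> can be nonzero.\<close>

lemma local_lower_bound:
  assumes s: "\<And>j. sol (u (Suc j)) (G (Suc j)) (u j)"
    and w: "smooth w" "AE x in lebesgue. grad w x \<bullet> (A x *v grad w x) \<le> 1"
    and \<eta>: "(\<lambda>x. step (w x)) \<in> test_functions"
    and B: "B \<in> sets lebesgue" "emeasure lebesgue B < \<infinity>" "\<And>x. x \<notin> B \<Longrightarrow> w x \<ge> 2/3"
    and u0: "u 0 = (\<lambda>x. complex_of_real (\<psi> x))" and \<psi>: "(\<integral>x. \<psi> x \<partial>lebesgue) = 1"
      "\<And>x. \<psi> x \<noteq> 0 \<Longrightarrow> w x \<le> 1/6"
  shows "1 \<le> lower_const m * sqrt (measure lebesgue B) * sqrt (ip (u m) (u m))"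
proof -
  have wd: "w differentiable (at x)" for x by (rule smooth_differentiable[OF w(1)])
  define z where "z x = 1 - step (2 * w x)" for x
  define K where "K = 2 * step_lip"
  have gz: "grad z x = (- 2 * step' (2 * w x)) *\<^sub>R grad w x" for x
    unfolding z_def
    by (rule grad_compose[where f = "\<lambda>t. 1 - step (2 * t)", OF _ wd])
      (auto intro!: derivative_eq_intros DERIV_chain2[OF step_deriv])
  interpret cutoff A \<mu> \<Lambda> z K
  proof
    show "smooth z" unfolding z_def[abs_def]
      using w(1) by (auto intro!: Ck_diff Ck_const Ck_step Ck_mult)
    show "0 \<le> z x" "z x \<le> 1" for x using step_bounds[of "2 * w x"] by (auto simp: z_def)
    show "K \<ge> 0" using step_lip_pos by (simp add: K_def)
    show "AE x in lebesgue. grad z x \<bullet> (A x *v grad z x) \<le> K\<^sup>2"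
      using w(2)
    proof eventually_elim
      case (elim x)
      have "grad z x \<bullet> (A x *v grad z x) = (- 2 * step' (2 * w x))\<^sup>2 * (grad w x \<bullet> (A x *v grad w x))"
        unfolding gz by (rule quadratic_scaleR)
      also have "\<dots> \<le> (- 2 * step' (2 * w x))\<^sup>2 * 1" using elim by (intro mult_left_mono) auto
      also have "\<dots> = (2 * \<bar>step' (2 * w x)\<bar>)\<^sup>2" by (simp add: power_mult_distrib)
      also have "\<dots> \<le> K\<^sup>2" unfolding K_def
        using step'_bound[of "2 * w x"] by (intro power_mono) auto
      finally show ?case .
    qed
  qed
  have us: "u j \<in> sqint" for j using sol_sqint(3)[OF s[of j]] .
  have Gs: "G (Suc j) \<in> sqint" for j using sol_sqint(2)[OF s[of j]] .
  define b where "b = measure lebesgue B"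
  \<comment> \<open>An L2 majorant of norm squared |B|: \<eta> and the factor v of its gradient
    vanish off B, where w \<ge> 2/3.\<close>
  define iB :: "real^'n \<Rightarrow> complex" where "iB x = complex_of_real (indicator B x)" for x
  have iB: "iB \<in> sqint" "ip iB iB = b"
  proof -
    have e: "(norm (iB x))\<^sup>2 = indicator B x" for x by (simp add: iB_def indicator_def)
    have i: "integrable lebesgue (indicator B :: _ \<Rightarrow> real)" using B by (intro integrable_real_indicator) auto
    have "iB \<in> borel_measurable lebesgue"
      unfolding iB_def using borel_measurable_integrable[OF i] by measurable
    then show "iB \<in> sqint" using i by (simp add: sqint_def e)
    show "ip iB iB = b" using B(1) by (simp add: ip_self e b_def)
  qed
  define \<eta> where "\<eta> x = complex_of_real (step (w x))" for x
  define v where "v x = complex_of_real (step' (w x))" for x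
  define g where "g x = cvec (grad w x) (v x)" for x
  have g_eq: "cvec (grad (\<lambda>x. step (w x)) x) 1 = g x" for x
    unfolding grad_compose[OF step_deriv wd] g_def v_def cvec_def
    by (simp add: vec_eq_iff) (simp add: scaleR_conv_of_real)
  have wg: "wgrad \<eta> g" using wgrad_test_function[OF \<open>_ \<in> test_functions\<close>] by (simp add: g_eq \<eta>_def[abs_def])
  have \<eta>s: "\<eta> \<in> sqint" and gs: "g \<in> sqint" using wgrad_sqint[OF wg] by auto
  have "norm (\<eta> x) \<le> norm (iB x)" for x
    using step_bounds[of "w x"] step_eq_0[of "w x"] B(3)[of x] by (cases "x \<in> B") (auto simp: \<eta>_def iB_def)
  then have \<eta>_le: "ip \<eta> \<eta> \<le> b" using ip_mono_self[OF \<eta>s iB(1)] iB(2) by simp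
  have v_le: "norm (v x) \<le> step_lip * norm (iB x)" for x
    using step'_bound[of "w x"] step'_eq_0[of "w x"] B(3)[of x] by (cases "x \<in> B") (auto simp: v_def iB_def)
  have vs: "v \<in> sqint"
  proof (rule sqint_bound[OF iB(1)])
    have "continuous_on UNIV (\<lambda>x. complex_of_real (step' (w x)))"
      using Ck_continuous[OF w(1)[rule_format]]
      by (intro continuous_on_of_real continuous_on_compose2[OF continuous_step']) auto
    then show "v \<in> borel_measurable lebesgue"
      unfolding v_def[abs_def] by (rule measurable_lebesgue_of_continuous)
    show "AE x in lebesgue. norm (v x) \<le> step_lip * norm (iB x)" using v_le by simp
  qed
  have "ip v v \<le> ip (\<lambda>x. step_lip *\<^sub>R iB x) (\<lambda>x. step_lip *\<^sub>R iB x)"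
    using v_le step_lip_pos by (intro ip_mono_self vs sqint_scaleR iB) auto
  also have "\<dots> = step_lip\<^sup>2 * b" by (simp add: ip_scaleR_left ip_scaleR_right iB(2) power2_eq_square)
  finally have "Q g g \<le> step_lip\<^sup>2 * b"
    using Q_cvec_grad_le[of w 1 v] w vs by (simp add: g_def[abs_def])
  then have "sqrt (Q g g) \<le> sqrt (step_lip\<^sup>2 * b)" by (rule real_sqrt_le_mono)
  then have Qg: "sqrt (Q g g) \<le> step_lip * sqrt b" using step_lip_pos by (simp add: real_sqrt_mult)
  define c where "c = chain_const (energy_const K m) m ^ Suc m"
  have N0: "N 0 f = sqrt (ip f f)" for f by (simp add: N_def)
  have Q_le: "\<bar>Q g (G (Suc j))\<bar> \<le> step_lip * c * sqrt b * sqrt (ip (u m) (u m))" if j: "j < m" for j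
  proof -
    define k where "k = 2 * (m - Suc j) + 1"
    \<comment> \<open>Inserting the weight is free: for w \<le> 1/3 the vector g is 0, and otherwise
      z is 1.\<close>
    have "g x \<bullet> act (A x) (G (Suc j) x) = g x \<bullet> act (A x) (z x ^ k *\<^sub>R G (Suc j) x)" for x
    proof (cases "w x \<le> 1/3")
      case True
      then show ?thesis using step'_eq_0[of "w x"] by (simp add: g_def v_def cvec_def zero_vec_def[symmetric])
    next
      case False
      then show ?thesis using step_eq_0[of "2 * w x"] by (simp add: z_def)
    qed
    then have "Q g (G (Suc j)) = Q g (\<lambda>x. z x ^ k *\<^sub>R G (Suc j) x)" by (simp add: Q_def ip_def)
    then have "\<bar>Q g (G (Suc j))\<bar> \<le> sqrt (Q g g) * E k (G (Suc j))"
      unfolding E_def using Q_Cauchy_Schwarz[OF gs z_sqint[OF Gs]] by simp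
    also have "\<dots> \<le> (step_lip * sqrt b) * (c * sqrt (ip (u m) (u m)))"
    proof (rule mult_mono[OF Qg])
      have "z x * norm (u 0 x) = 0" for x
        using \<psi>(2)[of x] step_eq_1[of "2 * w x"] by (cases "\<psi> x = 0") (auto simp: u0 z_def)
      from energy_away_from_source[OF s this j]
      show "E k (G (Suc j)) \<le> c * sqrt (ip (u m) (u m))" by (simp add: c_def k_def N0)
    qed (use step_lip_pos in \<open>auto simp: b_def E_nonneg Gs\<close>)
    finally show ?thesis by (simp add: mult_ac)
  qed
  have tele: "ip \<eta> (u 0) = ip \<eta> (u n) + (\<Sum>j<n. Q g (G (Suc j)))" for n
  proof (induction n)
    case (Suc n)
    then show ?case using sol_eq[OF s[of n] wg] by simp
  qed simp
  have "\<eta> x \<bullet> u 0 x = \<psi> x" for x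
    using \<psi>(2)[of x] step_eq_1[of "w x"] by (cases "\<psi> x = 0") (auto simp: \<eta>_def u0)
  then have "1 = ip \<eta> (u 0)" using \<psi>(1) by (simp add: ip_def)
  also have "\<dots> = ip \<eta> (u m) + (\<Sum>j<m. Q g (G (Suc j)))" by (rule tele)
  also have "ip \<eta> (u m) \<le> sqrt (ip \<eta> \<eta>) * sqrt (ip (u m) (u m))"
    using ip_Cauchy_Schwarz[OF \<eta>s us[of m]] by linarith
  also have "\<dots> \<le> sqrt b * sqrt (ip (u m) (u m))"
    using \<eta>_le by (intro mult_right_mono real_sqrt_le_mono) (auto simp: ip_nonneg)
  also have "(\<Sum>j<m. Q g (G (Suc j))) \<le> (\<Sum>j<m. step_lip * c * sqrt b * sqrt (ip (u m) (u m)))"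
    using Q_le by (intro sum_mono) (auto intro: order_trans[OF abs_ge_self])
  finally show ?thesis by (simp add: lower_const_def c_def K_def b_def algebra_simps)
qed

end

section \<open>The distance\<close>

text \<open>The set where the bound fails is open and null, hence empty.\<close>

lemma AE_le_imp_le:
  fixes f :: "'a::euclidean_space \<Rightarrow> real"
  assumes "continuous_on UNIV f" "AE x in lebesgue. f x \<le> c"
  shows "f x \<le> c"
proof (rule ccontr)
  assume "\<not> f x \<le> c"
  then have "x \<in> {x. c < f x}" by simp
  moreover have "open {x. c < f x}"
    by (intro open_Collect_less assms(1)) auto
  moreover have "{x. c < f x} \<in> null_sets lebesgue"
    using assms(2) \<open>open {x. c < f x}\<close> by (subst AE_iff_null_sets) (auto simp: not_less)
  ultimately show False using open_not_negligible by (metis empty_iff negligible_iff_null_sets)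
qed

lemma frechet_derivative_grad:
  fixes f :: "real^'n::finite \<Rightarrow> real"
  assumes "f differentiable (at x)"
  shows "frechet_derivative f (at x) h = grad f x \<bullet> h"
proof -
  interpret linear "frechet_derivative f (at x)" by (rule linear_frechet_derivative[OF assms])
  have "frechet_derivative f (at x) h = frechet_derivative f (at x) (\<Sum>i\<in>UNIV. h $ i *\<^sub>R axis i 1)"
    using basis_expansion[of h] by (simp add: scalar_mult_eq_scaleR)
  also have "\<dots> = grad f x \<bullet> h"
    by (simp add: sum scale grad_def partial_def inner_vec_def mult.commute)
  finally show ?thesis .
qed

text \<open>Continuity of the gradient upgrades the bound to every point, so that the mean value
  inequality applies along segments, which are null sets in higher dimension.\<close>

lemma lipschitz_of_grad_bound:
  fixes f :: "real^'n::finite \<Rightarrow> real"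
  assumes "smooth f" "AE x in lebesgue. norm (grad f x) \<le> c"
  shows "\<bar>f x - f y\<bar> \<le> c * norm (x - y)"
proof -
  have "continuous_on UNIV (grad f)"
    unfolding grad_def[abs_def]
    using Ck_continuous[OF smooth_partial[OF assms(1), rule_format]] by (intro continuous_on_vec_lambda)
  then have c: "norm (grad f x) \<le> c" for x
    by (intro AE_le_imp_le[of "\<lambda>x. norm (grad f x)"] continuous_on_norm assms(2))
  have "norm (f x - f y) \<le> c * norm (x - y)"
  proof (rule differentiable_bound[of UNIV f "\<lambda>x. frechet_derivative f (at x)"])
    fix x
    show "(f has_derivative frechet_derivative f (at x)) (at x within UNIV)"
      using smooth_differentiable[OF assms(1)] by (simp add: frechet_derivative_works[symmetric])
    have "norm (frechet_derivative f (at x) h) \<le> c * norm h" for h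
    proof -
      have "norm (frechet_derivative f (at x) h) \<le> norm (grad f x) * norm h"
        unfolding frechet_derivative_grad[OF smooth_differentiable[OF assms(1)]]
        using Cauchy_Schwarz_ineq2 by simp
      also have "\<dots> \<le> c * norm h" by (intro mult_right_mono c) simp
      finally show ?thesis .
    qed
    then show "onorm (frechet_derivative f (at x)) \<le> c" by (rule onorm_le)
  qed auto
  then show ?thesis by simp
qed

lemma grad_add:
  fixes f g :: "real^'n::finite \<Rightarrow> real"
  assumes "f differentiable (at x)" "g differentiable (at x)"
  shows "grad (\<lambda>x. f x + g x) x = grad f x + grad g x"
  by (simp add: grad_def vec_eq_iff partial_add[OF assms])

lemma dist_class_energy:
  assumes "\<psi> \<in> dist_class C"
  shows "AE x in lebesgue. grad \<psi> x \<bullet> (C x *v grad \<psi> x) \<le> 1"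
proof -
  define e where "e x = (\<Sum>i\<in>UNIV. \<Sum>j\<in>UNIV. C x $ i $ j * partial i \<psi> x * partial j \<psi> x)" for x
  have e: "e x = grad \<psi> x \<bullet> (C x *v grad \<psi> x)" for x
    by (simp add: e_def grad_def inner_vec_def matrix_vector_mult_def sum_distrib_left algebra_simps)
  have "AE x in lebesgue. ennreal (norm (e x)) \<le> Linf_norm e"
    unfolding Linf_norm_def by (rule esssup_AE)
  then show ?thesis
  proof eventually_elim
    case (elim x)
    also have "Linf_norm e \<le> 1" using assms by (simp add: dist_class_def e_def[abs_def])
    finally have "norm (e x) \<le> 1" by simp
    then show ?case by (simp add: e[symmetric])
  qed
qed

lemma dist_C_triangle: "dist_C C x z \<le> dist_C C x y + dist_C C y z"
  unfolding dist_C_def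
proof (rule SUP_least)
  fix \<psi> assume \<psi>: "\<psi> \<in> dist_class C"
  have "ennreal \<bar>\<psi> x - \<psi> z\<bar> \<le> ennreal (\<bar>\<psi> x - \<psi> y\<bar> + \<bar>\<psi> y - \<psi> z\<bar>)"
    by (intro ennreal_leI) linarith
  also have "\<dots> = ennreal \<bar>\<psi> x - \<psi> y\<bar> + ennreal \<bar>\<psi> y - \<psi> z\<bar>" by simp
  also have "\<dots> \<le> (SUP \<psi>\<in>dist_class C. ennreal \<bar>\<psi> x - \<psi> y\<bar>) + (SUP \<psi>\<in>dist_class C. ennreal \<bar>\<psi> y - \<psi> z\<bar>)"
    by (intro add_mono SUP_upper \<psi>)
  finally show "ennreal \<bar>\<psi> x - \<psi> z\<bar>
      \<le> (SUP \<psi>\<in>dist_class C. ennreal \<bar>\<psi> x - \<psi> y\<bar>) + (SUP \<psi>\<in>dist_class C. ennreal \<bar>\<psi> y - \<psi> z\<bar>)" .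
qed

text \<open>Ellipticity bounds the Euclidean gradients in the class by 1 / sqrt \<mu>. With the
  triangle inequality this makes the balls open, hence measurable, and leaves compact sets minus a
  ball compact.\<close>

lemma dist_C_le:
  assumes "AE x in lebesgue. \<forall>\<xi>. \<mu> * (\<xi> \<bullet> \<xi>) \<le> \<xi> \<bullet> (C x *v \<xi>)" "\<mu> > 0"
  shows "dist_C C x y \<le> ennreal (norm (x - y) / sqrt \<mu>)"
  unfolding dist_C_def
proof (intro SUP_least ennreal_leI)
  fix \<psi> assume \<psi>: "\<psi> \<in> dist_class C"
  have "AE x in lebesgue. norm (grad \<psi> x) \<le> 1 / sqrt \<mu>"
    using dist_class_energy[OF \<psi>] assms(1)
  proof eventually_elim
    case (elim x)
    then have "\<mu> * (norm (grad \<psi> x))\<^sup>2 \<le> 1" by (metis order_trans power2_norm_eq_inner)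
    then have "(sqrt \<mu> * norm (grad \<psi> x))\<^sup>2 \<le> 1\<^sup>2" using assms(2) by (simp add: power_mult_distrib)
    then have "sqrt \<mu> * norm (grad \<psi> x) \<le> 1" by (rule power2_le_imp_le) simp
    then show ?case using assms(2) by (simp add: field_simps)
  qed
  then have "\<bar>\<psi> x - \<psi> y\<bar> \<le> 1 / sqrt \<mu> * norm (x - y)"
    using \<psi> by (intro lipschitz_of_grad_bound) (auto simp: dist_class_def test_functions_def)
  then show "\<bar>\<psi> x - \<psi> y\<bar> \<le> norm (x - y) / sqrt \<mu>" by simp
qed

lemma open_ball_C:
  assumes "AE x in lebesgue. \<forall>\<xi>. \<mu> * (\<xi> \<bullet> \<xi>) \<le> \<xi> \<bullet> (C x *v \<xi>)" "\<mu> > 0"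
  shows "open (ball_C C x r)"
  unfolding open_dist
proof
  fix y assume "y \<in> ball_C C x r"
  then have y: "dist_C C x y < ennreal r" by (simp add: ball_C_def)
  then obtain t where t: "dist_C C x y < t" "t < ennreal r" using dense by blast
  obtain t' where t': "t = ennreal t'" "t' \<ge> 0" using t(2) by (cases t) auto
  have tr: "t' < r" using t(2) t' by (simp add: ennreal_less_iff)
  define e where "e = (r - t') * sqrt \<mu>"
  have "z \<in> ball_C C x r" if "dist z y < e" for z
  proof -
    have "dist_C C x z \<le> dist_C C x y + dist_C C y z" by (rule dist_C_triangle)
    also have "\<dots> \<le> dist_C C x y + ennreal (r - t')"
    proof (intro add_left_mono order_trans[OF dist_C_le[OF assms]] ennreal_leI)
      show "norm (y - z) / sqrt \<mu> \<le> r - t'"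
        using that assms(2) by (simp add: e_def dist_norm norm_minus_commute divide_le_eq)
    qed
    also have "\<dots> < ennreal t' + ennreal (r - t')"
      using t(1) t' ennreal_add_left_cancel_less[of "ennreal (r - t')" "dist_C C x y" "ennreal t'"]
      by (simp add: add.commute)
    also have "\<dots> = ennreal r" using t'(2) tr by (simp flip: ennreal_plus)
    finally show ?thesis by (simp add: ball_C_def)
  qed
  moreover have "e > 0" using tr assms(2) by (simp add: e_def)
  ultimately show "\<exists>e>0. \<forall>z. dist z y < e \<longrightarrow> z \<in> ball_C C x r" by blast
qed

text \<open>The form of a convex combination equals the average of the two forms minus s (1 - s)
  times the form of the difference.\<close>

lemma quadratic_convex:
  fixes M :: "real^'n::finite^'n" and \<xi> \<eta> :: "real^'n"
  assumes M: "\<forall>\<xi>. 0 \<le> \<xi> \<bullet> (M *v \<xi>)" and s: "0 \<le> s" "s \<le> 1"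
    and le: "\<xi> \<bullet> (M *v \<xi>) \<le> 1" "\<eta> \<bullet> (M *v \<eta>) \<le> 1"
  shows "((1 - s) *\<^sub>R \<xi> + s *\<^sub>R \<eta>) \<bullet> (M *v ((1 - s) *\<^sub>R \<xi> + s *\<^sub>R \<eta>)) \<le> 1"
proof -
  have "((1 - s) *\<^sub>R \<xi> + s *\<^sub>R \<eta>) \<bullet> (M *v ((1 - s) *\<^sub>R \<xi> + s *\<^sub>R \<eta>))
    = (1 - s) * (\<xi> \<bullet> (M *v \<xi>)) + s * (\<eta> \<bullet> (M *v \<eta>)) - s * (1 - s) * ((\<xi> - \<eta>) \<bullet> (M *v (\<xi> - \<eta>)))"
    by (simp add: matrix_vector_right_distrib matrix_vector_mult_diff_distrib
        linear_scale[OF matrix_vector_mul_linear] inner_simps algebra_simps)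
  also have "\<dots> \<le> (1 - s) * 1 + s * 1 - 0"
    using s le M by (intro diff_mono add_mono mult_left_mono mult_nonneg_nonneg) auto
  finally show ?thesis by simp
qed

section \<open>Profiles of energy at most one and their smooth maxima\<close>

context elliptic
begin

text \<open>Compact support, part of \<open>dist_class\<close>, is not asked for: the smooth maximum
  of two functions vanishing at infinity does not vanish there. It is restored at the end by
  composing with \<open>step\<close>. With A = r^2 C the radius r is normalised to 1.\<close>

definition Lip :: "(real^'n \<Rightarrow> real) set" where
  "Lip = {w. smooth w \<and> (AE x in lebesgue. grad w x \<bullet> (A x *v grad w x) \<le> 1)}"

lemma quadratic_nonneg: "AE x in lebesgue. \<forall>\<xi>. 0 \<le> \<xi> \<bullet> (A x *v \<xi>)"
  using elliptic
proof eventually_elim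
  case (elim x)
  show ?case
  proof
    fix \<xi> :: "real^'n"
    have "0 \<le> \<mu> * (\<xi> \<bullet> \<xi>)" using \<mu>_pos by simp
    then show "0 \<le> \<xi> \<bullet> (A x *v \<xi>)" using elim by (meson order_trans)
  qed
qed

text \<open>Softplus replaces the maximum: the gradient stays a pointwise convex combination, so the
  energy bound survives.\<close>

lemma Lip_smooth_max:
  assumes "f \<in> Lip" "g \<in> Lip" "e > 0"
  obtains h where "h \<in> Lip" "\<And>y. f y \<le> h y" "\<And>y. g y \<le> h y" "\<And>y. h y \<le> max (f y) (g y) + e"
proof
  \<comment> \<open>Softplus at scale e: replacing max (g - f) 0 by it costs at most e, and its
    derivative, a logistic value in [0, 1], is the weight of grad g.\<close>
  define h where "h y = f y + e * softplus ((g y - f y) / e)" for y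
  have sm: "smooth f" "smooth g" using assms by (auto simp: Lip_def)
  note d = smooth_differentiable[OF sm(1)] smooth_differentiable[OF sm(2)]
  have "smooth (\<lambda>y. f y + e * softplus ((g y - f y) * inverse e))"
    using sm by (auto intro!: Ck_add Ck_mult Ck_const Ck_softplus Ck_diff)
  then have hs: "smooth h" by (simp add: h_def[abs_def] divide_inverse)
  define s where "s y = logistic ((g y - f y) / e)" for y
  have gh: "grad h y = (1 - s y) *\<^sub>R grad f y + s y *\<^sub>R grad g y" for y
  proof -
    have d': "(\<lambda>y. g y + - f y) differentiable (at y)" using d by auto
    have "((\<lambda>t. e * softplus (t / e)) has_real_derivative s y) (at (g y + - f y))"
      by (rule DERIV_cong[OF DERIV_cmult[OF DERIV_chain2[OF softplus_deriv DERIV_cdivide[OF DERIV_ident]]]])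
        (use assms(3) in \<open>simp add: s_def\<close>)
    from grad_compose[OF this d'] have 1: "grad (\<lambda>y. e * softplus ((g y + - f y) / e)) y = s y *\<^sub>R grad (\<lambda>y. g y + - f y) y" .
    have 2: "grad (\<lambda>y. - f y) y = - grad f y"
      using grad_compose[OF DERIV_minus[OF DERIV_ident] d(1)] by simp
    have 3: "grad (\<lambda>y. g y + - f y) y = grad g y + grad (\<lambda>y. - f y) y" using d by (intro grad_add) auto
    have "smooth (\<lambda>y. e * softplus ((g y - f y) * inverse e))"
      using sm by (auto intro!: Ck_mult Ck_const Ck_softplus Ck_diff)
    then have "(\<lambda>y. e * softplus ((g y + - f y) / e)) differentiable (at y)"
      by (intro smooth_differentiable) (simp add: divide_inverse)
    then have "grad (\<lambda>y. f y + e * softplus ((g y + - f y) / e)) y = grad f y + s y *\<^sub>R (grad g y - grad f y)"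
      by (subst grad_add) (use d 1 2 3 in auto)
    then show ?thesis by (simp add: h_def[abs_def] algebra_simps)
  qed
  have "AE x in lebesgue. grad f x \<bullet> (A x *v grad f x) \<le> 1" "AE x in lebesgue. grad g x \<bullet> (A x *v grad g x) \<le> 1"
    using assms by (auto simp: Lip_def)
  then have "AE x in lebesgue. grad h x \<bullet> (A x *v grad h x) \<le> 1"
    using quadratic_nonneg
  proof eventually_elim
    case (elim x)
    show ?case unfolding gh by (rule quadratic_convex) (use elim in \<open>auto simp: s_def logistic_bounds\<close>)
  qed
  then show "h \<in> Lip" using hs by (simp add: Lip_def)
  fix y
  have "e * softplus ((g y - f y) / e) \<ge> e * 0"
    using softplus_ge assms(3) by (intro mult_left_mono) auto
  then show "f y \<le> h y" by (simp add: h_def)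
  have "e * softplus ((g y - f y) / e) \<ge> e * ((g y - f y) / e)"
    using softplus_ge assms(3) by (intro mult_left_mono) auto
  then show "g y \<le> h y" using assms(3) by (simp add: h_def)
  have "e * softplus ((g y - f y) / e) \<le> e * (max ((g y - f y) / e) 0 + 1)"
    using softplus_le assms(3) by (intro mult_left_mono) auto
  also have "\<dots> = max (g y - f y) 0 + e"
    using assms(3) by (simp add: distrib_left max_mult_distrib_left)
  also have "max (g y - f y) 0 = max (f y) (g y) - f y" by (simp add: max_def)
  finally show "h y \<le> max (f y) (g y) + e" by (simp add: h_def)
qed

text \<open>Half of the tolerance goes to the maximum over F and half to the new smooth maximum, so
  the induction is over all e.\<close>

lemma Lip_finite_max:
  assumes "finite F" "F \<subseteq> Lip" "\<And>f. f \<in> F \<Longrightarrow> f x \<le> 0" "e > 0"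
  shows "\<exists>w\<in>Lip. (\<forall>f\<in>F. \<forall>y. f y \<le> w y) \<and> w x \<le> e"
  using assms
proof (induction F arbitrary: e rule: finite_induct)
  case empty
  have "grad (\<lambda>x. 0) y = 0" for y :: "real^'n" by (simp add: grad_def partial_const vec_eq_iff)
  then have "(\<lambda>x. 0) \<in> Lip" by (simp add: Lip_def Ck_const)
  then show ?case using empty by (intro bexI[of _ "\<lambda>x. 0"]) auto
next
  case (insert f F)
  obtain w where w: "w \<in> Lip" "\<forall>f\<in>F. \<forall>y. f y \<le> w y" "w x \<le> e / 2"
    using insert.IH[of "e / 2"] insert.prems by auto
  obtain h where h: "h \<in> Lip" "\<And>y. f y \<le> h y" "\<And>y. w y \<le> h y" "\<And>y. h y \<le> max (f y) (w y) + e / 2"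
    using Lip_smooth_max[of f w "e / 2"] insert.prems w(1) by auto
  have "f x \<le> 0" using insert.prems by auto
  then have "h x \<le> e" using h(4)[of x] w(3) insert.prems(3) by (auto simp: max_def split: if_splits)
  moreover have "f' y \<le> h y" if "f' \<in> insert f F" for f' y
    using that h(2)[of y] h(3)[of y] w(2) by (metis insertE order_trans)
  ultimately show ?case using h(1) by blast
qed

lemma quadratic_le: "AE x in lebesgue. \<forall>\<xi>. \<xi> \<bullet> (A x *v \<xi>) \<le> \<bar>act_bound\<bar> * (norm \<xi>)\<^sup>2"
  using bounded
proof eventually_elim
  case (elim x)
  show ?case
  proof
    fix \<xi> :: "real^'n"
    have "\<xi> \<bullet> (A x *v \<xi>) = cvec \<xi> 1 \<bullet> act (A x) (cvec \<xi> 1)" by (simp add: inner_act_cvec)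
    also have "\<dots> \<le> norm (cvec \<xi> 1) * norm (act (A x) (cvec \<xi> 1))" by (rule norm_cauchy_schwarz)
    also have "\<dots> \<le> norm (cvec \<xi> 1) * (act_bound * norm (cvec \<xi> 1))"
      using norm_act_le[OF elim, of "cvec \<xi> 1"] by (intro mult_left_mono) (auto simp: act_bound_def)
    also have "\<dots> = act_bound * (norm \<xi>)\<^sup>2" by (simp add: norm_cvec power2_eq_square)
    also have "\<dots> \<le> \<bar>act_bound\<bar> * (norm \<xi>)\<^sup>2" by (intro mult_right_mono) auto
    finally show "\<xi> \<bullet> (A x *v \<xi>) \<le> \<bar>act_bound\<bar> * (norm \<xi>)\<^sup>2" .
  qed
qed

end

lemma norm_square_smooth:
  fixes a :: "real^'n::finite"
  shows "smooth (\<lambda>x. (norm (x - a))\<^sup>2)"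
proof
  fix k
  have "Ck k (\<lambda>x. \<Sum>i\<in>UNIV. (x $ i - a $ i)\<^sup>2)"
    by (intro Ck_sum Ck_power Ck_diff Ck_nth Ck_const)
  moreover have "(norm (x - a))\<^sup>2 = (\<Sum>i\<in>UNIV. (x $ i - a $ i)\<^sup>2)" for x
    by (simp add: norm_vec_def L2_set_def sum_nonneg)
  ultimately show "Ck k (\<lambda>x. (norm (x - a))\<^sup>2)" by simp
qed

lemma grad_norm_square:
  fixes a :: "real^'n::finite"
  shows "grad (\<lambda>x. (norm (x - a))\<^sup>2) x = 2 *\<^sub>R (x - a)"
proof -
  have "((\<lambda>x. (x - a) \<bullet> (x - a)) has_derivative (\<lambda>h. 2 * ((x - a) \<bullet> h))) (at x)"
    by (auto intro!: derivative_eq_intros simp: inner_commute)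
  from partial_eqI[OF this] show ?thesis
    by (simp add: grad_def vec_eq_iff power2_norm_eq_inner inner_axis)
qed

text \<open>Controls the profile near infinity, where the compactness argument of
  \<open>cutoff_exists\<close> gives nothing; this makes the support of step w compact. The squared
  norm keeps f smooth at \<open>x0\<close>.\<close>

lemma (in elliptic) Lip_coercive:
  obtains f R where "f \<in> Lip" "f x0 = 0" "R > 0" "\<And>y. norm (y - x0) \<ge> R \<Longrightarrow> f y = 1"
proof -
  \<comment> \<open>The Euclidean slope of f is at most 2 step_lip / R, so its energy is at most (2
    step_lip sqrt |act_bound| / R)^2, which is below 1 for this R; the summand 1 keeps R
    positive.\<close>
  define R where "R = 2 * step_lip * sqrt \<bar>act_bound\<bar> + 1"
  have R: "R \<ge> 1" using step_lip_pos by (simp add: R_def)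
  then have R_pos: "R > 0" by simp
  define f where "f y = 1 - step ((norm (y - x0))\<^sup>2 / R\<^sup>2)" for y
  have f0: "f x0 = 0" using step_eq_1[of 0] by (simp add: f_def)
  have f1: "f y = 1" if "norm (y - x0) \<ge> R" for y
  proof -
    have "R\<^sup>2 \<le> (norm (y - x0))\<^sup>2" using that R by (intro power_mono) auto
    then have "(norm (y - x0))\<^sup>2 / R\<^sup>2 \<ge> 1" using R by (simp add: le_divide_eq)
    then have "step ((norm (y - x0))\<^sup>2 / R\<^sup>2) = 0" by (intro step_eq_0) linarith
    then show ?thesis by (simp add: f_def)
  qed
  have "smooth (\<lambda>y. 1 - step ((norm (y - x0))\<^sup>2 * inverse (R\<^sup>2)))"
    by (intro allI Ck_diff Ck_const Ck_step Ck_mult norm_square_smooth[rule_format])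
  then have sm: "smooth f" by (simp add: f_def[abs_def] divide_inverse)
  have gf: "grad f y = (- step' ((norm (y - x0))\<^sup>2 / R\<^sup>2) / R\<^sup>2) *\<^sub>R 2 *\<^sub>R (y - x0)" for y
    unfolding f_def grad_norm_square[symmetric]
    by (rule grad_compose[where f = "\<lambda>t. 1 - step (t / R\<^sup>2)", OF _ smooth_differentiable[OF norm_square_smooth]],
        rule DERIV_cong[OF DERIV_diff[OF DERIV_const DERIV_chain2[OF step_deriv DERIV_cdivide[OF DERIV_ident]]]])
      simp
  have ng: "norm (grad f y) \<le> 2 * step_lip / R" for y
  proof (cases "norm (y - x0) \<le> R")
    case True
    have "norm (grad f y) = 2 * (\<bar>step' ((norm (y - x0))\<^sup>2 / R\<^sup>2)\<bar> * norm (y - x0)) / R\<^sup>2"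
      unfolding gf by (simp add: abs_mult)
    also have "\<dots> \<le> 2 * (step_lip * R) / R\<^sup>2"
      using True step_lip_pos step'_bound by (intro divide_right_mono mult_left_mono mult_mono) auto
    also have "\<dots> = 2 * step_lip / R" using R by (simp add: power2_eq_square)
    finally show ?thesis .
  next
    case False
    then have "R\<^sup>2 \<le> (norm (y - x0))\<^sup>2" using R by (intro power_mono) auto
    then have "(norm (y - x0))\<^sup>2 / R\<^sup>2 \<ge> 1" using R by (simp add: le_divide_eq)
    then have "step' ((norm (y - x0))\<^sup>2 / R\<^sup>2) = 0" by (intro step'_eq_0 disjI2) linarith
    then show ?thesis unfolding gf using R step_lip_pos by simp
  qed
  have "AE x in lebesgue. grad f x \<bullet> (A x *v grad f x) \<le> 1"
    using quadratic_le
  proof eventually_elim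
    case (elim x)
    then have "grad f x \<bullet> (A x *v grad f x) \<le> \<bar>act_bound\<bar> * (norm (grad f x))\<^sup>2" by blast
    also have "\<dots> \<le> \<bar>act_bound\<bar> * (2 * step_lip / R)\<^sup>2"
      using ng by (intro mult_left_mono power_mono) auto
    also have "\<dots> = (2 * step_lip * sqrt \<bar>act_bound\<bar> / R)\<^sup>2"
      by (simp add: power_mult_distrib power_divide)
    also have "\<dots> \<le> 1\<^sup>2"
    proof (rule power_mono)
      show "2 * step_lip * sqrt \<bar>act_bound\<bar> / R \<le> 1" using R by (simp add: divide_le_eq) (simp add: R_def)
      show "0 \<le> 2 * step_lip * sqrt \<bar>act_bound\<bar> / R" using R step_lip_pos by simp
    qed
    finally show ?case by simp
  qed
  then have "f \<in> Lip" using sm by (simp add: Lip_def)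
  then show ?thesis using that f0 R_pos f1 by blast
qed

text \<open>Each point outside the ball is separated from \<open>x0\<close> by its own member of
  \<open>dist_class\<close>. Subtracting the value at \<open>x0\<close>, choosing the sign and
  dividing by r turns it into a member of \<open>Lip\<close> vanishing at \<open>x0\<close>.
  Compactness leaves finitely many of them, and the smooth maximum merges these with the coercive
  function into one profile.\<close>

lemma cutoff_exists:
  fixes C :: "real^'n::finite \<Rightarrow> real^'n^'n"
  assumes ell: "elliptic (\<lambda>x. r\<^sup>2 *\<^sub>R C x) \<mu> \<Lambda>" and r: "r > 0" and op: "open (ball_C C x0 r)"
  obtains w where "smooth w" "AE x in lebesgue. grad w x \<bullet> ((r\<^sup>2 *\<^sub>R C x) *v grad w x) \<le> 1"
    "(\<lambda>x. step (w x)) \<in> test_functions" "\<And>x. x \<notin> ball_C C x0 r \<Longrightarrow> w x \<ge> 2/3" "w x0 < 1/6"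
proof -
  interpret elliptic "\<lambda>x. r\<^sup>2 *\<^sub>R C x" \<mu> \<Lambda> by (rule ell)
  obtain f0 R where f0: "f0 \<in> Lip" "f0 x0 = 0" "R > 0" "\<And>y. norm (y - x0) \<ge> R \<Longrightarrow> f0 y = 1"
    using Lip_coercive by blast
  define F where "F = {f \<in> Lip. f x0 = 0}"
  have scaled: "(\<lambda>y. c * (\<psi> y - \<psi> x0) / r) \<in> F" if \<psi>: "\<psi> \<in> dist_class C" and c: "c = 1 \<or> c = -1" for \<psi> c
  proof -
    have sm: "smooth \<psi>" using \<psi> by (simp add: dist_class_def test_functions_def)
    have "smooth (\<lambda>y. c * (\<psi> y - \<psi> x0) * inverse r)"
      using sm by (intro allI Ck_mult Ck_diff Ck_const) auto
    then have 1: "smooth (\<lambda>y. c * (\<psi> y - \<psi> x0) / r)" by (simp add: divide_inverse)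
    have g: "grad (\<lambda>y. c * (\<psi> y - \<psi> x0) / r) y = (c / r) *\<^sub>R grad \<psi> y" for y
      by (rule grad_compose[where f = "\<lambda>t. c * (t - \<psi> x0) / r", OF _ smooth_differentiable[OF sm]])
        (use r in \<open>auto intro!: derivative_eq_intros\<close>)
    have "AE y in lebesgue. ((c / r) *\<^sub>R grad \<psi> y) \<bullet> ((r\<^sup>2 *\<^sub>R C y) *v ((c / r) *\<^sub>R grad \<psi> y)) \<le> 1"
      using dist_class_energy[OF \<psi>]
    proof eventually_elim
      case (elim y)
      have "((c / r) *\<^sub>R grad \<psi> y) \<bullet> ((r\<^sup>2 *\<^sub>R C y) *v ((c / r) *\<^sub>R grad \<psi> y))
          = (c / r)\<^sup>2 * (r\<^sup>2 * (grad \<psi> y \<bullet> (C y *v grad \<psi> y)))"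
        unfolding quadratic_scaleR by (simp add: scaleR_matrix_vector_assoc[symmetric])
      also have "\<dots> = grad \<psi> y \<bullet> (C y *v grad \<psi> y)" using r c by (auto simp: field_simps)
      finally show ?case using elim by simp
    qed
    then show ?thesis using 1 by (simp add: F_def Lip_def g)
  qed
  define S where "S = cball x0 R - ball_C C x0 r"
  have "compact S" unfolding S_def by (intro compact_diff compact_cball op)
  moreover have "open {y. 9/10 < f y}" if "f \<in> F" for f
  proof -
    have "continuous_on UNIV f" using that Ck_continuous[of 0 f] by (simp add: F_def Lip_def)
    then show ?thesis by (intro open_Collect_less) auto
  qed
  moreover have "S \<subseteq> (\<Union>f\<in>F. {y. 9/10 < f y})"
  proof
    fix y assume "y \<in> S"
    then have "ennreal r \<le> dist_C C x0 y" by (simp add: S_def ball_C_def not_less)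
    \<comment> \<open>Any fraction strictly between 2/3 and 1 would do: below 1 because the supremum
      need not be attained, above 2/3 to reach the zero set of \<open>step\<close>.\<close>
    moreover have "ennreal (9/10 * r) < ennreal r" using r by (simp add: ennreal_less_iff)
    ultimately have "ennreal (9/10 * r) < dist_C C x0 y" by (rule less_le_trans[rotated])
    then obtain \<psi> where \<psi>: "\<psi> \<in> dist_class C" "ennreal (9/10 * r) < ennreal \<bar>\<psi> x0 - \<psi> y\<bar>"
      unfolding dist_C_def less_SUP_iff by blast
    then have big: "9/10 * r < \<bar>\<psi> x0 - \<psi> y\<bar>" using r by (simp add: ennreal_less_iff)
    show "y \<in> (\<Union>f\<in>F. {y. 9/10 < f y})"
    proof (cases "\<psi> y \<ge> \<psi> x0")
      case True
      then have "9/10 < 1 * (\<psi> y - \<psi> x0) / r" using big r by (simp add: field_simps)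
      then show ?thesis using scaled[OF \<psi>(1), of 1] by blast
    next
      case False
      then have "9/10 < -1 * (\<psi> y - \<psi> x0) / r" using big r by (simp add: field_simps)
      then show ?thesis using scaled[OF \<psi>(1), of "-1"] by blast
    qed
  qed
  ultimately obtain F' where F': "F' \<subseteq> F" "finite F'" "S \<subseteq> (\<Union>f\<in>F'. {y. 9/10 < f y})"
    by (rule compactE_image)
  \<comment> \<open>The tolerance 1/12 stays strictly below 1/6, so by continuity a whole
    neighbourhood of \<open>x0\<close> is left for the support of the source.\<close>
  obtain w where w: "w \<in> Lip" "\<forall>f\<in>insert f0 F'. \<forall>y. f y \<le> w y" "w x0 \<le> 1/12"
  proof -
    have F0: "f \<in> Lip" "f x0 \<le> 0" if "f \<in> insert f0 F'" for f using that F'(1) f0 by (auto simp: F_def)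
    have "\<exists>w\<in>Lip. (\<forall>f\<in>insert f0 F'. \<forall>y. f y \<le> w y) \<and> w x0 \<le> 1/12"
    proof (rule Lip_finite_max)
      show "insert f0 F' \<subseteq> Lip" using F0(1) by (rule subsetI)
    qed (use F'(2) F0(2) in simp_all)
    then show ?thesis using that by blast
  qed
  have far: "w y \<ge> 1" if "norm (y - x0) \<ge> R" for y
    using w(2) f0(4)[OF that] by (metis insertI1)
  show ?thesis
  proof (rule that)
    show sm: "smooth w" using w(1) by (simp add: Lip_def)
    show "AE x in lebesgue. grad w x \<bullet> ((r\<^sup>2 *\<^sub>R C x) *v grad w x) \<le> 1" using w(1) by (simp add: Lip_def)
    show "(\<lambda>x. step (w x)) \<in> test_functions"
    proof (rule test_functionI)
      show "smooth (\<lambda>x. step (w x))" using sm by (simp add: Ck_step)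
      show "step (w x) = 0" if "norm x > R + norm x0" for x
        using far[of x] that norm_triangle_ineq2[of x x0] by (intro step_eq_0) linarith
    qed
    show "w x \<ge> 2/3" if "x \<notin> ball_C C x0 r" for x
    proof (cases "norm (x - x0) \<ge> R")
      case True
      then show ?thesis using far[of x] by simp
    next
      case False
      then have "x \<in> S" using that by (simp add: S_def dist_norm norm_minus_commute)
      then obtain f where "f \<in> F'" "9/10 < f x" using F'(3) by blast
      moreover from this have "f x \<le> w x" using w(2) by blast
      ultimately show ?thesis by linarith
    qed
    show "w x0 < 1/6" using w(3) by simp
  qed
qed

section \<open>The kernel on the diagonal\<close>

lemma approximate_delta:
  fixes x0 :: "real^'n::finite"
  assumes "\<delta> > 0"
  obtains \<psi> :: "real^'n \<Rightarrow> real" where "\<psi> \<in> test_functions" "\<And>x. \<psi> x \<ge> 0"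
    "(\<integral>x. \<psi> x \<partial>lebesgue) = 1" "\<And>x. norm (x - x0) \<ge> \<delta> \<Longrightarrow> \<psi> x = 0"
proof -
  define f where "f x = step ((norm (x - x0))\<^sup>2 * inverse (\<delta>\<^sup>2))" for x :: "real^'n"
  have far: "f x = 0" if "norm (x - x0) \<ge> \<delta>" for x
  proof -
    have "\<delta>\<^sup>2 \<le> (norm (x - x0))\<^sup>2" using that assms by (intro power_mono) auto
    then have "(norm (x - x0))\<^sup>2 * inverse (\<delta>\<^sup>2) \<ge> 1" using assms by (simp add: field_simps)
    then show ?thesis unfolding f_def by (intro step_eq_0) linarith
  qed
  have near: "f x = 1" if "x \<in> ball x0 (\<delta> / 2)" for x
  proof -
    have "(norm (x - x0))\<^sup>2 \<le> (\<delta> / 2)\<^sup>2"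
      using that by (intro power_mono) (auto simp: dist_norm norm_minus_commute)
    then have "(norm (x - x0))\<^sup>2 * inverse (\<delta>\<^sup>2) \<le> 1/4" using assms by (simp add: field_simps power2_eq_square)
    then show ?thesis unfolding f_def by (intro step_eq_1) linarith
  qed
  have nn: "f x \<ge> 0" for x by (simp add: f_def step_bounds)
  have sm: "smooth f" unfolding f_def[abs_def]
    by (intro allI Ck_step Ck_mult Ck_const norm_square_smooth[rule_format])
  have t: "f \<in> test_functions"
  proof (rule test_functionI[OF sm])
    show "f x = 0" if "norm x > \<delta> + norm x0" for x
      using that norm_triangle_ineq2[of x x0] by (intro far) linarith
  qed
  have int: "integrable lebesgue f" by (rule test_function_integrable[OF t])
  define c where "c = (\<integral>x. f x \<partial>lebesgue)"
  have "0 < measure lebesgue (ball x0 (\<delta> / 2))"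
    using assms content_ball_pos by auto
  also have "\<dots> = (\<integral>x. indicator (ball x0 (\<delta> / 2)) x \<partial>lebesgue)" by simp
  also have "\<dots> \<le> c" unfolding c_def
  proof (rule integral_mono)
    show "integrable lebesgue (indicator (ball x0 (\<delta> / 2)) :: _ \<Rightarrow> real)"
      using emeasure_lborel_ball_finite[of x0 "\<delta> / 2"] by (intro integrable_real_indicator) auto
    show "indicator (ball x0 (\<delta> / 2)) x \<le> f x" for x
      using near[of x] nn[of x] by (simp add: indicator_def)
  qed (rule int)
  finally have c: "c > 0" .
  show ?thesis
  proof (rule that)
    show "(\<lambda>x. inverse c *\<^sub>R f x) \<in> test_functions"
      by (rule test_function_scaleR[OF _ t]) (simp add: Ck_const)
    show "inverse c *\<^sub>R f x \<ge> 0" for x using nn[of x] c by simp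
    show "(\<integral>x. inverse c *\<^sub>R f x \<partial>lebesgue) = 1" using c by (simp add: c_def[symmetric])
    show "inverse c *\<^sub>R f x = 0" if "norm (x - x0) \<ge> \<delta>" for x using far[OF that] by simp
  qed
qed

text \<open>Since \<psi> has integral 1, the constant kernel k has double average k. Subtracting it
  leaves an integrand bounded by e \<psi>(x) \<psi>(y), because \<psi> vanishes wherever K might be
  far from k.\<close>

lemma kernel_average:
  fixes K :: "real^'n::finite \<Rightarrow> real^'n \<Rightarrow> complex" and \<psi> :: "real^'n \<Rightarrow> real"
  assumes K: "continuous_on UNIV (\<lambda>(x, y). K x y)"
    and near: "\<And>x y. norm (x - x0) < \<delta> \<Longrightarrow> norm (y - x0) < \<delta> \<Longrightarrow> norm (K x y - k) \<le> e"
    and \<psi>: "\<psi> \<in> test_functions" "\<And>x. \<psi> x \<ge> 0" "(\<integral>x. \<psi> x \<partial>lebesgue) = 1"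
      "\<And>x. norm (x - x0) \<ge> \<delta> \<Longrightarrow> \<psi> x = 0"
  shows "norm ((\<integral>x. (\<integral>y. complex_of_real (\<psi> x) * K x y * complex_of_real (\<psi> y) \<partial>lebesgue) \<partial>lebesgue) - k) \<le> e"
proof -
  let ?F = "\<lambda>x y. complex_of_real (\<psi> x) * K x y * complex_of_real (\<psi> y)"
  let ?k = "\<lambda>x y. complex_of_real (\<psi> x) * k * complex_of_real (\<psi> y)"
  have \<psi>c: "continuous_on UNIV \<psi>" using Ck_continuous test_function_smooth[OF \<psi>(1)] by blast
  have \<psi>i: "integrable lebesgue \<psi>" by (rule test_function_integrable[OF \<psi>(1)])
  have \<psi>i': "integrable lebesgue (\<lambda>x. complex_of_real (\<psi> x))"
    by (intro test_function_integrable test_function_of_real \<psi>)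
  obtain R where R: "\<And>x. norm x > R \<Longrightarrow> \<psi> x = 0" using test_function_support[OF \<psi>(1)] by blast
  define I where "I x = (\<integral>y. ?F x y \<partial>lebesgue)" for x
  have e: "e \<ge> 0" if "\<psi> x \<noteq> 0" for x
  proof -
    have "norm (x - x0) < \<delta>" using \<psi>(4)[of x] that by force
    then show ?thesis using near[of x x] norm_ge_zero order_trans by blast
  qed
  have Kx: "continuous_on UNIV (\<lambda>y. K x y)" for x
  proof -
    have "continuous_on UNIV (\<lambda>y. (x, y))" by (intro continuous_intros)
    from continuous_on_compose2[OF K this] show ?thesis by simp
  qed
  have ci: "integrable lebesgue (\<lambda>y. ?F x y)" for x
    by (rule integrable_continuous_support(1)[of _ R])
      (use R \<psi>c Kx in \<open>auto intro!: continuous_intros\<close>)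
  have I_near: "norm (I x - complex_of_real (\<psi> x) * k) \<le> e * \<psi> x" for x
  proof (cases "\<psi> x = 0")
    case False
    have x: "norm (x - x0) < \<delta>" using \<psi>(4)[of x] False by force
    have "(\<integral>y. ?k x y \<partial>lebesgue) = complex_of_real (\<psi> x) * k"
      using \<psi>(3) by simp
    then have "I x - complex_of_real (\<psi> x) * k
        = (\<integral>y. ?F x y - ?k x y \<partial>lebesgue)"
      unfolding I_def using ci[of x] \<psi>i' by (subst Bochner_Integration.integral_diff) auto
    also have "norm \<dots> \<le> (\<integral>y. norm (?F x y - ?k x y) \<partial>lebesgue)"
      by (rule integral_norm_bound)
    also have "\<dots> \<le> (\<integral>y. e * \<psi> x * \<psi> y \<partial>lebesgue)"
    proof (rule integral_mono)
      show "integrable lebesgue (\<lambda>y. norm (?F x y - ?k x y))"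
        using ci[of x] \<psi>i' by (intro integrable_norm Bochner_Integration.integrable_diff) auto
      show "integrable lebesgue (\<lambda>y. e * \<psi> x * \<psi> y)" using \<psi>i by simp
      fix y
      have "?F x y - ?k x y
          = complex_of_real (\<psi> x * \<psi> y) * (K x y - k)" by (simp add: algebra_simps)
      then have eq: "norm (?F x y - ?k x y) = \<psi> x * \<psi> y * norm (K x y - k)"
        using \<psi>(2) by (simp add: norm_mult abs_mult)
      show "norm (?F x y - ?k x y) \<le> e * \<psi> x * \<psi> y"
      proof (cases "\<psi> y = 0")
        case False
        then have "norm (y - x0) < \<delta>" using \<psi>(4)[of y] by force
        then have "\<psi> x * \<psi> y * norm (K x y - k) \<le> \<psi> x * \<psi> y * e"
          using near[OF x] \<psi>(2) by (intro mult_left_mono) auto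
        then show ?thesis unfolding eq by (simp add: mult_ac)
      qed simp
    qed
    also have "\<dots> = e * \<psi> x" using \<psi>(3) by simp
    finally show ?thesis .
  qed (simp add: I_def)
  \<comment> \<open>Measurability in the parameter is available on the Borel product; for each x the
    integrand is continuous, so its Borel and Lebesgue integrals coincide.\<close>
  have "I \<in> borel_measurable lborel"
  proof -
    have "continuous_on UNIV (\<lambda>(x, y). ?F x y)"
      unfolding split_beta using K[unfolded split_beta]
      by (intro continuous_intros continuous_on_compose2[OF \<psi>c]) auto
    then have [measurable]: "(\<lambda>(x, y). ?F x y)
        \<in> borel_measurable (lborel \<Otimes>\<^sub>M lborel)"
      by (simp add: borel_measurable_continuous_onI lborel_prod)
    have "(\<lambda>x. \<integral>y. ?F x y \<partial>lborel) \<in> borel_measurable lborel"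
      by (rule lborel.borel_measurable_lebesgue_integral) measurable
    moreover have "I = (\<lambda>x. \<integral>y. ?F x y \<partial>lborel)"
      unfolding I_def[abs_def] using \<psi>c Kx
      by (intro ext integral_completion) (auto intro!: borel_measurable_continuous_onI continuous_intros)
    ultimately show ?thesis by simp
  qed
  then have I_meas: "I \<in> borel_measurable lebesgue" by (rule measurable_completion)
  have d: "integrable lebesgue (\<lambda>x. I x - complex_of_real (\<psi> x) * k)"
  proof (rule Bochner_Integration.integrable_bound)
    show "integrable lebesgue (\<lambda>x. e * \<psi> x)" using \<psi>i by simp
    show "(\<lambda>x. I x - complex_of_real (\<psi> x) * k) \<in> borel_measurable lebesgue"
      using I_meas borel_measurable_integrable[OF \<psi>i'] by (intro borel_measurable_diff borel_measurable_times) auto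
    show "AE x in lebesgue. norm (I x - complex_of_real (\<psi> x) * k) \<le> norm (e * \<psi> x)"
      using I_near by (auto intro: order_trans[OF _ abs_ge_self])
  qed
  have "(\<integral>x. I x \<partial>lebesgue) = (\<integral>x. (I x - complex_of_real (\<psi> x) * k) + complex_of_real (\<psi> x) * k \<partial>lebesgue)" by simp
  also have "\<dots> = (\<integral>x. I x - complex_of_real (\<psi> x) * k \<partial>lebesgue) + k"
    using d \<psi>i' \<psi>(3) by (subst Bochner_Integration.integral_add) auto
  finally have "norm ((\<integral>x. I x \<partial>lebesgue) - k) = norm (\<integral>x. I x - complex_of_real (\<psi> x) * k \<partial>lebesgue)" by simp
  also have "\<dots> \<le> (\<integral>x. norm (I x - complex_of_real (\<psi> x) * k) \<partial>lebesgue)" by (rule integral_norm_bound)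
  also have "\<dots> \<le> (\<integral>x. e * \<psi> x \<partial>lebesgue)"
    using I_near \<psi>i d by (intro integral_mono integrable_norm) auto
  also have "\<dots> = e" using \<psi>(3) by simp
  finally show ?thesis by (simp add: I_def)
qed

section \<open>Chains of resolvents and their symmetry\<close>

context elliptic
begin

lemma sol_chain_exists:
  assumes "f \<in> sqint"
  obtains u G where "u 0 = f" "\<And>j::nat. sol (u (Suc j)) (G (Suc j)) (u j)"
proof -
  define S where "S f = (SOME p. sol (fst p) (snd p) f)" for f
  have S: "sol (fst (S f)) (snd (S f)) f" if f: "f \<in> sqint" for f
  proof -
    obtain u G where "sol u G f" using sol_exists[OF f] by blast
    then have "sol (fst (u, G)) (snd (u, G)) f" by simp
    then show ?thesis unfolding S_def by (rule someI)
  qed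
  define u where "u j = ((\<lambda>f. fst (S f)) ^^ j) f" for j
  \<comment> \<open>The shift by one pairs \<open>G j\<close> with \<open>u j\<close> for j \<ge>
    1.\<close>
  define G where "G j = snd (S (u (j - 1)))" for j
  have sq: "u j \<in> sqint" for j
  proof (induction j)
    case (Suc j)
    then show ?case using sol_sqint(1)[OF S] by (simp add: u_def)
  qed (simp add: u_def assms)
  show ?thesis
  proof (rule that)
    show "u 0 = f" by (simp add: u_def)
    show "sol (u (Suc j)) (G (Suc j)) (u j)" for j
      using S[OF sq[of j]] by (simp add: u_def G_def)
  qed
qed

text \<open>Self-adjointness of the resolvent: each of the two equations is tested with the other
  solution, and the symmetry of \<open>ip\<close> and \<open>Q\<close> equates the results.
  Iterating moves resolvents from one factor to the other.\<close>

lemma sol_chain_shift: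
  assumes s: "\<And>j. sol (u (Suc j)) (G (Suc j)) (u j)"
  shows "ip (u (Suc j)) (u k) = ip (u j) (u (Suc k))"
proof -
  have w: "wgrad (u (Suc j)) (G (Suc j))" for j using s[of j] by (simp add: sol_def)
  have "ip (u (Suc j)) (u k) = ip (u (Suc j)) (u (Suc k)) + Q (G (Suc j)) (G (Suc k))"
    using sol_eq[OF s w] by simp
  also have "\<dots> = ip (u (Suc k)) (u (Suc j)) + Q (G (Suc k)) (G (Suc j))"
    by (simp add: ip_commute[of "u (Suc k)"] Q_commute[OF wgrad_sqint(2)[OF w] wgrad_sqint(2)[OF w], of k])
  also have "\<dots> = ip (u j) (u (Suc k))" using sol_eq[OF s[of j] w[of k]] by (simp add: ip_commute)
  finally show ?thesis .
qed

lemma sol_chain_norm: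
  assumes s: "\<And>j. sol (u (Suc j)) (G (Suc j)) (u j)"
  shows "ip (u m) (u m) = ip (u 0) (u (2 * m))"
proof -
  have "ip (u m) (u m) = ip (u (m - j)) (u (m + j))" if "j \<le> m" for j
    using that
  proof (induction j)
    case (Suc j)
    then show ?case using sol_chain_shift[where u = u and G = G, OF s, of "m - Suc j" "m + j"] by (simp add: Suc_diff_Suc)
  qed simp
  from this[of m] show ?thesis by (simp add: mult_2)
qed

lemma sol_scaleR:
  assumes "sol u G f"
  shows "sol (\<lambda>x. c *\<^sub>R u x) (\<lambda>x. c *\<^sub>R G x) (\<lambda>x. c *\<^sub>R f x)"
proof -
  have "c * ip v u + c * Q H G = c * ip v f" if "wgrad v H" for v H
    using sol_eq[OF assms that] by (metis distrib_left)
  then show ?thesis using assms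
    by (auto simp: sol_def ip_scaleR_right Q_scaleR_right intro: wgrad_scaleR sqint_scaleR)
qed

end

section \<open>Resolvent powers, their norm and their kernel\<close>

lemma resolvent_power_of_sol_chain:
  fixes C :: "real^'n::finite \<Rightarrow> real^'n^'n"
  assumes ell: "elliptic (\<lambda>x. r\<^sup>2 *\<^sub>R C x) \<mu> \<Lambda>" and r: "r > 0"
    and s: "\<And>j. elliptic.sol (\<lambda>x. r\<^sup>2 *\<^sub>R C x) (u (Suc j)) (G (Suc j)) (u j)"
  shows "(u j, u (j + k)) \<in> resolvent_power C r k"
  unfolding resolvent_power_def relpow_fun_conv
  by (rule exI[of _ "\<lambda>i. u (j + i)"]) (use resolvent_of_sol[OF ell s r] in auto)

lemma strongly_elliptic_elliptic:
  fixes C :: "real^'n::finite \<Rightarrow> real^'n^'n"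
  assumes C: "strongly_elliptic C" and r: "r > 0"
  obtains \<mu> \<Lambda> where "elliptic (\<lambda>x. r\<^sup>2 *\<^sub>R C x) \<mu> \<Lambda>"
    "AE x in lebesgue. \<forall>\<xi>. \<mu> / r\<^sup>2 * (\<xi> \<bullet> \<xi>) \<le> \<xi> \<bullet> (C x *v \<xi>)" "\<mu> > 0"
proof -
  obtain \<nu> where \<nu>: "\<nu> > 0" "AE x in lebesgue. \<forall>\<xi>. \<nu> * (\<xi> \<bullet> \<xi>) \<le> \<xi> \<bullet> (C x *v \<xi>)"
    using C by (auto simp: strongly_elliptic_def)
  have "\<exists>L. AE x in lebesgue. \<bar>C x $ i $ j\<bar> \<le> L" for i j
  proof -
    let ?l = "Linf_norm (\<lambda>x. C x $ i $ j)"
    have "?l < \<infinity>" using C by (simp add: strongly_elliptic_def)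
    then obtain L where L: "?l = ennreal L" "L \<ge> 0" by (cases ?l) auto
    have "AE x in lebesgue. ennreal (norm (C x $ i $ j)) \<le> ?l"
      unfolding Linf_norm_def by (rule esssup_AE)
    then have "AE x in lebesgue. \<bar>C x $ i $ j\<bar> \<le> L"
      by eventually_elim (simp add: L)
    then show ?thesis by blast
  qed
  then obtain L where L: "\<And>i j. AE x in lebesgue. \<bar>C x $ i $ j\<bar> \<le> L i j" by metis
  define \<Lambda> where "\<Lambda> = r\<^sup>2 * (\<Sum>i\<in>UNIV. \<Sum>j\<in>UNIV. \<bar>L i j\<bar>)"
  have L_le: "\<bar>L i j\<bar> \<le> (\<Sum>i\<in>UNIV. \<Sum>j\<in>UNIV. \<bar>L i j\<bar>)" for i j
  proof -
    have "\<bar>L i j\<bar> \<le> (\<Sum>j\<in>UNIV. \<bar>L i j\<bar>)" by (rule member_le_sum) auto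
    also have "\<dots> \<le> (\<Sum>i\<in>UNIV. \<Sum>j\<in>UNIV. \<bar>L i j\<bar>)"
      by (rule member_le_sum[of i UNIV "\<lambda>i. \<Sum>j\<in>UNIV. \<bar>L i j\<bar>"]) (auto intro: sum_nonneg)
    finally show ?thesis .
  qed
  have "elliptic (\<lambda>x. r\<^sup>2 *\<^sub>R C x) (r\<^sup>2 * \<nu>) \<Lambda>"
  proof
    show "(\<lambda>x. (r\<^sup>2 *\<^sub>R C x) $ i $ j) \<in> borel_measurable lebesgue" for i j
      using C by (auto simp: strongly_elliptic_def intro: borel_measurable_times)
    have "AE x in lebesgue. \<forall>i j. \<bar>C x $ i $ j\<bar> \<le> L i j" using L by (simp add: AE_all_countable)
    then show "AE x in lebesgue. \<forall>i j. \<bar>(r\<^sup>2 *\<^sub>R C x) $ i $ j\<bar> \<le> \<Lambda>"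
    proof eventually_elim
      case (elim x)
      have "\<bar>C x $ i $ j\<bar> \<le> (\<Sum>i\<in>UNIV. \<Sum>j\<in>UNIV. \<bar>L i j\<bar>)" for i j
        using elim[rule_format, of i j] L_le[of i j] by linarith
      then show ?case by (simp add: \<Lambda>_def abs_mult mult_left_mono)
    qed
    have "AE x in lebesgue. transpose (C x) = C x" using C by (simp add: strongly_elliptic_def)
    then show "AE x in lebesgue. transpose (r\<^sup>2 *\<^sub>R C x) = r\<^sup>2 *\<^sub>R C x"
      by eventually_elim (simp add: transpose_def vec_eq_iff)
    show "AE x in lebesgue. \<forall>\<xi>. r\<^sup>2 * \<nu> * (\<xi> \<bullet> \<xi>) \<le> \<xi> \<bullet> ((r\<^sup>2 *\<^sub>R C x) *v \<xi>)"
      using \<nu>(2) by eventually_elim (simp add: scaleR_matrix_vector_assoc[symmetric] mult.assoc mult_left_mono)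
    show "r\<^sup>2 * \<nu> > 0" using \<nu>(1) r by simp
  qed
  then show ?thesis using that[of "r\<^sup>2 * \<nu>" \<Lambda>] \<nu> r by simp
qed

text \<open>Let c be the norm of \<open>u m\<close>. Dividing by c puts (\<open>u m\<close>,
  \<open>u (2 * m)\<close>) into the graph with a unit argument, so |\<open>u (2 * m)\<close>| \<le>
  n c almost everywhere. Pairing with the source, nonnegative of integral 1, gives c^2 \<le> n
  c.\<close>

lemma norm_le_norm_2_inf:
  fixes C :: "real^'n::finite \<Rightarrow> real^'n^'n"
  assumes ell: "elliptic (\<lambda>x. r\<^sup>2 *\<^sub>R C x) \<mu> \<Lambda>" and r: "r > 0"
    and s: "\<And>j. elliptic.sol (\<lambda>x. r\<^sup>2 *\<^sub>R C x) (u (Suc j)) (G (Suc j)) (u j)"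
    and u0: "u 0 = (\<lambda>x. complex_of_real (\<psi> x))"
    and \<psi>: "\<psi> \<in> test_functions" "\<And>x. \<psi> x \<ge> 0" "(\<integral>x. \<psi> x \<partial>lebesgue) = 1"
    and N: "norm_2_inf (resolvent_power C r m) = ennreal n" "n \<ge> 0"
  shows "ip (u m) (u m) \<le> n\<^sup>2"
proof (cases "ip (u m) (u m) = 0")
  case False
  interpret elliptic "\<lambda>x. r\<^sup>2 *\<^sub>R C x" \<mu> \<Lambda> by (rule ell)
  define c where "c = sqrt (ip (u m) (u m))"
  have c: "c > 0" "c\<^sup>2 = ip (u m) (u m)"
    using False ip_nonneg[of "u m"] by (auto simp: c_def)
  define v where "v j x = inverse c *\<^sub>R u j x" for j x
  have "sol (v (Suc j)) (\<lambda>x. inverse c *\<^sub>R G (Suc j) x) (v j)" for j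
    unfolding v_def[abs_def] by (rule sol_scaleR[OF s])
  from resolvent_power_of_sol_chain[OF ell r, of v "\<lambda>j x. inverse c *\<^sub>R G j x", OF this, of m m]
  have mem: "(v m, v (2 * m)) \<in> resolvent_power C r m" by (simp add: mult_2)
  have "L2_norm (v m) = sqrt (ip (v m) (v m))" by (simp add: L2_norm_def ip_self)
  also have "ip (v m) (v m) = (inverse c)\<^sup>2 * c\<^sup>2"
    unfolding v_def[abs_def] ip_scaleR_left ip_scaleR_right c(2) by (simp add: power2_eq_square)
  finally have "L2_norm (v m) \<le> 1" using c(1) by (simp add: power_mult_distrib[symmetric])
  then have "Linf_norm (v (2 * m)) \<le> norm_2_inf (resolvent_power C r m)"
    unfolding norm_2_inf_def using mem by (intro SUP_upper2[of "(v m, v (2 * m))"]) auto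
  then have Linf: "Linf_norm (v (2 * m)) \<le> ennreal n" by (simp add: N)
  have "AE x in lebesgue. ennreal (norm (v (2 * m) x)) \<le> Linf_norm (v (2 * m))"
    unfolding Linf_norm_def by (rule esssup_AE)
  then have bound: "AE x in lebesgue. norm (u (2 * m) x) \<le> n * c"
  proof eventually_elim
    case (elim x)
    then have "ennreal (norm (v (2 * m) x)) \<le> ennreal n" using Linf by (rule order_trans)
    then have "norm (v (2 * m) x) \<le> n" using N(2) by simp
    then show ?case using c(1) by (simp add: v_def field_simps)
  qed
  have us: "u j \<in> sqint" for j using sol_sqint(3)[OF s[of j]] .
  have "c\<^sup>2 = ip (u 0) (u (2 * m))" unfolding c(2) by (rule sol_chain_norm[where u = u and G = G, OF s])
  also have "\<dots> \<le> (\<integral>x. n * c * \<psi> x \<partial>lebesgue)"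
    unfolding ip_def
  proof (rule integral_mono_AE)
    show "integrable lebesgue (\<lambda>x. u 0 x \<bullet> u (2 * m) x)" by (intro sqint_inner_integrable us)
    show "integrable lebesgue (\<lambda>x. n * c * \<psi> x)" using test_function_integrable[OF \<psi>(1)] by simp
    show "AE x in lebesgue. u 0 x \<bullet> u (2 * m) x \<le> n * c * \<psi> x"
      using bound
    proof eventually_elim
      case (elim x)
      have "u 0 x \<bullet> u (2 * m) x \<le> norm (u 0 x) * norm (u (2 * m) x)" by (rule norm_cauchy_schwarz)
      also have "\<dots> \<le> \<psi> x * (n * c)" using elim \<psi>(2)[of x] by (simp add: u0 mult_left_mono)
      finally show ?case by (simp add: mult.commute)
    qed
  qed
  also have "\<dots> = n * c" using \<psi>(3) by simp
  finally have "c \<le> n" using c(1) by (simp add: power2_eq_square)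
  then have "c\<^sup>2 \<le> n\<^sup>2" using c(1) by (intro power_mono) auto
  then show ?thesis by (simp add: c(2))
qed simp

text \<open>One source serves both inequalities: its support is small enough for K to stay within e
  of \<open>K x0 x0\<close> and for w to stay below 1/6. As \<psi> is real, the real part of the
  bilinear pairing in \<open>is_continuous_kernel\<close> is the inner product with the
  source.\<close>

lemma kernel_diagonal_approx:
  fixes C :: "real^'n::finite \<Rightarrow> real^'n^'n" and w :: "real^'n \<Rightarrow> real"
  assumes ell: "elliptic (\<lambda>x. r\<^sup>2 *\<^sub>R C x) \<mu> \<Lambda>" and r: "r > 0"
    and K: "is_continuous_kernel (resolvent_power C r (2 * m)) K"
    and w: "smooth w" "w x0 < 1/6" and e: "e > 0"
  obtains u G \<psi> where "\<And>j. elliptic.sol (\<lambda>x. r\<^sup>2 *\<^sub>R C x) (u (Suc j)) (G (Suc j)) (u j)"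
    "u 0 = (\<lambda>x. complex_of_real (\<psi> x))" "\<psi> \<in> test_functions" "\<And>x. \<psi> x \<ge> 0" "(\<integral>x. \<psi> x \<partial>lebesgue) = 1"
    "\<And>x. \<psi> x \<noteq> 0 \<Longrightarrow> w x \<le> 1/6" "\<bar>ip (u m) (u m) - Re (K x0 x0)\<bar> \<le> e"
proof -
  interpret elliptic "\<lambda>x. r\<^sup>2 *\<^sub>R C x" \<mu> \<Lambda> by (rule ell)
  have Kc: "continuous_on UNIV (\<lambda>(x, y). K x y)" using K by (simp add: is_continuous_kernel_def)
  obtain d where d: "d > 0" "\<And>p. dist p (x0, x0) < d \<Longrightarrow> dist ((\<lambda>(x, y). K x y) p) (K x0 x0) < e"
    using Kc e unfolding continuous_on_iff by (metis UNIV_I case_prod_conv)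
  have "continuous_on UNIV w" using Ck_continuous w(1) by blast
  then obtain d' where d': "d' > 0" "\<And>x. dist x x0 < d' \<Longrightarrow> dist (w x) (w x0) < 1/6 - w x0"
    using w(2) unfolding continuous_on_iff by (metis UNIV_I diff_gt_0_iff_gt)
  define \<delta> where "\<delta> = min (d / 2) d'"
  have \<delta>: "\<delta> > 0" using d d' by (simp add: \<delta>_def)
  have near: "norm (K x y - K x0 x0) \<le> e" if "norm (x - x0) < \<delta>" "norm (y - x0) < \<delta>" for x y
  proof -
    have "dist (x, y) (x0, x0) \<le> dist x x0 + dist y x0"
      unfolding dist_Pair_Pair by (rule sqrt_sum_squares_le_sum) auto
    also have "\<dots> < d" using that by (simp add: \<delta>_def dist_norm)
    finally show ?thesis using d(2)[of "(x, y)"] by (simp add: dist_norm)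
  qed
  obtain \<psi> :: "real^'n \<Rightarrow> real" where \<psi>: "\<psi> \<in> test_functions" "\<And>x. \<psi> x \<ge> 0"
      "(\<integral>x. \<psi> x \<partial>lebesgue) = 1" "\<And>x. norm (x - x0) \<ge> \<delta> \<Longrightarrow> \<psi> x = 0"
    using approximate_delta[OF \<delta>] by blast
  define f where "f x = complex_of_real (\<psi> x)" for x
  have f: "f \<in> test_functions" unfolding f_def[abs_def] by (rule test_function_of_real[OF \<psi>(1)])
  obtain u G where u: "u 0 = f" and s: "\<And>j::nat. sol (u (Suc j)) (G (Suc j)) (u j)"
    using sol_chain_exists[OF test_function_sqint[OF f]] by blast
  have us: "u j \<in> sqint" for j using sol_sqint(3)[OF s[of j]] .
  show ?thesis
  proof (rule that[of u G \<psi>, OF s])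
    show "u 0 = (\<lambda>x. complex_of_real (\<psi> x))" by (simp add: u f_def[abs_def])
    show "w x \<le> 1/6" if "\<psi> x \<noteq> 0" for x
    proof -
      have "norm (x - x0) < d'" using \<psi>(4)[of x] that by (force simp: \<delta>_def)
      then show ?thesis using d'(2)[of x] by (simp add: dist_norm)
    qed
    have mem: "(f, u (2 * m)) \<in> resolvent_power C r (2 * m)"
      using resolvent_power_of_sol_chain[OF ell r, where u = u and G = G, OF s, of 0 "2 * m"] by (simp add: u)
    have "ip (u m) (u m) = ip f (u (2 * m))" using sol_chain_norm[where u = u and G = G, OF s, of m] by (simp add: u)
    also have "\<dots> = Re (\<integral>x. f x * u (2 * m) x \<partial>lebesgue)"
      unfolding ip_def using sqint_mult_integrable[OF test_function_sqint[OF f] us]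
      by (subst integral_Re[symmetric]) (auto simp: f_def inner_complex_def)
    also have "(\<integral>x. f x * u (2 * m) x \<partial>lebesgue) = (\<integral>x. (\<integral>y. f x * K x y * f y \<partial>lebesgue) \<partial>lebesgue)"
      using K mem f by (simp add: is_continuous_kernel_def)
    finally have "ip (u m) (u m) - Re (K x0 x0)
        = Re ((\<integral>x. (\<integral>y. f x * K x y * f y \<partial>lebesgue) \<partial>lebesgue) - K x0 x0)" by simp
    also have "\<bar>\<dots>\<bar> \<le> norm ((\<integral>x. (\<integral>y. f x * K x y * f y \<partial>lebesgue) \<partial>lebesgue) - K x0 x0)"
      by (rule abs_Re_le_cmod)
    also have "\<dots> \<le> e" unfolding f_def by (rule kernel_average[OF Kc near \<psi>])
    finally show "\<bar>ip (u m) (u m) - Re (K x0 x0)\<bar> \<le> e" .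
  qed (rule \<psi>)+
qed

text \<open>Reciprocals are taken in \<open>ennreal\<close>, where \<open>inverse 0\<close> is
  infinite. On a ball of finite measure the first inequality therefore includes that the diagonal
  value is strictly positive.\<close>

theorem theorem5p1:
  fixes m :: nat
  assumes "4 * m > CARD('n::finite)"
  shows "\<exists>a::real. a > 0 \<and>
    (\<forall>C :: real^'n \<Rightarrow> real^'n^'n. strongly_elliptic C \<longrightarrow>
      (\<forall>r>0. \<forall>K. is_continuous_kernel (resolvent_power C r (2 * m)) K \<longrightarrow>
        (\<forall>x. ennreal a * emeasure lebesgue (ball_C C x r) \<ge> inverse (ennreal (Re (K x x))) \<and>
             inverse (ennreal (Re (K x x))) \<ge> inverse ((norm_2_inf (resolvent_power C r m))\<^sup>2))))"
proof (intro exI conjI allI impI)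
  show "(lower_const m)\<^sup>2 > 0" using lower_const_pos[of m] by simp
  fix C :: "real^'n \<Rightarrow> real^'n^'n" and r :: real and K x0
  assume C: "strongly_elliptic C" and r: "r > 0" and K: "is_continuous_kernel (resolvent_power C r (2 * m)) K"
  obtain \<mu> \<Lambda> where ell: "elliptic (\<lambda>x. r\<^sup>2 *\<^sub>R C x) \<mu> \<Lambda>"
    and ellC: "AE x in lebesgue. \<forall>\<xi>. \<mu> / r\<^sup>2 * (\<xi> \<bullet> \<xi>) \<le> \<xi> \<bullet> (C x *v \<xi>)" and \<mu>: "\<mu> > 0"
    using strongly_elliptic_elliptic[OF C r] by blast
  define B where "B = ball_C C x0 r"
  have op: "open B" unfolding B_def using open_ball_C[OF ellC] \<mu> r by simp
  obtain w where w: "smooth w" "AE x in lebesgue. grad w x \<bullet> ((r\<^sup>2 *\<^sub>R C x) *v grad w x) \<le> 1"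
    "(\<lambda>x. step (w x)) \<in> test_functions" "\<And>x. x \<notin> B \<Longrightarrow> w x \<ge> 2/3" "w x0 < 1/6"
    using cutoff_exists[OF ell r op[unfolded B_def]] unfolding B_def by blast
  define k where "k = Re (K x0 x0)"
  show "ennreal ((lower_const m)\<^sup>2) * emeasure lebesgue (ball_C C x0 r) \<ge> inverse (ennreal (Re (K x0 x0)))"
    unfolding B_def[symmetric] k_def[symmetric]
  proof (cases "emeasure lebesgue B < \<infinity>")
    case True
    define b where "b = measure lebesgue B"
    have b: "emeasure lebesgue B = ennreal b" "b \<ge> 0"
      using True by (auto simp: b_def emeasure_eq_ennreal_measure)
    have le: "1 \<le> (lower_const m)\<^sup>2 * b * (k + e)" if e: "e > 0" for e
    proof -
      obtain u G \<psi> where s: "\<And>j. elliptic.sol (\<lambda>x. r\<^sup>2 *\<^sub>R C x) (u (Suc j)) (G (Suc j)) (u j)"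
        and \<psi>: "u 0 = (\<lambda>x. complex_of_real (\<psi> x))" "(\<integral>x. \<psi> x \<partial>lebesgue) = 1"
          "\<And>x. \<psi> x \<noteq> 0 \<Longrightarrow> w x \<le> 1/6" and near': "\<bar>ip (u m) (u m) - Re (K x0 x0)\<bar> \<le> e"
        by (rule kernel_diagonal_approx[OF ell r K w(1,5) e], rule that)
      note near = near'[folded k_def]
      have "1 \<le> lower_const m * sqrt b * sqrt (ip (u m) (u m))"
        unfolding b_def
        by (rule elliptic.local_lower_bound[where u = u and G = G, OF ell s w(1,2,3) _ True w(4) \<psi>]) (use op in auto)
      then have "1\<^sup>2 \<le> (lower_const m * sqrt b * sqrt (ip (u m) (u m)))\<^sup>2" by (intro power_mono) auto
      also have "\<dots> = (lower_const m)\<^sup>2 * b * ip (u m) (u m)"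
        using b(2) by (simp add: power_mult_distrib ip_nonneg)
      also have "\<dots> \<le> (lower_const m)\<^sup>2 * b * (k + e)"
        using near b(2) by (intro mult_left_mono) auto
      finally show ?thesis by simp
    qed
    have "1 \<le> (lower_const m)\<^sup>2 * b * k"
    proof (rule field_le_epsilon)
      fix e :: real assume e: "e > 0"
      \<comment> \<open>The added 1 allows division by q even if b is 0, and e / q then costs at
        most e after multiplication by the coefficient of k.\<close>
      define q where "q = (lower_const m)\<^sup>2 * b + 1"
      have q: "q > 0" using b(2) by (simp add: q_def add_nonneg_pos)
      have "1 \<le> (lower_const m)\<^sup>2 * b * (k + e / q)" using e q by (intro le) simp
      also have "\<dots> = (lower_const m)\<^sup>2 * b * k + ((lower_const m)\<^sup>2 * b) * (e / q)" by (simp add: distrib_left)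
      also have "((lower_const m)\<^sup>2 * b) * (e / q) \<le> q * (e / q)"
        using e q by (intro mult_right_mono) (auto simp: q_def)
      also have "\<dots> = e" using q by simp
      finally show "1 \<le> (lower_const m)\<^sup>2 * b * k + e" by simp
    qed
    \<comment> \<open>Positivity of the diagonal is an outcome of the lower bound; without it the
      reciprocal would be infinite.\<close>
    moreover from this have "k > 0" using b(2)
      by (smt (verit) mult_nonneg_nonneg mult_nonneg_nonpos zero_le_power2)
    ultimately have "inverse k \<le> (lower_const m)\<^sup>2 * b" by (simp add: field_simps)
    then show "ennreal ((lower_const m)\<^sup>2) * emeasure lebesgue B \<ge> inverse (ennreal k)"
      using \<open>k > 0\<close> b by (simp add: inverse_ennreal ennreal_mult[symmetric] ennreal_leI)
  next
    case False
    then have "emeasure lebesgue B = \<infinity>" by (simp add: less_top[symmetric])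
    then show "ennreal ((lower_const m)\<^sup>2) * emeasure lebesgue B \<ge> inverse (ennreal k)"
      using lower_const_pos[of m] by (simp add: ennreal_mult_top)
  qed
  show "inverse (ennreal (Re (K x0 x0))) \<ge> inverse ((norm_2_inf (resolvent_power C r m))\<^sup>2)"
    unfolding k_def[symmetric]
  proof (cases "norm_2_inf (resolvent_power C r m)")
    case top
    then show "inverse ((norm_2_inf (resolvent_power C r m))\<^sup>2) \<le> inverse (ennreal k)"
      by (simp add: power2_eq_square)
  next
    case (real n)
    have "k \<le> n\<^sup>2"
    proof (rule field_le_epsilon)
      fix e :: real assume e: "e > 0"
      obtain u G \<psi> where s: "\<And>j. elliptic.sol (\<lambda>x. r\<^sup>2 *\<^sub>R C x) (u (Suc j)) (G (Suc j)) (u j)"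
        and \<psi>: "u 0 = (\<lambda>x. complex_of_real (\<psi> x))" "\<psi> \<in> test_functions" "\<And>x. \<psi> x \<ge> 0" "(\<integral>x. \<psi> x \<partial>lebesgue) = 1"
        and near': "\<bar>ip (u m) (u m) - Re (K x0 x0)\<bar> \<le> e"
        by (rule kernel_diagonal_approx[OF ell r K w(1,5) e], rule that)
      note near = near'[folded k_def]
      have "ip (u m) (u m) \<le> n\<^sup>2" by (rule norm_le_norm_2_inf[where u = u and G = G, OF ell r s \<psi> real(2,1)])
      then show "k \<le> n\<^sup>2 + e" using near by linarith
    qed
    show "inverse ((norm_2_inf (resolvent_power C r m))\<^sup>2) \<le> inverse (ennreal k)"
    \<comment> \<open>For k \<le> 0 the truncation in \<open>ennreal\<close> makes the right-hand
      reciprocal infinite, so nothing remains to be shown.\<close>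
    proof (cases "k > 0")
      case True
      then have "inverse (n\<^sup>2) \<le> inverse k" using \<open>k \<le> n\<^sup>2\<close> by (intro le_imp_inverse_le)
      then show ?thesis
        using True \<open>k \<le> n\<^sup>2\<close> less_le_trans[OF True \<open>k \<le> n\<^sup>2\<close>] real
        by (simp add: ennreal_power inverse_ennreal ennreal_leI)
    qed (simp add: ennreal_neg)
  qed
qed

end
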